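(* Let $(M^{2n},J,\omega)$ be a compact complex manifold equipped with a pluriclosed Hermitian metric $\omega$. If there exists $f\in C^\infty(M)$ such that $\hat\omega:=e^f\omega$ is balanced, i.e. $d^*_{\hat\omega}\hat\omega=0$, then $\omega$ and $\hat\omega$ are both Kähler.
   Context: $M^{2n}$ has real dimension $2n$. A Hermitian metric is identified with its fundamental $(1,1)$-form $\omega$. It is pluriclosed if $\partial\bar\partial\omega=0$ (equivalently $dd^c\omega=0$) and Kähler if $d\omega=0$. $d^*_{\hat\omega}$ is the adjoint of $d$ with respect to the metric of $\hat\omega$. *)

theory Defs
  imports "HOL-Analysis.Analysis"
begin

primrec Ck_on :: "nat \<Rightarrow> ('a::real_normed_vector \<Rightarrow> 'b::real_normed_vector) \<Rightarrow> 'a set \<Rightarrow> bool" where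
  "Ck_on 0 f S \<longleftrightarrow> continuous_on S f"
| "Ck_on (Suc k) f S \<longleftrightarrow>
     (\<forall>x\<in>S. f differentiable (at x)) \<and> (\<forall>v. Ck_on k (\<lambda>x. frechet_derivative f (at x) v) S)"

text \<open>Only used for open \<^term>\<open>S\<close>.\<close>

definition smooth_on :: "('a::real_normed_vector \<Rightarrow> 'b::real_normed_vector) \<Rightarrow> 'a set \<Rightarrow> bool" where
  "smooth_on f S \<longleftrightarrow> (\<forall>k. Ck_on k f S)"

text \<open>A chart is a pair \<open>(U, \<phi>)\<close> of an open set and a homeomorphism onto an open subset of complex
  \<open>n\<close>-space. The almost complex structure \<open>J\<close> of the manifold is, in every chart, multiplication of
  tangent vectors by \<open>\<i>\<close>; it does not depend on the chart because transition maps have complex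
  linear differentials.\<close>

type_synonym ('m, 'n) chart = "'m set \<times> ('m \<Rightarrow> complex^'n)"

abbreviation J :: "complex^'n \<Rightarrow> complex^'n::finite" where
  "J v \<equiv> \<i> *s v"

definition image_of :: "('m, 'n) chart \<Rightarrow> (complex^'n::finite) set" where
  "image_of c = snd c ` fst c"

definition inv_chart :: "('m, 'n) chart \<Rightarrow> complex^'n::finite \<Rightarrow> 'm" where
  "inv_chart c = inv_into (fst c) (snd c)"

definition is_chart :: "'m topology \<Rightarrow> ('m, 'n::finite) chart \<Rightarrow> bool" where
  "is_chart X c \<longleftrightarrow> openin X (fst c) \<and> open (image_of c) \<and>
     homeomorphic_map (subtopology X (fst c)) (top_of_set (image_of c)) (snd c)"

definition transition :: "('m, 'n) chart \<Rightarrow> ('m, 'n) chart \<Rightarrow> complex^'n \<Rightarrow> complex^'n::finite" where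
  "transition c c' = snd c' \<circ> inv_chart c"

definition holomorphic_map_on :: "(complex^'n \<Rightarrow> complex^'n) \<Rightarrow> (complex^'n::finite) set \<Rightarrow> bool" where
  "holomorphic_map_on F S \<longleftrightarrow> smooth_on F S \<and>
     (\<forall>x\<in>S. \<forall>v. frechet_derivative F (at x) (J v) = J (frechet_derivative F (at x) v))"

definition complex_manifold :: "'m topology \<Rightarrow> ('m, 'n::finite) chart set \<Rightarrow> bool" where
  "complex_manifold X A \<longleftrightarrow>
     Hausdorff_space X \<and> second_countable X \<and>
     (\<forall>c\<in>A. is_chart X c) \<and> (\<Union>c\<in>A. fst c) = topspace X \<and>
     (\<forall>c\<in>A. \<forall>c'\<in>A. holomorphic_map_on (transition c c') (snd c ` (fst c \<inter> fst c')))"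

definition smooth_function :: "('m, 'n::finite) chart set \<Rightarrow> ('m \<Rightarrow> real) \<Rightarrow> bool" where
  "smooth_function A f \<longleftrightarrow> (\<forall>c\<in>A. smooth_on (f \<circ> inv_chart c) (image_of c))"

text \<open>A real differential \<open>k\<close>-form is given by its local representatives: \<open>\<alpha> c x [v\<^sub>1, \<dots>, v\<^sub>k]\<close> is its
  value, in the chart \<open>c\<close> and at the point with coordinates \<open>x\<close>, on the tangent vectors
  \<open>v\<^sub>1, \<dots>, v\<^sub>k\<close>. Values at \<open>x\<close> outside \<open>image_of c\<close> and on lists of other lengths are irrelevant.\<close>

type_synonym ('m, 'n) form = "('m, 'n) chart \<Rightarrow> complex^'n \<Rightarrow> (complex^'n) list \<Rightarrow> real"

definition alternating_multilinear :: "nat \<Rightarrow> ('v::real_vector list \<Rightarrow> real) \<Rightarrow> bool" where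
  "alternating_multilinear k a \<longleftrightarrow>
     (\<forall>vs. length vs = k \<longrightarrow>
        (\<forall>i<k. linear (\<lambda>v. a (vs[i := v]))) \<and>
        (\<forall>i<k. \<forall>j<k. i \<noteq> j \<and> vs ! i = vs ! j \<longrightarrow> a vs = 0))"

definition differential_form ::
  "('m, 'n::finite) chart set \<Rightarrow> nat \<Rightarrow> ('m, 'n) form \<Rightarrow> bool" where
  "differential_form A k \<alpha> \<longleftrightarrow>
     (\<forall>c\<in>A. \<forall>x\<in>image_of c. alternating_multilinear k (\<alpha> c x)) \<and>
     (\<forall>c\<in>A. \<forall>vs. length vs = k \<longrightarrow> smooth_on (\<lambda>x. \<alpha> c x vs) (image_of c)) \<and>
     (\<forall>c\<in>A. \<forall>c'\<in>A. \<forall>p\<in>fst c \<inter> fst c'. \<forall>vs. length vs = k \<longrightarrow>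
        \<alpha> c (snd c p) vs =
        \<alpha> c' (snd c' p) (map (frechet_derivative (transition c c') (at (snd c p))) vs))"

definition form_vanishes :: "('m, 'n::finite) chart set \<Rightarrow> nat \<Rightarrow> ('m, 'n) form \<Rightarrow> bool" where
  "form_vanishes A k \<alpha> \<longleftrightarrow> (\<forall>c\<in>A. \<forall>x\<in>image_of c. \<forall>vs. length vs = k \<longrightarrow> \<alpha> c x vs = 0)"

text \<open>The invariant formula for the exterior derivative on constant vector fields (whose Lie
  brackets vanish):
  \<open>d\<alpha>(v\<^sub>0, \<dots>, v\<^sub>k) = \<Sum>\<^sub>i (-1)\<^sup>i D\<^bsub>v\<^sub>i\<^esub> \<alpha>(v\<^sub>0, \<dots>, v\<^sub>i omitted, \<dots>, v\<^sub>k)\<close>.\<close>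

definition ext_d :: "('m, 'n::finite) form \<Rightarrow> ('m, 'n) form" where
  "ext_d \<alpha> c x vs =
     (\<Sum>i<length vs. (-1) ^ i *
        frechet_derivative (\<lambda>y. \<alpha> c y (take i vs @ drop (Suc i) vs)) (at x) (vs ! i))"

text \<open>\<open>d\<^sup>c = J\<inverse> d J\<close> with \<open>(J\<alpha>)(v\<^sub>1, \<dots>, v\<^sub>k) = \<alpha>(Jv\<^sub>1, \<dots>, Jv\<^sub>k)\<close>. As \<open>J\<close> multiplies forms of type
  \<open>(p,q)\<close> by \<open>\<i>\<close> to the power \<open>p - q\<close>, this is the usual operator \<open>\<i>(\<partial>bar - \<partial>)\<close>, so that
  \<open>dd\<^sup>c = 2\<i>\<partial>\<partial>bar\<close>.\<close>

definition pull_J :: "('m, 'n::finite) form \<Rightarrow> ('m, 'n) form" where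
  "pull_J \<alpha> c x vs = \<alpha> c x (map J vs)"

definition pull_J_inv :: "('m, 'n::finite) form \<Rightarrow> ('m, 'n) form" where
  "pull_J_inv \<alpha> c x vs = \<alpha> c x (map (\<lambda>v. - J v) vs)"

definition ext_dc :: "('m, 'n::finite) form \<Rightarrow> ('m, 'n) form" where
  "ext_dc \<alpha> = pull_J_inv (ext_d (pull_J \<alpha>))"

text \<open>A Hermitian metric \<open>g\<close> is identified with its fundamental form \<open>\<omega>(v, w) = g(Jv, w)\<close>, a real
  form of type \<open>(1,1)\<close>, that is, a \<open>J\<close>-invariant real \<open>2\<close>-form; conversely \<open>g(v, w) = \<omega>(v, Jw)\<close>.\<close>

definition metric_of :: "('m, 'n::finite) form \<Rightarrow> ('m, 'n) chart \<Rightarrow> complex^'n \<Rightarrow>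
    complex^'n \<Rightarrow> complex^'n \<Rightarrow> real" where
  "metric_of \<omega> c x v w = \<omega> c x [v, J w]"

definition hermitian_metric :: "('m, 'n::finite) chart set \<Rightarrow> ('m, 'n) form \<Rightarrow> bool" where
  "hermitian_metric A \<omega> \<longleftrightarrow> differential_form A 2 \<omega> \<and>
     (\<forall>c\<in>A. \<forall>x\<in>image_of c. (\<forall>v w. \<omega> c x [J v, J w] = \<omega> c x [v, w]) \<and>
        (\<forall>v. v \<noteq> 0 \<longrightarrow> metric_of \<omega> c x v v > 0))"

definition conformal :: "('m \<Rightarrow> real) \<Rightarrow> ('m, 'n::finite) form \<Rightarrow> ('m, 'n) form" where
  "conformal f \<omega> c x vs = exp (f (inv_chart c x)) * \<omega> c x vs"

definition pluriclosed :: "('m, 'n::finite) chart set \<Rightarrow> ('m, 'n) form \<Rightarrow> bool" where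
  "pluriclosed A \<omega> \<longleftrightarrow> form_vanishes A 4 (ext_d (ext_dc \<omega>))"

definition kaehler_metric :: "('m, 'n::finite) chart set \<Rightarrow> ('m, 'n) form \<Rightarrow> bool" where
  "kaehler_metric A \<omega> \<longleftrightarrow> hermitian_metric A \<omega> \<and> form_vanishes A 3 (ext_d \<omega>)"

text \<open>The pointwise inner product
  \<open>\<langle>a, b\<rangle> = 1/k! \<Sum> a\<^bsub>i\<^sub>1 \<dots> i\<^sub>k\<^esub> b\<^bsup>i\<^sub>1 \<dots> i\<^sub>k\<^esup>\<close> of \<open>k\<close>-covectors, i.e. the one for which the
  \<open>k\<close>-fold wedge products of a \<open>g\<close>-orthonormal coframe are orthonormal.
  Indices are raised with the vectors \<open>\<Sum>\<^sub>j g\<^bsup>ij\<^esup> e\<^sub>j\<close>, which are \<open>g\<close>-dual to the coordinate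
  covectors of \<open>e\<^sub>i\<close>; this is \<open>raise g e\<^sub>i\<close>.\<close>

definition raise :: "('v \<Rightarrow> 'v \<Rightarrow> real) \<Rightarrow> 'v::euclidean_space \<Rightarrow> 'v" where
  "raise g b = (THE w. \<forall>v. g w v = b \<bullet> v)"

definition covector_inner :: "('v \<Rightarrow> 'v \<Rightarrow> real) \<Rightarrow> nat \<Rightarrow>
    ('v::euclidean_space list \<Rightarrow> real) \<Rightarrow> ('v list \<Rightarrow> real) \<Rightarrow> real" where
  "covector_inner g k a b =
     (\<Sum>bs | set bs \<subseteq> Basis \<and> length bs = k. a bs * b (map (raise g) bs)) / fact k"

text \<open>The chart used to evaluate at \<^term>\<open>p\<close> does not matter for differential forms and for
  the metric of a Hermitian form.\<close>

definition form_inner :: "('m, 'n::finite) chart set \<Rightarrow> ('m, 'n) form \<Rightarrow> nat \<Rightarrow>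
    ('m, 'n) form \<Rightarrow> ('m, 'n) form \<Rightarrow> 'm \<Rightarrow> real" where
  "form_inner A \<omega> k \<alpha> \<beta> p =
     (let c = (SOME c. c \<in> A \<and> p \<in> fst c); x = snd c p
      in covector_inner (metric_of \<omega> c x) k (\<alpha> c x) (\<beta> c x))"

text \<open>The density \<open>sqrt (det (g\<^sub>i\<^sub>j))\<close> with respect to the real coordinates
  \<open>Re z\<^sub>j\<close> (index \<open>Inl j\<close>) and \<open>Im z\<^sub>j\<close> (index \<open>Inr j\<close>).\<close>

definition real_frame :: "'n + 'n \<Rightarrow> complex^'n::finite" where
  "real_frame s = (case s of Inl j \<Rightarrow> axis j 1 | Inr j \<Rightarrow> axis j \<i>)"

definition volume_density :: "(complex^'n \<Rightarrow> complex^'n::finite \<Rightarrow> real) \<Rightarrow> real" where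
  "volume_density g =
     sqrt (det (\<chi> s t. g (real_frame s) (real_frame t) :: real^('n + 'n)^('n + 'n)))"

text \<open>The Riemannian volume measure of \<open>\<omega>\<close>. On a complex manifold (second countable)
  with Hermitian metric \<open>\<omega>\<close>, exactly one Borel measure has this property.\<close>

definition is_volume_measure :: "'m topology \<Rightarrow> ('m, 'n::finite) chart set \<Rightarrow> ('m, 'n) form \<Rightarrow>
    'm measure \<Rightarrow> bool" where
  "is_volume_measure X A \<omega> \<mu> \<longleftrightarrow>
     space \<mu> = topspace X \<and> sets \<mu> = sigma_sets (topspace X) {U. openin X U} \<and>
     (\<forall>c\<in>A. \<forall>S\<in>sets \<mu>. S \<subseteq> fst c \<longrightarrow>
        emeasure \<mu> S =
        (\<integral>\<^sup>+x\<in>snd c ` S. ennreal (volume_density (metric_of \<omega> c x)) \<partial>lborel))"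

text \<open>\<open>is_codifferential X A \<omega> k \<beta> \<gamma>\<close> says \<open>d\<^sup>*\<beta> = \<gamma>\<close> for a \<open>(k+1)\<close>-form \<open>\<beta>\<close>, where \<open>d\<^sup>*\<close> is the
  adjoint of \<open>d\<close> for the \<open>L\<^sup>2\<close> inner product given by the metric of \<open>\<omega>\<close>, on a compact \<open>X\<close>.\<close>

definition is_codifferential :: "'m topology \<Rightarrow> ('m, 'n::finite) chart set \<Rightarrow> ('m, 'n) form \<Rightarrow>
    nat \<Rightarrow> ('m, 'n) form \<Rightarrow> ('m, 'n) form \<Rightarrow> bool" where
  "is_codifferential X A \<omega> k \<beta> \<gamma> \<longleftrightarrow> differential_form A k \<gamma> \<and>
     (\<exists>\<mu>. is_volume_measure X A \<omega> \<mu> \<and>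
        (\<forall>\<alpha>. differential_form A k \<alpha> \<longrightarrow>
           (\<integral>p. form_inner A \<omega> (Suc k) (ext_d \<alpha>) \<beta> p \<partial>\<mu>) = (\<integral>p. form_inner A \<omega> k \<alpha> \<gamma> p \<partial>\<mu>)))"

definition balanced :: "'m topology \<Rightarrow> ('m, 'n::finite) chart set \<Rightarrow> ('m, 'n) form \<Rightarrow> bool" where
  "balanced X A \<omega> \<longleftrightarrow> is_codifferential X A \<omega> 1 \<omega> (\<lambda>c x vs. 0)"

end

theory Submission
  imports Defs
begin

text \<open>Put \<open>m = 2n\<close>, let \<open>g\<close> be the metric of \<open>\<omega>\<close>, \<open>D\<close> the derivative in a chart, let \<open>e\<close>, \<open>e'\<close> run
  through a \<open>g\<close>-orthonormal basis at a point, and let \<open>Lf = \<Sum>\<^sub>e D\<^sub>e D\<^sub>e f\<close>.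

  Testing the balanced condition for \<open>e\<^sup>f \<omega>\<close> with compactly supported \<open>1\<close>-forms in a chart gives the
  pointwise equation (star): for all \<open>w\<close>,
  \<open>\<Sum>\<^sub>e (\<onehalf> D\<^bsub>Jw\<^esub> \<omega>(e, Je) + D\<^sub>e \<omega>(e, w)) + (m/2 - 1) D\<^bsub>Jw\<^esub> f = 0\<close>.
  Differentiate it in the direction \<open>e'\<close>, put \<open>w = Je'\<close> and sum over \<open>e'\<close>. The second derivatives of
  \<open>\<omega>\<close> assemble to the full trace of \<open>dd\<^sup>c\<omega>\<close>, which vanishes, and the terms quadratic in its first
  derivatives assemble to \<open>|d\<omega>|\<^sup>2\<close>. The result is \<open>|d\<omega>|\<^sup>2 = 3 (m - 2) Lf\<close>.

  Hence \<open>Lf \<ge> 0\<close> unless \<open>m = 2\<close>. Since \<open>e\<^bsup>-f\<^esup> Lf\<close> is the inner product of \<open>dd\<^sup>cf\<close> and \<open>e\<^sup>f \<omega>\<close> in the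
  metric of \<open>e\<^sup>f \<omega>\<close>, its integral vanishes, so that \<open>Lf = 0\<close> and \<open>d\<omega> = 0\<close>. Now (star) reduces to
  \<open>(m - 2) df = 0\<close>: if \<open>m > 2\<close>, then \<open>f\<close> is locally constant, and if \<open>m = 2\<close>, every \<open>3\<close>-form vanishes.\<close>


section \<open>Smooth functions\<close>

text \<open>All computations take place in one chart with constant vector fields, so the data are
  just the partial derivatives of \<omega>. The condition \<open>balanced\<close> is a weak one. It
  is tested with \<phi> l, where \<phi> is a bump function and l a constant covector: the inner
  product of d(\<phi> l) with the fundamental form is - d\<phi>(J l#), where l# is the raised
  covector, so J l# times the volume density is divergence free. In (star) the factor 1/2 comes from
  differentiating the density and the other term from differentiating the inverse metric; m/2 and -1
  arise when these two terms meet the derivative of the conformal factor. Differentiating the trace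
  in (star) differentiates the inverse metric once more, which is the source of the quadratic terms.
  Pluriclosedness enters through one scalar: all second derivatives in the trace of dd^c \<omega>
  reduce to two sums, and (star) produces the same combination of them up to a constant. The
  integral of e^-f Lf vanishes because the balanced condition is tested a second time, now with the
  global 1-form d^c f.\<close>

abbreviation fd :: "('a::real_normed_vector \<Rightarrow> 'b::real_normed_vector) \<Rightarrow> 'a \<Rightarrow> 'a \<Rightarrow> 'b" where
  "fd f x \<equiv> frechet_derivative f (at x)"

lemma fd_eqI: "(f has_derivative f') (at x) \<Longrightarrow> fd f x = f'"
  by (simp add: frechet_derivative_at[symmetric])

lemma fd_works: "f differentiable (at x) \<Longrightarrow> (f has_derivative fd f x) (at x)"
  by (simp add: frechet_derivative_works)

lemma Ck_on_subset: "Ck_on k f S \<Longrightarrow> T \<subseteq> S \<Longrightarrow> Ck_on k f T"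
  by (induction k arbitrary: f) (auto intro: continuous_on_subset)

lemma Ck_on_cong:
  assumes "open S" "\<And>x. x \<in> S \<Longrightarrow> f x = g x" "Ck_on k f S"
  shows "Ck_on k g S"
  using assms(2,3)
proof (induction k arbitrary: f g)
  case 0
  then show ?case by (metis Ck_on.simps(1) continuous_on_cong)
next
  case (Suc k)
  have D: "(g has_derivative fd f x) (at x)" if "x \<in> S" for x
    using Suc.prems that
    by (intro has_derivative_transform_within_open[OF fd_works \<open>open S\<close>]) auto
  have "Ck_on k (\<lambda>x. fd g x v) S" for v
  proof (rule Suc.IH)
    show "fd f x v = fd g x v" if "x \<in> S" for x
      using fd_eqI[OF D[OF that]] by simp
  qed (use Suc.prems in auto)
  then show ?case using D by (auto simp: differentiable_def)
qed

lemma Ck_on_open_local: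
  assumes "\<And>x. x \<in> S \<Longrightarrow> \<exists>U. open U \<and> x \<in> U \<and> Ck_on k f U"
  shows "Ck_on k f S"
  using assms
proof (induction k arbitrary: f)
  case 0
  then have "isCont f x" if "x \<in> S" for x
    using that by (metis Ck_on.simps(1) continuous_on_eq_continuous_at)
  then show ?case by (simp add: continuous_at_imp_continuous_on)
next
  case (Suc k)
  have "f differentiable (at x)" if "x \<in> S" for x
    using Suc.prems[OF that] by auto
  moreover have "Ck_on k (\<lambda>x. fd f x v) S" for v
    using Suc.prems by (intro Suc.IH) fastforce
  ultimately show ?case by simp
qed

lemma Ck_on_Suc_D: "Ck_on (Suc k) f S \<Longrightarrow> Ck_on k f S"
proof (induction k arbitrary: f)
  case 0
  then show ?case
    by (auto intro!: continuous_at_imp_continuous_on differentiable_imp_continuous_within)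
next
  case (Suc k)
  then show ?case by (metis Ck_on.simps(2))
qed

text \<open>Every later induction on the order of smoothness raises \<open>k\<close> by one through
  this rule, from an explicit formula for the derivative.\<close>

lemma Ck_on_SucI:
  assumes "open S" "\<And>x. x \<in> S \<Longrightarrow> (f has_derivative f' x) (at x)" "\<And>v. Ck_on k (\<lambda>x. f' x v) S"
  shows "Ck_on (Suc k) f S"
proof -
  have "Ck_on k (\<lambda>x. fd f x v) S" for v
    by (rule Ck_on_cong[OF assms(1) _ assms(3)]) (simp add: fd_eqI[OF assms(2)])
  then show ?thesis using assms(2) by (auto simp: differentiable_def)
qed

lemma Ck_on_const: "open S \<Longrightarrow> Ck_on k (\<lambda>x. c) S"
proof (induction k arbitrary: c)
  case (Suc k)
  then show ?case by (intro Ck_on_SucI[where f' = "\<lambda>x v. 0"]) auto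
qed simp

lemma Ck_on_linear:
  assumes "bounded_linear L" "open S"
  shows "Ck_on k L S"
proof (cases k)
  case 0
  then show ?thesis using assms(1) by (simp add: linear_continuous_on)
next
  case (Suc l)
  show ?thesis unfolding Suc
    by (rule Ck_on_SucI[where f' = "\<lambda>x. L"])
      (auto simp: assms bounded_linear_imp_has_derivative Ck_on_const)
qed

lemma Ck_on_linear_comp:
  assumes L: "bounded_linear L" and S: "open S" and f: "Ck_on k f S"
  shows "Ck_on k (\<lambda>x. L (f x)) S"
  using f
proof (induction k arbitrary: f)
  case 0
  then show ?case using L by (simp add: bounded_linear.continuous_on)
next
  case (Suc k)
  show ?case
    by (rule Ck_on_SucI[where f' = "\<lambda>x v. L (fd f x v)"])
      (use Suc S in \<open>auto intro!: bounded_linear.has_derivative[OF L] fd_works\<close>)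
qed

lemma Ck_on_add:
  assumes S: "open S" and "Ck_on k f S" "Ck_on k g S"
  shows "Ck_on k (\<lambda>x. f x + g x) S"
  using assms(2,3)
proof (induction k arbitrary: f g)
  case 0
  then show ?case by (simp add: continuous_on_add)
next
  case (Suc k)
  show ?case
    by (rule Ck_on_SucI[where f' = "\<lambda>x v. fd f x v + fd g x v"])
      (use Suc S in \<open>auto intro!: has_derivative_add fd_works\<close>)
qed

lemma Ck_on_sum:
  assumes S: "open S" and "\<And>i. i \<in> I \<Longrightarrow> Ck_on k (f i) S"
  shows "Ck_on k (\<lambda>x. \<Sum>i\<in>I. f i x) S"
  using assms(2)
  by (induction I rule: infinite_finite_induct) (auto simp: S Ck_on_const intro!: Ck_on_add)

lemma Ck_on_bilinear:
  assumes B: "bounded_bilinear B" and S: "open S" and "Ck_on k f S" "Ck_on k g S"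
  shows "Ck_on k (\<lambda>x. B (f x) (g x)) S"
  using assms(3,4)
proof (induction k arbitrary: f g)
  case 0
  then show ?case using B by (simp add: bounded_bilinear.continuous_on)
next
  case (Suc k)
  have "Ck_on k f S" "Ck_on k g S" using Suc.prems Ck_on_Suc_D by blast+
  then show ?case
    by (intro Ck_on_SucI[where f' = "\<lambda>x v. B (f x) (fd g x v) + B (fd f x v) (g x)"] Ck_on_add Suc.IH)
      (use Suc S in \<open>auto intro!: bounded_bilinear.FDERIV[OF B] fd_works\<close>)
qed

lemmas Ck_on_mult = Ck_on_bilinear[OF bounded_bilinear_mult]
  and Ck_on_scaleR = Ck_on_bilinear[OF bounded_bilinear_scaleR]

lemma linear_sum_Basis:
  fixes F :: "'a::euclidean_space \<Rightarrow> 'b::real_normed_vector"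
  assumes "linear F"
  shows "F v = (\<Sum>b\<in>Basis. (v \<bullet> b) *\<^sub>R F b)"
  by (metis (no_types, lifting) assms euclidean_representation linear_sum linear_scale sum.cong)

text \<open>The chain rule yields \<open>fd g (f x) (fd f x v)\<close>, where the vector argument
  moves with \<open>x\<close>, so the induction hypothesis does not apply directly. Expanding that
  vector in the basis leaves \<open>fd g (f x) b\<close> with \<open>b\<close> fixed; hence the
  Euclidean space in the middle.\<close>

lemma Ck_on_compose:
  fixes g :: "'b::euclidean_space \<Rightarrow> 'c::real_normed_vector"
  assumes S: "open S" and T: "open T" and sub: "f ` S \<subseteq> T" and "Ck_on k f S" "Ck_on k g T"
  shows "Ck_on k (\<lambda>x. g (f x)) S"
  using assms(4,5)
proof (induction k arbitrary: g)
  case 0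
  then show ?case using continuous_on_compose2[OF _ _ sub] by simp
next
  case (Suc k)
  have D: "((\<lambda>x. g (f x)) has_derivative (\<lambda>v. fd g (f x) (fd f x v))) (at x)" if "x \<in> S" for x
    using Suc.prems that sub has_derivative_compose[OF fd_works fd_works, of f x g] by auto
  have "Ck_on k (\<lambda>x. fd g (f x) (fd f x v)) S" for v
  proof -
    have "Ck_on k (\<lambda>x. \<Sum>b\<in>Basis. (fd f x v \<bullet> b) *\<^sub>R fd g (f x) b) S"
    proof (intro Ck_on_sum S Ck_on_scaleR)
      show "Ck_on k (\<lambda>x. fd f x v \<bullet> b) S" for b
        using Suc.prems S by (intro Ck_on_linear_comp[where L = "\<lambda>x. x \<bullet> b"] bounded_linear_inner_left) auto
      show "Ck_on k (\<lambda>x. fd g (f x) b) S" for b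
        using Suc.IH[where g = "\<lambda>y. fd g y b"] Suc.prems Ck_on_Suc_D by auto
    qed
    then show ?thesis
    proof (rule Ck_on_cong[OF S, rotated])
      fix x assume "x \<in> S"
      then have "linear (fd g (f x))"
        using Suc.prems sub by (auto intro!: linear_frechet_derivative)
      then show "(\<Sum>b\<in>Basis. (fd f x v \<bullet> b) *\<^sub>R fd g (f x) b) = fd g (f x) (fd f x v)"
        by (metis linear_sum_Basis)
    qed
  qed
  then show ?case using S by (intro Ck_on_SucI[OF _ D]) auto
qed

lemma Ck_on_exp: "Ck_on k (exp :: real \<Rightarrow> real) UNIV"
proof (induction k)
  case 0
  then show ?case by (simp add: continuous_on_exp)
next
  case (Suc k)
  have "Ck_on k (\<lambda>x. exp x * v) UNIV" for v :: real
    by (intro Ck_on_mult Suc Ck_on_const open_UNIV)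
  then show ?case
    by (intro Ck_on_SucI[where f' = "\<lambda>x v. exp x * v", OF open_UNIV])
      (use DERIV_exp in \<open>auto simp: has_field_derivative_def\<close>)
qed

lemma smooth_on_subset: "smooth_on f S \<Longrightarrow> T \<subseteq> S \<Longrightarrow> smooth_on f T"
  by (auto simp: smooth_on_def intro: Ck_on_subset)

lemma smooth_on_cong:
  "open S \<Longrightarrow> (\<And>x. x \<in> S \<Longrightarrow> f x = g x) \<Longrightarrow> smooth_on f S \<Longrightarrow> smooth_on g S"
  unfolding smooth_on_def by (blast intro: Ck_on_cong)

lemma smooth_on_Un: "open S \<Longrightarrow> open T \<Longrightarrow> smooth_on f S \<Longrightarrow> smooth_on f T \<Longrightarrow> smooth_on f (S \<union> T)"
  unfolding smooth_on_def by (blast intro: Ck_on_open_local)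

lemma smooth_on_const: "open S \<Longrightarrow> smooth_on (\<lambda>x. c) S"
  by (simp add: smooth_on_def Ck_on_const)

lemma smooth_on_linear: "bounded_linear L \<Longrightarrow> open S \<Longrightarrow> smooth_on L S"
  by (simp add: smooth_on_def Ck_on_linear)

lemma smooth_on_linear_comp:
  "bounded_linear L \<Longrightarrow> open S \<Longrightarrow> smooth_on f S \<Longrightarrow> smooth_on (\<lambda>x. L (f x)) S"
  by (simp add: smooth_on_def Ck_on_linear_comp)

lemma smooth_on_add: "open S \<Longrightarrow> smooth_on f S \<Longrightarrow> smooth_on g S \<Longrightarrow> smooth_on (\<lambda>x. f x + g x) S"
  by (simp add: smooth_on_def Ck_on_add)

lemma smooth_on_sum:
  "open S \<Longrightarrow> (\<And>i. i \<in> I \<Longrightarrow> smooth_on (f i) S) \<Longrightarrow> smooth_on (\<lambda>x. \<Sum>i\<in>I. f i x) S"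
  by (simp add: smooth_on_def Ck_on_sum)

lemma smooth_on_mult:
  fixes f g :: "'a::real_normed_vector \<Rightarrow> real"
  shows "open S \<Longrightarrow> smooth_on f S \<Longrightarrow> smooth_on g S \<Longrightarrow> smooth_on (\<lambda>x. f x * g x) S"
  by (simp add: smooth_on_def Ck_on_mult)

lemma smooth_on_uminus:
  fixes f :: "'a::real_normed_vector \<Rightarrow> real"
  shows "open S \<Longrightarrow> smooth_on f S \<Longrightarrow> smooth_on (\<lambda>x. - f x) S"
  by (rule smooth_on_linear_comp[OF bounded_linear_minus[OF bounded_linear_ident]])

lemma smooth_on_compose:
  fixes g :: "'b::euclidean_space \<Rightarrow> 'c::real_normed_vector"
  shows "open S \<Longrightarrow> open T \<Longrightarrow> f ` S \<subseteq> T \<Longrightarrow> smooth_on f S \<Longrightarrow> smooth_on g T \<Longrightarrow>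
    smooth_on (\<lambda>x. g (f x)) S"
  by (simp add: smooth_on_def Ck_on_compose)

lemma smooth_on_exp: "open S \<Longrightarrow> smooth_on f S \<Longrightarrow> smooth_on (\<lambda>x. exp (f x :: real)) S"
  by (rule smooth_on_compose[of _ UNIV]) (simp_all add: smooth_on_def Ck_on_exp)

lemma smooth_on_fd: "smooth_on f S \<Longrightarrow> smooth_on (\<lambda>x. fd f x v) S"
  unfolding smooth_on_def by (metis Ck_on.simps(2))

lemma smooth_on_differentiable: "smooth_on f S \<Longrightarrow> x \<in> S \<Longrightarrow> f differentiable (at x)"
  unfolding smooth_on_def by (metis Ck_on.simps(2))

lemma smooth_on_has_derivative: "smooth_on f S \<Longrightarrow> x \<in> S \<Longrightarrow> (f has_derivative fd f x) (at x)"
  using fd_works smooth_on_differentiable by blast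

lemma smooth_on_continuous: "smooth_on f S \<Longrightarrow> continuous_on S f"
  unfolding smooth_on_def by (metis Ck_on.simps(1))

lemma linear_fd: "smooth_on f S \<Longrightarrow> x \<in> S \<Longrightarrow> linear (fd f x)"
  using linear_frechet_derivative smooth_on_differentiable by blast

text \<open>\<open>frechet_derivative\<close> picks an element of the set of all derivatives at a
  point. Functions that agree near \<open>x\<close> have the same set there, so the pick is the same
  even if the set is empty.\<close>

lemma fd_cong:
  assumes "open S" "x \<in> S" "\<And>y. y \<in> S \<Longrightarrow> f y = g y"
  shows "fd f x = fd g x"
proof -
  have "(f has_derivative f') (at x) \<longleftrightarrow> (g has_derivative f') (at x)" for f'
    using assms by (metis has_derivative_transform_within_open)
  then show ?thesis by (simp add: frechet_derivative_def)
qed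

section \<open>Bump functions and integration by parts\<close>

lemma DERIV_line:
  fixes f :: "'a::real_normed_vector \<Rightarrow> real"
  assumes "f differentiable (at (a + s *\<^sub>R u))"
  shows "((\<lambda>s. f (a + s *\<^sub>R u)) has_real_derivative fd f (a + s *\<^sub>R u) u) (at s)"
proof -
  have l: "((\<lambda>s. a + s *\<^sub>R u) has_derivative (\<lambda>h. h *\<^sub>R u)) (at s)"
    by (auto intro!: derivative_eq_intros)
  have "((\<lambda>s. f (a + s *\<^sub>R u)) has_derivative (\<lambda>h. fd f (a + s *\<^sub>R u) (h *\<^sub>R u))) (at s)"
    by (rule has_derivative_compose[OF l fd_works[OF assms]])
  then show ?thesis
    using linear_frechet_derivative[OF assms]
    by (simp add: has_field_derivative_def linear_scale mult.commute[of _ "fd f _ _"])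
qed

text \<open>Two uses of the mean value theorem: in direction \<open>u\<close> for the increment of
  \<open>f\<close> across \<open>t v\<close>, then in direction \<open>v\<close> for the derivative
  of \<open>f\<close> along \<open>u\<close>.\<close>

lemma second_difference_MVT:
  fixes f :: "'a::real_normed_vector \<Rightarrow> real"
  assumes f: "smooth_on f S" and "t > 0"
    and S: "\<And>s r. 0 \<le> s \<Longrightarrow> s \<le> t \<Longrightarrow> 0 \<le> r \<Longrightarrow> r \<le> t \<Longrightarrow> x + s *\<^sub>R u + r *\<^sub>R v \<in> S"
  shows "\<exists>s r. 0 < s \<and> s < t \<and> 0 < r \<and> r < t \<and>
    f (x + t *\<^sub>R u + t *\<^sub>R v) - f (x + t *\<^sub>R u) - f (x + t *\<^sub>R v) + f x =
    t * t * fd (\<lambda>y. fd f y u) (x + s *\<^sub>R u + r *\<^sub>R v) v"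
proof -
  have "\<exists>s. 0 < s \<and> s < t \<and>
    (f ((x + t *\<^sub>R v) + t *\<^sub>R u) - f (x + t *\<^sub>R u)) - (f ((x + t *\<^sub>R v) + 0 *\<^sub>R u) - f (x + 0 *\<^sub>R u)) =
    (t - 0) * (fd f ((x + t *\<^sub>R v) + s *\<^sub>R u) u - fd f (x + s *\<^sub>R u) u)"
  proof (rule MVT2[OF \<open>t > 0\<close>])
    fix s assume "0 \<le> s" "s \<le> t"
    then have "x + t *\<^sub>R v + s *\<^sub>R u \<in> S" "x + s *\<^sub>R u \<in> S"
      using S[of s t] S[of s 0] \<open>t > 0\<close> by (auto simp: algebra_simps)
    then show "((\<lambda>s. f ((x + t *\<^sub>R v) + s *\<^sub>R u) - f (x + s *\<^sub>R u)) has_real_derivative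
        fd f ((x + t *\<^sub>R v) + s *\<^sub>R u) u - fd f (x + s *\<^sub>R u) u) (at s)"
      by (intro DERIV_diff DERIV_line smooth_on_differentiable[OF f])
  qed
  then obtain s where s: "0 < s" "s < t"
    "f (x + t *\<^sub>R u + t *\<^sub>R v) - f (x + t *\<^sub>R u) - f (x + t *\<^sub>R v) + f x =
      t * (fd f (x + s *\<^sub>R u + t *\<^sub>R v) u - fd f (x + s *\<^sub>R u) u)"
    by (auto simp: algebra_simps)
  have "\<exists>r. 0 < r \<and> r < t \<and>
    fd f ((x + s *\<^sub>R u) + t *\<^sub>R v) u - fd f ((x + s *\<^sub>R u) + 0 *\<^sub>R v) u =
    (t - 0) * fd (\<lambda>y. fd f y u) (x + s *\<^sub>R u + r *\<^sub>R v) v"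
  proof (rule MVT2[OF \<open>t > 0\<close>])
    fix r assume "0 \<le> r" "r \<le> t"
    then have "x + s *\<^sub>R u + r *\<^sub>R v \<in> S"
      using S[of s r] s by auto
    then show "((\<lambda>r. fd f ((x + s *\<^sub>R u) + r *\<^sub>R v) u) has_real_derivative
        fd (\<lambda>y. fd f y u) (x + s *\<^sub>R u + r *\<^sub>R v) v) (at r)"
      by (intro DERIV_line[where f = "\<lambda>y. fd f y u"] smooth_on_differentiable[OF smooth_on_fd[OF f]])
  qed
  then obtain r where r: "0 < r" "r < t"
    "fd f (x + s *\<^sub>R u + t *\<^sub>R v) u - fd f (x + s *\<^sub>R u) u =
      t * fd (\<lambda>y. fd f y u) (x + s *\<^sub>R u + r *\<^sub>R v) v"
    by auto
  have "f (x + t *\<^sub>R u + t *\<^sub>R v) - f (x + t *\<^sub>R u) - f (x + t *\<^sub>R v) + f x =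
    t * t * fd (\<lambda>y. fd f y u) (x + s *\<^sub>R u + r *\<^sub>R v) v"
    using s(3) r(3) by simp
  then show ?thesis using s r by blast
qed

text \<open>The second difference over a parallelogram is symmetric in \<open>u\<close> and
  \<open>v\<close>. By \<open>second_difference_MVT\<close> both mixed derivatives therefore take a
  common value arbitrarily near \<open>x\<close>, and both are continuous.\<close>

lemma second_derivative_symmetric:
  fixes f :: "'a::real_normed_vector \<Rightarrow> real"
  assumes f: "smooth_on f S" and S: "open S" "x \<in> S"
  shows "fd (\<lambda>y. fd f y u) x v = fd (\<lambda>y. fd f y v) x u"
proof (rule ccontr)
  define P where "P u v y = fd (\<lambda>y. fd f y u) y v" for u v y
  assume neq: "\<not> ?thesis"
  define e where "e = \<bar>P u v x - P v u x\<bar> / 2"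
  have "e > 0" using neq by (simp add: e_def P_def)
  have "isCont (P u v) x" for u v
  proof -
    have "continuous_on S (P u v)"
      unfolding P_def by (intro smooth_on_continuous smooth_on_fd f)
    then show ?thesis using S continuous_on_eq_continuous_at by blast
  qed
  then obtain d1 d2 where d1: "d1 > 0" "\<And>y. dist y x < d1 \<Longrightarrow> dist (P u v y) (P u v x) < e"
    and d2: "d2 > 0" "\<And>y. dist y x < d2 \<Longrightarrow> dist (P v u y) (P v u x) < e"
    using \<open>e > 0\<close> unfolding continuous_at_eps_delta by meson
  obtain d3 where d3: "d3 > 0" "ball x d3 \<subseteq> S" using S open_contains_ball by blast
  define d where "d = min d1 (min d2 d3)"
  \<comment> \<open>The parallelogram spanned by \<open>t u\<close> and \<open>t v\<close> then
    stays in the ball of radius \<open>d\<close>. The summand 1 covers the case u = v = 0.\<close>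
  define t where "t = d / (norm u + norm v + 1)"
  have "d > 0" using d1 d2 d3 by (simp add: d_def)
  have pos: "norm u + norm v + 1 > 0" by (smt (verit) norm_ge_zero)
  have "t > 0" using \<open>d > 0\<close> pos by (simp add: t_def)
  have near: "dist (x + s *\<^sub>R u' + r *\<^sub>R v') x < d"
    if "0 \<le> s" "s \<le> t" "0 \<le> r" "r \<le> t" "{u', v'} = {u, v}" for s r u' v'
  proof -
    have "norm (s *\<^sub>R u' + r *\<^sub>R v') \<le> t * norm u' + t * norm v'"
      using that \<open>t > 0\<close> by (intro order_trans[OF norm_triangle_ineq] add_mono) (auto intro!: mult_right_mono)
    also have "\<dots> = t * (norm u + norm v)"
      using that(5) by (auto simp: doubleton_eq_iff algebra_simps)
    also have "\<dots> < t * (norm u + norm v + 1)" using \<open>t > 0\<close> by simp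
    also have "\<dots> = d" using pos by (simp add: t_def)
    finally show ?thesis by (simp add: dist_norm add.assoc)
  qed
  have nearS: "x + s *\<^sub>R u' + r *\<^sub>R v' \<in> S"
    if "0 \<le> s" "s \<le> t" "0 \<le> r" "r \<le> t" "{u', v'} = {u, v}" for s r u' v'
  proof -
    have "x + s *\<^sub>R u' + r *\<^sub>R v' \<in> ball x d3"
      using near[OF that] by (simp add: dist_commute d_def)
    then show ?thesis using d3 by blast
  qed
  obtain s r where 1: "0 < s" "s < t" "0 < r" "r < t"
    "f (x + t *\<^sub>R u + t *\<^sub>R v) - f (x + t *\<^sub>R u) - f (x + t *\<^sub>R v) + f x =
      t * t * P u v (x + s *\<^sub>R u + r *\<^sub>R v)"
    using second_difference_MVT[OF f \<open>t > 0\<close>, of x u v] nearS[of _ _ u v] unfolding P_def by auto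
  obtain s' r' where 2: "0 < s'" "s' < t" "0 < r'" "r' < t"
    "f (x + t *\<^sub>R v + t *\<^sub>R u) - f (x + t *\<^sub>R v) - f (x + t *\<^sub>R u) + f x =
      t * t * P v u (x + s' *\<^sub>R v + r' *\<^sub>R u)"
    using second_difference_MVT[OF f \<open>t > 0\<close>, of x v u] nearS[of _ _ v u] unfolding P_def
    by (auto simp: insert_commute)
  have "t * t * P u v (x + s *\<^sub>R u + r *\<^sub>R v) = t * t * P v u (x + s' *\<^sub>R v + r' *\<^sub>R u)"
    using 1(5) 2(5) by (simp add: algebra_simps)
  then have eq: "P u v (x + s *\<^sub>R u + r *\<^sub>R v) = P v u (x + s' *\<^sub>R v + r' *\<^sub>R u)"
    using \<open>t > 0\<close> by simp
  have "dist (P u v (x + s *\<^sub>R u + r *\<^sub>R v)) (P u v x) < e"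
    using near[of s r u v] 1 by (intro d1) (auto simp: d_def)
  moreover have "dist (P v u (x + s' *\<^sub>R v + r' *\<^sub>R u)) (P v u x) < e"
    using near[of s' r' v u] 2 by (intro d2) (auto simp: d_def insert_commute)
  ultimately show False unfolding eq e_def dist_real_def by (simp add: abs_if split: if_splits)
qed

text \<open>The factor t^-k makes the family closed under differentiation: the derivative of
  \<open>flat k\<close> is \<open>flat (k + 2)\<close> minus k times \<open>flat (k + 1)\<close>.
  One induction then shows that all members are smooth.\<close>

definition flat :: "nat \<Rightarrow> real \<Rightarrow> real" where
  "flat k t = (if t > 0 then exp (- inverse t) * inverse t ^ k else 0)"

lemma flat_tendsto_0: "(flat k \<longlongrightarrow> 0) (at 0)"
proof -
  have "((\<lambda>t. inverse t ^ k / exp (inverse t)) \<longlongrightarrow> 0) (at_right (0::real))"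
    by (rule filterlim_compose[OF tendsto_power_div_exp_0 filterlim_inverse_at_top_right])
  then have "(flat k \<longlongrightarrow> 0) (at_right 0)"
    by (rule Lim_transform_eventually)
      (auto simp: flat_def eventually_at_right_field exp_minus divide_inverse intro!: exI[of _ 1])
  moreover have "(flat k \<longlongrightarrow> 0) (at_left 0)"
    by (rule Lim_transform_eventually[OF tendsto_const])
      (auto simp: flat_def eventually_at_left_field intro!: exI[of _ "-1"])
  ultimately show ?thesis by (simp add: filterlim_split_at)
qed

lemma has_derivative_flat:
  "(flat k has_derivative (\<lambda>h. h * (flat (k + 2) t - k * flat (k + 1) t))) (at t)"
proof (cases t "0::real" rule: linorder_cases)
  case less
  have "((\<lambda>t. 0) has_derivative (\<lambda>h. 0)) (at t)" by simp
  then have "(flat k has_derivative (\<lambda>h. 0)) (at t)"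
    by (rule has_derivative_transform_within_open[of _ _ _ _ "{..<0}"]) (use less in \<open>auto simp: flat_def\<close>)
  then show ?thesis using less by (simp add: flat_def)
next
  case equal
  \<comment> \<open>The difference quotient of \<open>flat k\<close> at 0 is
    \<open>flat (Suc k)\<close>.\<close>
  have "(flat k has_real_derivative 0) (at 0)"
    unfolding has_field_derivative_iff
    by (rule Lim_transform_eventually[OF flat_tendsto_0[of "Suc k"]])
      (auto simp: flat_def divide_inverse eventually_at_filter)
  then have "(flat k has_derivative (\<lambda>h. 0 * h)) (at 0)"
    unfolding has_field_derivative_def .
  then show ?thesis using equal by (simp add: flat_def)
next
  case greater
  have D: "((\<lambda>t. exp (- inverse t) * inverse t ^ k) has_real_derivative
      exp (- inverse t) * inverse t ^ (k + 2) - k * (exp (- inverse t) * inverse t ^ (k + 1))) (at t)"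
  proof (cases k)
    case 0
    then show ?thesis using greater
      by (auto intro!: derivative_eq_intros simp: power2_eq_square algebra_simps)
  next
    case (Suc j)
    have "((\<lambda>t. inverse t ^ Suc j) has_real_derivative real (Suc j) * (inverse t ^ j * - (inverse t ^ 2))) (at t)"
      using greater DERIV_power[OF DERIV_inverse[of t UNIV], of "Suc j"]
      by (simp add: numeral_2_eq_2 mult_ac del: power_Suc of_nat_Suc)
    then have "((\<lambda>t. inverse t ^ Suc j) has_real_derivative - (real (Suc j) * inverse t ^ (j + 2))) (at t)"
      by (simp add: power2_eq_square mult_ac)
    then show ?thesis using greater unfolding Suc
      by (auto intro!: derivative_eq_intros simp del: power_Suc of_nat_Suc)
        (simp add: algebra_simps power2_eq_square)
  qed
  have "((\<lambda>t. exp (- inverse t) * inverse t ^ k) has_derivative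
      (\<lambda>h. h * (flat (k + 2) t - k * flat (k + 1) t))) (at t)"
  proof -
    have "(\<lambda>h. h * (flat (k + 2) t - k * flat (k + 1) t)) =
        (*) (exp (- inverse t) * inverse t ^ (k + 2) - k * (exp (- inverse t) * inverse t ^ (k + 1)))"
      using greater by (auto simp: flat_def mult.commute)
    with D show ?thesis unfolding has_field_derivative_def by simp
  qed
  then show ?thesis
    by (rule has_derivative_transform_within_open[of _ _ _ _ "{0<..}"]) (use greater in \<open>auto simp: flat_def\<close>)
qed

lemma Ck_on_flat: "Ck_on n (flat k) UNIV"
proof (induction n arbitrary: k)
  case 0
  have "isCont (flat k) t" for t
    using has_derivative_continuous[OF has_derivative_flat] .
  then show ?case by (simp add: continuous_at_imp_continuous_on)
next
  case (Suc n)
  have "Ck_on n (\<lambda>t. flat (k + 2) t + (- real k) * flat (k + 1) t) UNIV"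
    by (intro Ck_on_add Ck_on_mult Ck_on_const Suc open_UNIV)
  then have "Ck_on n (\<lambda>t. h * (flat (k + 2) t + (- real k) * flat (k + 1) t)) UNIV" for h
    by (intro Ck_on_mult Ck_on_const open_UNIV)
  then show ?case
    by (intro Ck_on_SucI[OF open_UNIV has_derivative_flat]) simp
qed

text \<open>The function is \<open>flat 0\<close> applied to r^2 - |x - p|^2.\<close>

lemma ex_smooth_bump:
  fixes p :: "'a::euclidean_space"
  assumes "r > 0"
  obtains \<phi> :: "'a \<Rightarrow> real" where "smooth_on \<phi> UNIV" "\<And>x. x \<in> ball p r \<Longrightarrow> \<phi> x > 0"
    "\<And>x. x \<notin> ball p r \<Longrightarrow> \<phi> x = 0"
proof
  let ?\<phi> = "\<lambda>x. flat 0 (r\<^sup>2 - (x - p) \<bullet> (x - p))"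
  have diff: "smooth_on (\<lambda>x. x + (- p)) UNIV"
    by (intro smooth_on_add smooth_on_linear smooth_on_const open_UNIV bounded_linear_ident)
  then have "smooth_on (\<lambda>x. (x + (- p)) \<bullet> (x + (- p))) UNIV"
    unfolding smooth_on_def using Ck_on_bilinear[OF bounded_bilinear_inner open_UNIV] by blast
  then have "smooth_on (\<lambda>x. r\<^sup>2 + - ((x + (- p)) \<bullet> (x + (- p)))) UNIV"
    by (intro smooth_on_add smooth_on_uminus smooth_on_const open_UNIV)
  then show "smooth_on ?\<phi> UNIV"
    using smooth_on_compose[OF open_UNIV open_UNIV _ _ , of _ "flat 0"] Ck_on_flat
    by (simp add: smooth_on_def)
  have "(x - p) \<bullet> (x - p) < r\<^sup>2 \<longleftrightarrow> x \<in> ball p r" for x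
    using assms by (simp add: dist_norm norm_minus_commute flip: power2_norm_eq_inner)
      (meson abs_ge_zero norm_ge_zero not_le power2_less_imp_less power_mono less_imp_le power_strict_mono zero_less_numeral)
  then show "x \<in> ball p r \<Longrightarrow> ?\<phi> x > 0" "x \<notin> ball p r \<Longrightarrow> ?\<phi> x = 0" for x
    by (auto simp: flat_def)
qed

section \<open>Integration of compactly supported functions\<close>

lemma integrable_compact_support:
  fixes F :: "'a::euclidean_space \<Rightarrow> real"
  assumes "continuous_on UNIV F" "compact K" "\<And>x. x \<notin> K \<Longrightarrow> F x = 0"
  shows "integrable lborel F"
proof -
  have "set_integrable lborel K F"
    unfolding set_integrable_def
    by (rule borel_integrable_compact) (use assms continuous_on_subset[OF assms(1)] in auto)
  moreover have "(\<lambda>x. indicator K x *\<^sub>R F x) = F"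
    using assms(3) by (intro ext) (simp split: split_indicator)
  ultimately show ?thesis by (simp add: set_integrable_def)
qed

lemma bounded_compact_support:
  fixes F :: "'a::euclidean_space \<Rightarrow> real"
  assumes "continuous_on UNIV F" "compact K" "\<And>x. x \<notin> K \<Longrightarrow> F x = 0"
  shows "\<exists>B\<ge>0. \<forall>x. \<bar>F x\<bar> \<le> B"
proof -
  have "compact (F ` K)"
    using assms compact_continuous_image continuous_on_subset by blast
  then obtain B where "\<forall>x\<in>K. \<bar>F x\<bar> \<le> B"
    using compact_imp_bounded bounded_iff by (metis image_eqI real_norm_def)
  then have "\<forall>x. \<bar>F x\<bar> \<le> max B 0"
    using assms(3) by (metis abs_zero max.coboundedI1 max.cobounded2)
  then show ?thesis by (intro exI[of _ "max B 0"]) auto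
qed

lemma fd_outside_support:
  assumes "compact K" "\<And>x. x \<notin> K \<Longrightarrow> F x = 0" "x \<notin> K"
  shows "fd F x v = 0"
proof -
  have "fd F x = fd (\<lambda>x. 0) x"
    by (rule fd_cong[of "- K"]) (use assms compact_imp_closed in auto)
  then show ?thesis by simp
qed

text \<open>Difference quotients of \<open>F\<close> have integral 0 because Lebesgue measure is
  translation invariant. Dominated convergence carries this over to the directional
  derivative.\<close>

lemma integral_fd_compact_support:
  fixes F :: "'a::euclidean_space \<Rightarrow> real"
  assumes F: "Ck_on (Suc 0) F UNIV" and K: "compact K" and F0: "\<And>x. x \<notin> K \<Longrightarrow> F x = 0"
  shows "integral\<^sup>L lborel (\<lambda>x. fd F x b) = 0"
proof -
  have cont: "continuous_on UNIV F" using Ck_on_Suc_D[OF F] by simp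
  have diff: "F differentiable (at x)" for x using F by simp
  have cont': "continuous_on UNIV (\<lambda>x. fd F x b)" using F by simp
  have [measurable]: "F \<in> borel_measurable borel" "(\<lambda>x. fd F x b) \<in> borel_measurable borel"
    using cont cont' by (auto intro: borel_measurable_continuous_onI)
  obtain B where B: "B \<ge> 0" "\<And>x. \<bar>fd F x b\<bar> \<le> B"
    using bounded_compact_support[OF cont' K fd_outside_support[OF K F0]] by auto
  obtain R where R: "\<And>x. x \<in> K \<Longrightarrow> norm x \<le> R"
    using compact_imp_bounded[OF K] bounded_iff by metis
  define t where "t i = inverse (real (Suc i))" for i
  have t: "t i > 0" "t i \<le> 1" for i by (auto simp: t_def inverse_eq_divide)
  define s where "s i x = (F (x + t i *\<^sub>R b) - F x) / t i" for i x
  \<comment> \<open>As t i <= 1, the quotient vanishes at \<open>x\<close> unless |x| <= R + |b|. On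
    that ball the mean value theorem bounds it by \<open>B\<close>.\<close>
  let ?w = "\<lambda>x. indicator (cball 0 (R + norm b)) x * B"
  have int: "integrable lborel F" by (rule integrable_compact_support[OF cont K F0])
  have shift: "integrable lborel (\<lambda>x. F (c + x))" "integral\<^sup>L lborel (\<lambda>x. F (c + x)) = integral\<^sup>L lborel F" for c
    using integrable_distr_eq[of "\<lambda>x. c + x" lborel borel F] integral_distr[of "\<lambda>x. c + x" lborel borel F]
      int lborel_distr_plus[of c] by (simp_all add: lborel_distr_plus)
  have s0: "integral\<^sup>L lborel (s i) = 0" for i
  proof -
    have "integral\<^sup>L lborel (\<lambda>x. F (x + t i *\<^sub>R b) - F x) = 0"
      using shift[of "t i *\<^sub>R b"] int by (subst Bochner_Integration.integral_diff) (auto simp: add.commute)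
    then show ?thesis by (simp add: s_def[abs_def])
  qed
  have "(\<lambda>i. integral\<^sup>L lborel (s i)) \<longlonglongrightarrow> integral\<^sup>L lborel (\<lambda>x. fd F x b)"
  proof (rule integral_dominated_convergence[where w = ?w])
    show "integrable lborel ?w"
      by (intro integrable_mult_left integrable_real_indicator)
        (use emeasure_lborel_cball_finite in \<open>auto simp: top.not_eq_extremum\<close>)
    show "s i \<in> borel_measurable lborel" for i unfolding s_def by measurable
    show "AE x in lborel. (\<lambda>i. s i x) \<longlonglongrightarrow> fd F x b"
    proof (rule AE_I2)
      fix x
      have "((\<lambda>h. F (x + h *\<^sub>R b)) has_real_derivative fd F x b) (at 0)"
        using DERIV_line[of F x 0 b] diff by simp
      then have D: "((\<lambda>h. (F (x + h *\<^sub>R b) - F x) / h) \<longlongrightarrow> fd F x b) (at 0)"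
        by (simp add: has_field_derivative_iff)
      have "filterlim t (at 0) sequentially"
        using LIMSEQ_inverse_real_of_nat t(1)
        unfolding filterlim_at t_def by (auto simp del: of_nat_Suc)
      from filterlim_compose[OF D this] show "(\<lambda>i. s i x) \<longlonglongrightarrow> fd F x b"
        by (simp add: s_def)
    qed
    show "AE x in lborel. norm (s i x) \<le> ?w x" for i
    proof (rule AE_I2)
      fix x
      show "norm (s i x) \<le> ?w x"
      proof (cases "x \<in> cball 0 (R + norm b)")
        case True
        obtain z where "F (x + t i *\<^sub>R b) - F (x + 0 *\<^sub>R b) = (t i - 0) * fd F (x + z *\<^sub>R b) b"
          using MVT2[OF t(1)[of i], of "\<lambda>s. F (x + s *\<^sub>R b)" "\<lambda>s. fd F (x + s *\<^sub>R b) b"]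
            DERIV_line[OF diff] by blast
        then have "s i x = fd F (x + z *\<^sub>R b) b" using t(1)[of i] by (simp add: s_def)
        then show ?thesis using B True by simp
      next
        case False
        have "norm x > R + norm b" using False by simp
        moreover have "norm x \<le> norm (x + t i *\<^sub>R b) + norm (t i *\<^sub>R b)"
          by (metis add_diff_cancel norm_triangle_ineq4)
        moreover have "norm (t i *\<^sub>R b) \<le> norm b"
          using t[of i] by (simp add: mult_left_le_one_le)
        ultimately have "x \<notin> K" "x + t i *\<^sub>R b \<notin> K"
          using R[of x] R[of "x + t i *\<^sub>R b"] norm_ge_zero[of b] by auto
        then show ?thesis using F0 False by (simp add: s_def)
      qed
    qed
  qed auto
  then show ?thesis using s0 by (simp add: LIMSEQ_const_iff)
qed

text \<open>The set where \<open>h\<close> is nonzero is open, and it is null because the integral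
  vanishes; a nonempty open set is not null.\<close>

lemma lborel_integral_nonneg_eq_0:
  fixes h :: "'a::euclidean_space \<Rightarrow> real"
  assumes "continuous_on UNIV h" "integrable lborel h" "\<And>x. h x \<ge> 0" "integral\<^sup>L lborel h = 0"
  shows "h x = 0"
proof (rule ccontr)
  assume "h x \<noteq> 0"
  define U where "U = {x. h x \<noteq> 0}"
  have U: "open U" "x \<in> U"
    using assms(1) \<open>h x \<noteq> 0\<close> by (auto simp: U_def intro!: open_Collect_neq continuous_intros)
  have "AE x in lborel. h x = 0"
    using integral_nonneg_eq_0_iff_AE[OF assms(2)] assms by auto
  then have "U \<in> null_sets lborel"
    using U AE_iff_null_sets[of U lborel] by (simp add: U_def)
  then have "negligible U"
    by (simp add: negligible_iff_null_sets null_sets_completionI)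
  then show False using U open_not_negligible by blast
qed

section \<open>Traces with respect to a scalar product\<close>

definition metric_tensor :: "('v::real_vector \<Rightarrow> 'v \<Rightarrow> real) \<Rightarrow> bool" where
  "metric_tensor g \<longleftrightarrow> bilinear g \<and> (\<forall>v w. g v w = g w v) \<and> (\<forall>v. v \<noteq> 0 \<longrightarrow> g v v > 0)"

definition onb :: "('v::real_vector \<Rightarrow> 'v \<Rightarrow> real) \<Rightarrow> 'v set \<Rightarrow> bool" where
  "onb g E \<longleftrightarrow> finite E \<and> span E = UNIV \<and> (\<forall>e\<in>E. \<forall>e'\<in>E. g e e' = (if e = e' then 1 else 0))"

text \<open>The contraction g^ij B_ij. The coordinate basis stays fixed when \<open>g\<close> varies
  with a point, so this expression can be differentiated; at a single point \<open>tr_onb\<close>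
  replaces it by a sum over an orthonormal basis.\<close>

definition tr :: "('v \<Rightarrow> 'v \<Rightarrow> real) \<Rightarrow> ('v::euclidean_space \<Rightarrow> 'v \<Rightarrow> real) \<Rightarrow> real" where
  "tr g B = (\<Sum>b\<in>Basis. B b (raise g b))"

lemma bilinear_linear: "bilinear B \<Longrightarrow> linear (B v)" "bilinear B \<Longrightarrow> linear (\<lambda>v. B v w)"
  by (auto simp: bilinear_def)

lemma bilinear_sum_sum:
  assumes "bilinear B"
  shows "B (\<Sum>i\<in>I. a i *\<^sub>R v i) w = (\<Sum>i\<in>I. a i *\<^sub>R B (v i) w)"
    and "B w (\<Sum>i\<in>I. a i *\<^sub>R v i) = (\<Sum>i\<in>I. a i *\<^sub>R B w (v i))"
  using linear_sum[OF bilinear_linear(2)[OF assms, of w], of "\<lambda>i. a i *\<^sub>R v i" I]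
    linear_sum[OF bilinear_linear(1)[OF assms, of w], of "\<lambda>i. a i *\<^sub>R v i" I]
  by (simp_all add: bilinear_lmul[OF assms] bilinear_rmul[OF assms])

lemma orthonormal_independent:
  assumes g: "metric_tensor g" and "finite E" and on: "\<forall>e\<in>E. \<forall>e'\<in>E. g e e' = (if e = e' then 1 else 0)"
  shows "independent E"
proof (rule independent_if_scalars_zero[OF \<open>finite E\<close>])
  fix u e assume 0: "(\<Sum>e\<in>E. u e *\<^sub>R e) = 0" and "e \<in> E"
  have B: "bilinear g" using g by (simp add: metric_tensor_def)
  have "0 = g (\<Sum>e\<in>E. u e *\<^sub>R e) e"
    using 0 bilinear_lzero[OF B] by simp
  also have "\<dots> = (\<Sum>e'\<in>E. u e' * (if e' = e then 1 else 0))"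
    unfolding bilinear_sum_sum(1)[OF B] using on \<open>e \<in> E\<close> by (intro sum.cong) auto
  also have "\<dots> = u e" using \<open>e \<in> E\<close> \<open>finite E\<close> by (simp add: if_distrib cong: if_cong)
  finally show "u e = 0" by simp
qed

text \<open>An orthonormal set of maximal size spans: otherwise the normalised orthogonal component
  of a vector outside the span would enlarge it. Sizes are bounded by independence.\<close>

lemma ex_onb:
  fixes g :: "'v::euclidean_space \<Rightarrow> 'v \<Rightarrow> real"
  assumes g: "metric_tensor g"
  obtains E where "onb g E"
proof -
  have B: "bilinear g" and sym: "\<And>v w. g v w = g w v" and pos: "\<And>v. v \<noteq> 0 \<Longrightarrow> g v v > 0"
    using g by (auto simp: metric_tensor_def)
  define P where "P E \<longleftrightarrow> finite E \<and> (\<forall>e\<in>E. \<forall>e'\<in>E. g e e' = (if e = e' then 1 else 0))" for E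
  have "P {}" by (simp add: P_def)
  moreover have "card E < Suc DIM('v)" if "P E" for E
    using orthonormal_independent[OF g] that independent_card_le[of E] by (auto simp: P_def less_Suc_eq_le)
  ultimately obtain E where E: "P E" "\<And>E'. P E' \<Longrightarrow> card E' \<le> card E"
    by (metis ex_has_greatest_nat)
  have fin: "finite E" using E(1) by (simp add: P_def)
  have "span E = UNIV"
  proof (rule ccontr)
    assume "span E \<noteq> UNIV"
    then obtain v where v: "v \<notin> span E" by auto
    define w where "w = v - (\<Sum>e\<in>E. g v e *\<^sub>R e)"
    have "(\<Sum>e\<in>E. g v e *\<^sub>R e) \<in> span E" by (intro span_sum span_scale span_base)
    then have "w \<noteq> 0" using v by (auto simp: w_def)
    then have gw: "g w w > 0" by (rule pos)
    have gwe: "g w e = 0" if "e \<in> E" for e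
    proof -
      have "g (\<Sum>e\<in>E. g v e *\<^sub>R e) e = (\<Sum>e'\<in>E. g v e' * (if e' = e then 1 else 0))"
        unfolding bilinear_sum_sum(1)[OF B] using E(1) that by (intro sum.cong) (auto simp: P_def)
      also have "\<dots> = g v e" using that fin by (simp add: if_distrib cong: if_cong)
      finally show ?thesis by (simp add: w_def bilinear_lsub[OF B])
    qed
    define u where "u = (1 / sqrt (g w w)) *\<^sub>R w"
    have ue: "g u e = 0" if "e \<in> E" for e
      using gwe[OF that] by (simp add: u_def bilinear_lmul[OF B])
    have uu: "g u u = 1"
      using gw by (simp add: u_def bilinear_lmul[OF B] bilinear_rmul[OF B])
    have "P (insert u E)"
      using E(1) ue uu sym by (force simp: P_def)
    moreover have "u \<notin> E" using ue uu by auto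
    ultimately show False using E(2)[of "insert u E"] fin by simp
  qed
  then show ?thesis using that E(1) by (auto simp: onb_def P_def)
qed

lemma onb_expand:
  assumes g: "metric_tensor g" and E: "onb g E"
  shows "v = (\<Sum>e\<in>E. g v e *\<^sub>R e)"
proof -
  have B: "bilinear g" using g by (simp add: metric_tensor_def)
  have fin: "finite E" using E by (simp add: onb_def)
  have "v \<in> span E" using E by (simp add: onb_def)
  then obtain u where u: "v = (\<Sum>e\<in>E. u e *\<^sub>R e)"
    unfolding span_finite[OF fin] by auto
  have "g v e = u e" if "e \<in> E" for e
  proof -
    have "g v e = (\<Sum>e'\<in>E. u e' * (if e' = e then 1 else 0))"
      unfolding u bilinear_sum_sum(1)[OF B] using E that by (intro sum.cong) (auto simp: onb_def)
    also have "\<dots> = u e" using that fin by (simp add: if_distrib cong: if_cong)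
    finally show ?thesis .
  qed
  then show ?thesis using u by simp
qed

lemma onb_linear:
  assumes "metric_tensor g" "onb g E" "linear (l :: _ \<Rightarrow> real)"
  shows "l v = (\<Sum>e\<in>E. g v e * l e)"
proof -
  have "l v = l (\<Sum>e\<in>E. g v e *\<^sub>R e)" using onb_expand[OF assms(1,2), of v] by simp
  then show ?thesis by (simp add: linear_sum[OF assms(3)] linear_scale[OF assms(3)])
qed

lemma raise_eq:
  assumes g: "metric_tensor g" and E: "onb g E"
  shows "raise g l = (\<Sum>e\<in>E. (l \<bullet> e) *\<^sub>R e)"
  unfolding raise_def
proof (rule the_equality)
  have B: "bilinear g" and sym: "\<And>v w. g v w = g w v" and pos: "\<And>v. v \<noteq> 0 \<Longrightarrow> g v v > 0"
    using g by (auto simp: metric_tensor_def)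
  show 1: "\<forall>v. g (\<Sum>e\<in>E. (l \<bullet> e) *\<^sub>R e) v = l \<bullet> v"
  proof
    fix v
    have "g (\<Sum>e\<in>E. (l \<bullet> e) *\<^sub>R e) v = (\<Sum>e\<in>E. g v e * (l \<bullet> e))"
      unfolding bilinear_sum_sum(1)[OF B] by (simp add: sym mult.commute)
    also have "\<dots> = l \<bullet> v"
      by (rule onb_linear[OF g E, symmetric]) (rule bounded_linear.linear[OF bounded_linear_inner_right])
    finally show "g (\<Sum>e\<in>E. (l \<bullet> e) *\<^sub>R e) v = l \<bullet> v" .
  qed
  fix w assume "\<forall>v. g w v = l \<bullet> v"
  then have "g (w - (\<Sum>e\<in>E. (l \<bullet> e) *\<^sub>R e)) v = 0" for v
    using 1 by (simp add: bilinear_lsub[OF B])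
  then show "w = (\<Sum>e\<in>E. (l \<bullet> e) *\<^sub>R e)"
    using pos by (metis eq_iff_diff_eq_0 less_irrefl)
qed

lemma raise_works:
  assumes g: "metric_tensor g"
  shows "g (raise g l) v = l \<bullet> v"
proof -
  obtain E where E: "onb g E" using ex_onb[OF g] .
  have B: "bilinear g" and sym: "\<And>v w. g v w = g w v"
    using g by (auto simp: metric_tensor_def)
  have "g (raise g l) v = (\<Sum>e\<in>E. g v e * (l \<bullet> e))"
    unfolding raise_eq[OF g E] bilinear_sum_sum(1)[OF B] by (simp add: sym mult.commute)
  also have "\<dots> = l \<bullet> v"
    by (rule onb_linear[OF g E, symmetric]) (rule bounded_linear.linear[OF bounded_linear_inner_right])
  finally show ?thesis .
qed

lemma raise_eqI:
  assumes g: "metric_tensor g" and "\<And>v. g w v = l \<bullet> v"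
  shows "raise g l = w"
proof -
  have B: "bilinear g" and pos: "\<And>v. v \<noteq> 0 \<Longrightarrow> g v v > 0"
    using g by (auto simp: metric_tensor_def)
  have "g (raise g l - w) v = 0" for v
    using assms(2) raise_works[OF g] by (simp add: bilinear_lsub[OF B])
  then show ?thesis using pos by (metis eq_iff_diff_eq_0 less_irrefl)
qed

text \<open>The divergence computation yields (star) at vectors that are raised from constant
  covectors. By this lemma every vector at a given point is of that kind.\<close>

lemma ex_raise:
  assumes g: "metric_tensor (g :: 'v::euclidean_space \<Rightarrow> 'v \<Rightarrow> real)"
  shows "\<exists>l. raise g l = w"
proof
  have B: "bilinear g" and sym: "\<And>v w. g v w = g w v" using g by (auto simp: metric_tensor_def)
  show "raise g (\<Sum>b\<in>Basis. g w b *\<^sub>R b) = w"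
  proof (rule raise_eqI[OF g])
    fix v
    have "g w v = (\<Sum>b\<in>Basis. (v \<bullet> b) *\<^sub>R g w b)"
      by (rule linear_sum_Basis) (rule bilinear_linear(1)[OF B])
    then show "g w v = (\<Sum>b\<in>Basis. g w b *\<^sub>R b) \<bullet> v"
      by (simp add: inner_sum_left inner_sum_right inner_commute mult.commute)
  qed
qed

lemma tr_onb:
  assumes g: "metric_tensor g" and E: "onb g E" and B: "bilinear B"
  shows "tr g B = (\<Sum>e\<in>E. B e e)"
proof -
  have "tr g B = (\<Sum>b\<in>Basis. \<Sum>e\<in>E. (b \<bullet> e) * B b e)"
    unfolding tr_def raise_eq[OF g E] bilinear_sum_sum(2)[OF B] by simp
  also have "\<dots> = (\<Sum>e\<in>E. \<Sum>b\<in>Basis. (e \<bullet> b) *\<^sub>R B b e)"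
    by (subst sum.swap) (simp add: inner_commute)
  also have "\<dots> = (\<Sum>e\<in>E. B e e)"
    by (intro sum.cong refl linear_sum_Basis[symmetric] bilinear_linear(2)[OF B])
  finally show ?thesis .
qed

lemma tr_add: "tr g (\<lambda>a b. B a b + C a b) = tr g B + tr g C"
  by (simp add: tr_def sum.distrib)

lemma tr_uminus: "tr g (\<lambda>a b. - B a b) = - tr g B"
  by (simp add: tr_def sum_negf)

lemma tr_diff: "tr g (\<lambda>a b. B a b - C a b) = tr g B - tr g C"
  by (simp add: tr_def sum_subtractf)

lemma tr_mult: "tr g (\<lambda>a b. c * B a b) = c * tr g B"
  by (simp add: tr_def sum_distrib_left)

lemma tr_transpose:
  assumes g: "metric_tensor g" and B: "bilinear B"
  shows "tr g (\<lambda>a b. B b a) = tr g B"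
proof -
  obtain E where E: "onb g E" using ex_onb[OF g] .
  have "bilinear (\<lambda>a b. B b a)" using B by (simp add: bilinear_def)
  then show ?thesis using tr_onb[OF g E] B by simp
qed

lemma onb_image:
  assumes g: "metric_tensor g" and E: "onb g E" and L: "linear L" "surj L"
    and eq: "\<And>v w. g' (L v) (L w) = g v w"
  shows "onb g' (L ` E)" and "inj_on L E"
proof -
  have B: "bilinear g" and pos: "\<And>v. v \<noteq> 0 \<Longrightarrow> g v v > 0"
    using g by (auto simp: metric_tensor_def)
  show inj: "inj_on L E"
  proof (rule inj_onI)
    fix v w assume "L v = L w"
    then have "g v u = g w u" for u by (metis eq)
    then have "g (v - w) (v - w) = 0" by (simp add: bilinear_lsub[OF B])
    then show "v = w" using pos[of "v - w"] by auto
  qed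
  have "span (L ` E) = UNIV"
    using E L by (simp add: onb_def linear_span_image)
  then show "onb g' (L ` E)"
    using E eq inj by (auto simp: onb_def inj_on_def)
qed

lemma tr_image:
  assumes g: "metric_tensor g" and g': "metric_tensor g'" and L: "linear L" "surj L"
    and eq: "\<And>v w. g' (L v) (L w) = g v w" and B: "bilinear B"
  shows "tr g (\<lambda>a b. B (L a) (L b)) = tr g' B"
proof -
  obtain E where E: "onb g E" using ex_onb[OF g] .
  have B': "bilinear (\<lambda>a b. B (L a) (L b))"
    using B L by (auto simp: bilinear_def intro: linear_compose[unfolded o_def])
  have "tr g (\<lambda>a b. B (L a) (L b)) = (\<Sum>e\<in>E. B (L e) (L e))"
    by (rule tr_onb[OF g E B'])
  also have "\<dots> = (\<Sum>e\<in>L ` E. B e e)"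
    by (simp add: sum.reindex[OF onb_image(2)[OF g E L eq]])
  also have "\<dots> = tr g' B"
    by (rule tr_onb[OF g' onb_image(1)[OF g E L eq] B, symmetric])
  finally show ?thesis .
qed

lemma tr_contract:
  assumes g: "metric_tensor g" and l: "linear l"
  shows "tr g (\<lambda>a b. l a * g b w) = l w"
proof -
  obtain E where E: "onb g E" using ex_onb[OF g] .
  have B: "bilinear g" and sym: "\<And>v w. g v w = g w v" using g by (auto simp: metric_tensor_def)
  have "bilinear (\<lambda>a b. l a * g b w)"
    unfolding bilinear_def
    by (auto intro!: linearI simp: bilinear_ladd[OF B] bilinear_lmul[OF B] linear_add[OF l]
        linear_scale[OF l] algebra_simps)
  then have "tr g (\<lambda>a b. l a * g b w) = (\<Sum>e\<in>E. g w e * l e)"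
    using tr_onb[OF g E] by (simp add: sym mult.commute)
  then show ?thesis using onb_linear[OF g E l, of w] by simp
qed

lemma card_onb:
  assumes g: "metric_tensor (g :: 'v::euclidean_space \<Rightarrow> 'v \<Rightarrow> real)" and E: "onb g E"
  shows "card E = DIM('v)"
proof -
  have "independent E" using orthonormal_independent[OF g] E by (auto simp: onb_def)
  then have "card E = dim (span E)" by (simp add: dim_eq_card_independent)
  also have "span E = UNIV" using E by (simp add: onb_def)
  finally show ?thesis by simp
qed

lemma tr_self:
  assumes g: "metric_tensor (g :: 'v::euclidean_space \<Rightarrow> 'v \<Rightarrow> real)"
  shows "tr g g = DIM('v)"
proof -
  obtain E where E: "onb g E" using ex_onb[OF g] .
  have B: "bilinear g" using g by (simp add: metric_tensor_def)
  have "tr g g = (\<Sum>e\<in>E. 1)"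
    unfolding tr_onb[OF g E B] using E by (intro sum.cong) (auto simp: onb_def)
  then show ?thesis using card_onb[OF g E] by simp
qed

lemma metric_tensor_scale: "metric_tensor g \<Longrightarrow> c > 0 \<Longrightarrow> metric_tensor (\<lambda>v w. c * g v w)"
  unfolding metric_tensor_def bilinear_def by (auto intro!: linear_compose_scale_right[where 'b = real, simplified])

lemma tr_scale:
  assumes g: "metric_tensor g" and c: "c > 0" and B: "bilinear B"
  shows "tr (\<lambda>v w. c * g v w) B = tr g B / c"
proof -
  have g': "metric_tensor (\<lambda>v w. c * g v w)" by (rule metric_tensor_scale[OF g c])
  have Bg: "bilinear g" using g by (simp add: metric_tensor_def)
  have "raise (\<lambda>v w. c * g v w) l = (1 / c) *\<^sub>R raise g l" for l
    by (rule raise_eqI[OF g']) (use c in \<open>simp add: bilinear_lmul[OF Bg] raise_works[OF g]\<close>)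
  then show ?thesis
    by (simp add: tr_def bilinear_rmul[OF B] sum_divide_distrib)
qed

text \<open>A product rule with one factor merely continuous, at a zero of the other factor. It
  breaks a circle in \<open>has_derivative_raise\<close>: there the increment of
  \<open>raise\<close> is expressed through \<open>raise\<close> itself, of which so far only
  continuity is known.\<close>

lemma has_derivative_mult_zero:
  fixes f q :: "'a::real_normed_vector \<Rightarrow> real"
  assumes f: "isCont f p" and q: "(q has_derivative q') (at p)" and 0: "q p = 0"
  shows "((\<lambda>y. f y * q y) has_derivative (\<lambda>a. f p * q' a)) (at p)"
proof -
  have lin: "bounded_linear q'" using q by (rule has_derivative_bounded_linear)
  obtain K where K: "\<And>a. \<bar>q' a\<bar> \<le> norm a * K"
    using bounded_linear.bounded[OF lin] by auto
  have rem: "((\<lambda>y. norm (q y - q p - q' (y - p)) / norm (y - p)) \<longlongrightarrow> 0) (at p)"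
    using q unfolding has_derivative_iff_norm by auto
  have fz: "((\<lambda>y. \<bar>f y - f p\<bar>) \<longlongrightarrow> 0) (at p)"
    using f unfolding isCont_def by (simp add: LIM_zero tendsto_rabs_zero)
  let ?r = "\<lambda>y. norm (q y - q p - q' (y - p)) / norm (y - p)"
  have "((\<lambda>y. \<bar>f y - f p\<bar> * (?r y + K) + \<bar>f p\<bar> * ?r y) \<longlongrightarrow> 0 * (0 + K) + \<bar>f p\<bar> * 0) (at p)"
    by (intro tendsto_intros rem fz)
  then have lim: "((\<lambda>y. \<bar>f y - f p\<bar> * (?r y + K) + \<bar>f p\<bar> * ?r y) \<longlongrightarrow> 0) (at p)"
    by simp
  have "((\<lambda>y. norm (f y * q y - f p * q p - f p * q' (y - p)) / norm (y - p)) \<longlongrightarrow> 0) (at p)"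
  proof (rule tendsto_sandwich[OF _ _ tendsto_const lim])
    show "\<forall>\<^sub>F y in at p. norm (f y * q y - f p * q p - f p * q' (y - p)) / norm (y - p)
      \<le> \<bar>f y - f p\<bar> * (?r y + K) + \<bar>f p\<bar> * ?r y"
      unfolding eventually_at_filter
    proof (intro always_eventually allI impI)
      fix y assume "y \<noteq> p"
      then have n: "norm (y - p) > 0" by simp
      have "\<bar>q y\<bar> \<le> \<bar>q y - q' (y - p)\<bar> + norm (y - p) * K"
        using K[of "y - p"] by linarith
      then have "\<bar>q y\<bar> / norm (y - p) \<le> ?r y + K"
        using n 0 by (simp add: field_simps)
      then have 1: "\<bar>f y - f p\<bar> * (\<bar>q y\<bar> / norm (y - p)) \<le> \<bar>f y - f p\<bar> * (?r y + K)"
        by (intro mult_left_mono) auto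
      have "f y * q y - f p * q p - f p * q' (y - p) =
          (f y - f p) * q y + f p * (q y - q p - q' (y - p))"
        using 0 by (simp add: algebra_simps)
      then have "norm (f y * q y - f p * q p - f p * q' (y - p))
        \<le> \<bar>f y - f p\<bar> * \<bar>q y\<bar> + \<bar>f p\<bar> * \<bar>q y - q p - q' (y - p)\<bar>"
        by (metis abs_mult abs_triangle_ineq real_norm_def)
      then have "norm (f y * q y - f p * q p - f p * q' (y - p)) / norm (y - p)
        \<le> (\<bar>f y - f p\<bar> * \<bar>q y\<bar> + \<bar>f p\<bar> * \<bar>q y - q p - q' (y - p)\<bar>) / norm (y - p)"
        using n by (simp add: divide_right_mono)
      also have "\<dots> = \<bar>f y - f p\<bar> * (\<bar>q y\<bar> / norm (y - p)) + \<bar>f p\<bar> * ?r y"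
        by (simp add: add_divide_distrib)
      finally show "norm (f y * q y - f p * q p - f p * q' (y - p)) / norm (y - p)
        \<le> \<bar>f y - f p\<bar> * (?r y + K) + \<bar>f p\<bar> * ?r y"
        using 1 by linarith
    qed
  qed (auto intro!: always_eventually)
  then show ?thesis
    unfolding has_derivative_iff_norm
    using bounded_linear_const_mult[OF lin] by simp
qed

text \<open>The resolvent identity h^-1 - g^-1 = - g^-1 (h - g) h^-1, with the outer g^-1 written in
  a g-orthonormal basis.\<close>

lemma raise_diff:
  fixes g :: "'v::euclidean_space \<Rightarrow> 'v \<Rightarrow> real"
  assumes g: "metric_tensor g" and h: "metric_tensor h" and E: "onb g E"
  shows "raise h l = raise g l - (\<Sum>e\<in>E. \<Sum>b\<in>Basis. ((raise h l \<bullet> b) * (h b e - g b e)) *\<^sub>R e)"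
proof -
  have Bg: "bilinear g" and Bh: "bilinear h"
    using g h by (auto simp: metric_tensor_def)
  have "g (raise h l - raise g l) e = - (\<Sum>b\<in>Basis. (raise h l \<bullet> b) * (h b e - g b e))" for e
  proof -
    have "linear (\<lambda>v. h v e - g v e)"
      by (intro linear_compose_sub bilinear_linear(2) Bg Bh)
    from linear_sum_Basis[OF this, of "raise h l"]
    have "h (raise h l) e - g (raise h l) e = (\<Sum>b\<in>Basis. (raise h l \<bullet> b) * (h b e - g b e))"
      by simp
    then show ?thesis
      by (simp add: bilinear_lsub[OF Bg] raise_works[OF g] raise_works[OF h])
  qed
  then have "raise h l - raise g l = (\<Sum>e\<in>E. (- (\<Sum>b\<in>Basis. (raise h l \<bullet> b) * (h b e - g b e))) *\<^sub>R e)"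
    using onb_expand[OF g E, of "raise h l - raise g l"] by simp
  then show ?thesis
    by (simp add: scaleR_sum_left sum_negf algebra_simps)
qed

text \<open>The resolvent identity bounds |R y - R p| by |R y| d y, where d y tends to 0. Once d y <
  1/2 this forces |R y| <= 2 |R p|, so the bound itself tends to 0.\<close>

lemma isCont_raise:
  fixes g :: "'a::real_normed_vector \<Rightarrow> 'v::euclidean_space \<Rightarrow> 'v \<Rightarrow> real"
  assumes V: "open V" "p \<in> V" and g: "\<And>y. y \<in> V \<Longrightarrow> metric_tensor (g y)"
    and cont: "\<And>v w. isCont (\<lambda>y. g y v w) p"
  shows "isCont (\<lambda>y. raise (g y) l) p"
proof -
  obtain E where E: "onb (g p) E" using ex_onb[OF g[OF V(2)]] .
  define d where "d y = (\<Sum>e\<in>E. \<Sum>b\<in>Basis. \<bar>g y b e - g p b e\<bar> * norm e)" for y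
  let ?R = "\<lambda>y. raise (g y) l"
  have d: "norm (?R y - ?R p) \<le> norm (?R y) * d y" if "y \<in> V" for y
  proof -
    have "a = b - c \<Longrightarrow> a - b = - c" for a b c :: 'v by simp
    from this[OF raise_diff[OF g[OF V(2)] g[OF that] E, of l]]
    have "?R y - ?R p = - (\<Sum>e\<in>E. \<Sum>b\<in>Basis. ((?R y \<bullet> b) * (g y b e - g p b e)) *\<^sub>R e)"
      .
    then have "norm (?R y - ?R p) = norm (\<Sum>e\<in>E. \<Sum>b\<in>Basis. ((?R y \<bullet> b) * (g y b e - g p b e)) *\<^sub>R e)"
      by (simp only: norm_minus_cancel)
    also have "\<dots> \<le> (\<Sum>e\<in>E. \<Sum>b\<in>Basis. norm (?R y) * (\<bar>g y b e - g p b e\<bar> * norm e))"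
      by (intro sum_norm_le order_trans[OF norm_sum] sum_mono)
        (auto simp: abs_mult mult.assoc intro!: mult_right_mono Basis_le_norm)
    also have "\<dots> = norm (?R y) * d y" by (simp add: d_def sum_distrib_left)
    finally show ?thesis .
  qed
  have "isCont d p" unfolding d_def by (intro continuous_intros cont)
  then have dz: "(d \<longlongrightarrow> 0) (at p)" unfolding isCont_def by (simp add: d_def)
  have "\<forall>\<^sub>F y in at p. d y < 1 / 2" using dz by (rule order_tendstoD) simp
  moreover have "\<forall>\<^sub>F y in at p. y \<in> V" using V eventually_at_in_open' by blast
  ultimately have "\<forall>\<^sub>F y in at p. norm (?R y - ?R p) \<le> 2 * norm (?R p) * d y"
  proof eventually_elim
    case (elim y)
    have "norm (?R y) \<le> norm (?R p) + norm (?R y - ?R p)"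
      by (rule norm_triangle_sub)
    moreover have "norm (?R y) * d y \<le> norm (?R y) * (1 / 2)"
      using elim by (intro mult_left_mono) auto
    ultimately have "norm (?R y) \<le> 2 * norm (?R p)" using d[OF elim(2)] by linarith
    then have "norm (?R y) * d y \<le> 2 * norm (?R p) * d y"
      by (intro mult_right_mono) (auto simp: d_def intro!: sum_nonneg)
    then show ?case using d[OF elim(2)] by linarith
  qed
  moreover have "((\<lambda>y. 2 * norm (?R p) * d y) \<longlongrightarrow> 0) (at p)"
    using tendsto_mult[OF tendsto_const dz] by simp
  ultimately have "((\<lambda>y. ?R y - ?R p) \<longlongrightarrow> 0) (at p)"
    by (rule Lim_null_comparison)
  then show ?thesis unfolding isCont_def by (simp add: LIM_zero_iff)
qed

lemma has_derivative_raise: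
  fixes g :: "'a::real_normed_vector \<Rightarrow> 'v::euclidean_space \<Rightarrow> 'v \<Rightarrow> real"
  assumes V: "open V" "p \<in> V" and g: "\<And>y. y \<in> V \<Longrightarrow> metric_tensor (g y)"
    and D: "\<And>v w. ((\<lambda>y. g y v w) has_derivative (\<lambda>a. g' a v w)) (at p)"
    and B: "\<And>a. bilinear (g' a)" and E: "onb (g p) E"
  shows "((\<lambda>y. raise (g y) l) has_derivative (\<lambda>a. - (\<Sum>e\<in>E. g' a (raise (g p) l) e *\<^sub>R e))) (at p)"
proof -
  let ?R = "\<lambda>y. raise (g y) l"
  have R: "isCont ?R p"
    by (rule isCont_raise[OF V g]) (auto intro: has_derivative_continuous[OF D])
  have 1: "((\<lambda>y. (?R y \<bullet> b) * (g y b e - g p b e)) has_derivative (\<lambda>a. (?R p \<bullet> b) * g' a b e)) (at p)" for b e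
    by (rule has_derivative_mult_zero) (auto intro!: continuous_intros R derivative_eq_intros D)
  have "((\<lambda>y. ?R p - (\<Sum>e\<in>E. \<Sum>b\<in>Basis. ((?R y \<bullet> b) * (g y b e - g p b e)) *\<^sub>R e)) has_derivative
      (\<lambda>a. 0 - (\<Sum>e\<in>E. \<Sum>b\<in>Basis. ((?R p \<bullet> b) * g' a b e) *\<^sub>R e))) (at p)"
    by (intro has_derivative_diff has_derivative_const has_derivative_sum has_derivative_scaleR_left 1)
  moreover have "(\<Sum>b\<in>Basis. ((?R p \<bullet> b) * g' a b e) *\<^sub>R e) = g' a (?R p) e *\<^sub>R e" for a e
    using linear_sum_Basis[OF bilinear_linear(2)[OF B[of a]], of "?R p" e]
    by (simp add: scaleR_sum_left)
  ultimately have "((\<lambda>y. ?R p - (\<Sum>e\<in>E. \<Sum>b\<in>Basis. ((?R y \<bullet> b) * (g y b e - g p b e)) *\<^sub>R e)) has_derivative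
      (\<lambda>a. - (\<Sum>e\<in>E. g' a (?R p) e *\<^sub>R e))) (at p)"
    by simp
  then show ?thesis
    by (rule has_derivative_transform_within_open[OF _ V]) (rule raise_diff[OF g[OF V(2)] g E, symmetric])
qed

text \<open>The second sum is the contribution of the inverse metric. When (star) is differentiated
  it becomes the part quadratic in the first derivatives of \<omega>.\<close>

lemma has_derivative_tr:
  fixes g :: "'a::real_normed_vector \<Rightarrow> 'v::euclidean_space \<Rightarrow> 'v \<Rightarrow> real"
  assumes V: "open V" "p \<in> V" and g: "\<And>y. y \<in> V \<Longrightarrow> metric_tensor (g y)"
    and D: "\<And>v w. ((\<lambda>y. g y v w) has_derivative (\<lambda>a. g' a v w)) (at p)"
    and B: "\<And>a. bilinear (g' a)" and E: "onb (g p) E"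
    and H: "\<And>y. y \<in> V \<Longrightarrow> bilinear (H y)"
    and DH: "\<And>v w. ((\<lambda>y. H y v w) has_derivative (\<lambda>a. H' a v w)) (at p)"
    and BH: "\<And>a. bilinear (H' a)"
  shows "((\<lambda>y. tr (g y) (H y)) has_derivative
    (\<lambda>a. (\<Sum>e\<in>E. H' a e e) - (\<Sum>e\<in>E. \<Sum>e'\<in>E. g' a e e' * H p e e'))) (at p)"
proof -
  let ?R = "\<lambda>y. raise (g y)" and ?R' = "\<lambda>l a. - (\<Sum>e\<in>E. g' a (raise (g p) l) e *\<^sub>R e)"
  have gp: "metric_tensor (g p)" and Hp: "bilinear (H p)" using g H V by auto
  \<comment> \<open>Both arguments of \<open>H y\<close> must be constant for \<open>DH\<close> to
    apply, so the raised vector is expanded in the coordinate basis as well.\<close>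
  have "((\<lambda>y. \<Sum>b\<in>Basis. \<Sum>c\<in>Basis. (?R y b \<bullet> c) * H y b c) has_derivative
    (\<lambda>a. \<Sum>b\<in>Basis. \<Sum>c\<in>Basis. (?R p b \<bullet> c) * H' a b c + (?R' b a \<bullet> c) * H p b c)) (at p)"
    by (intro has_derivative_sum has_derivative_mult DH has_derivative_inner_left
        has_derivative_raise[OF V g D B E])
  moreover have sumc: "(\<Sum>c\<in>Basis. (w \<bullet> c) * K c) = K w" if "linear K" for w and K :: "'v \<Rightarrow> real"
    using linear_sum_Basis[OF that, of w] by simp
  have "(\<Sum>b\<in>Basis. \<Sum>c\<in>Basis. (?R p b \<bullet> c) * H' a b c + (?R' b a \<bullet> c) * H p b c) =
      (\<Sum>e\<in>E. H' a e e) - (\<Sum>e\<in>E. \<Sum>e'\<in>E. g' a e e' * H p e e')" (is "?L = _") for a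
  proof -
    have "?L = (\<Sum>b\<in>Basis. H' a b (?R p b)) + (\<Sum>b\<in>Basis. H p b (?R' b a))"
      by (simp only: sum.distrib sumc[OF bilinear_linear(1)[OF BH]] sumc[OF bilinear_linear(1)[OF Hp]])
    also have "(\<Sum>b\<in>Basis. H' a b (?R p b)) = (\<Sum>e\<in>E. H' a e e)"
      using tr_onb[OF gp E BH[of a]] by (simp add: tr_def)
    also have "(\<Sum>b\<in>Basis. H p b (?R' b a)) = - (\<Sum>b\<in>Basis. \<Sum>e\<in>E. g' a (?R p b) e * H p b e)"
      by (simp add: bilinear_rneg[OF Hp] bilinear_sum_sum(2)[OF Hp] sum_negf)
    also have "(\<Sum>b\<in>Basis. \<Sum>e\<in>E. g' a (?R p b) e * H p b e) =
        (\<Sum>e\<in>E. tr (g p) (\<lambda>b c. g' a c e * H p b e))"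
      unfolding tr_def by (rule sum.swap)
    also have "\<dots> = (\<Sum>e\<in>E. \<Sum>b\<in>E. g' a b e * H p b e)"
    proof (intro sum.cong refl tr_onb[OF gp E])
      fix e
      show "bilinear (\<lambda>b c. g' a c e * H p b e)"
        unfolding bilinear_def
        by (auto intro!: linearI simp: bilinear_ladd[OF B] bilinear_lmul[OF B]
            bilinear_ladd[OF Hp] bilinear_lmul[OF Hp] algebra_simps)
    qed
    also have "\<dots> = (\<Sum>e\<in>E. \<Sum>e'\<in>E. g' a e e' * H p e e')" by (rule sum.swap)
    finally show ?thesis by simp
  qed
  ultimately have "((\<lambda>y. \<Sum>b\<in>Basis. \<Sum>c\<in>Basis. (?R y b \<bullet> c) * H y b c) has_derivative
    (\<lambda>a. (\<Sum>e\<in>E. H' a e e) - (\<Sum>e\<in>E. \<Sum>e'\<in>E. g' a e e' * H p e e'))) (at p)"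
    by simp
  then show ?thesis
    by (rule has_derivative_transform_within_open[OF _ V])
      (simp add: tr_def sumc bilinear_linear(1)[OF H])
qed

section \<open>The volume density\<close>

lemma has_derivative_det_mat1:
  fixes M :: "'a::real_normed_vector \<Rightarrow> real^'k^'k"
  assumes D: "\<And>i j. ((\<lambda>y. M y $ i $ j) has_derivative M' i j) (at p)" and M: "M p = mat 1"
  shows "((\<lambda>y. det (M y)) has_derivative (\<lambda>a. \<Sum>i\<in>UNIV. M' i i a)) (at p)"
proof -
  let ?P = "{q. q permutes (UNIV :: 'k set)}"
  have "((\<lambda>y. det (M y)) has_derivative
      (\<lambda>a. \<Sum>q\<in>?P. of_int (sign q) * (\<Sum>i\<in>UNIV. M' i (q i) a * (\<Prod>j\<in>UNIV - {i}. M p $ j $ q j)))) (at p)"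
    unfolding det_def
    by (intro has_derivative_sum has_derivative_mult_right has_derivative_prod D)
  moreover have K: "of_int (sign q) * (\<Sum>i\<in>UNIV. M' i (q i) a * (\<Prod>j\<in>UNIV - {i}. M p $ j $ q j)) =
      (if q = id then \<Sum>i\<in>UNIV. M' i i a else 0)" if "q \<in> ?P" for q a
  proof (cases "q = id")
    case True
    then show ?thesis by (simp add: M mat_def sign_id)
  next
    case False
    \<comment> \<open>A permutation other than \<open>id\<close> moves \<open>i0\<close> and also
      \<open>q i0\<close>. Whichever single factor is differentiated, an off-diagonal zero of the
      identity matrix remains.\<close>
    then obtain i0 where i0: "q i0 \<noteq> i0" by (auto simp: fun_eq_iff)
    have "inj q" using that by (simp add: permutes_inj)
    then have i1: "q (q i0) \<noteq> q i0" using i0 by (simp add: inj_eq)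
    have "(\<Prod>j\<in>UNIV - {i}. M p $ j $ q j) = 0" for i
    proof -
      have "\<exists>j\<in>UNIV - {i}. q j \<noteq> j"
        using i0 i1 by (cases "i = i0") auto
      then obtain j where "j \<in> UNIV - {i}" "q j \<noteq> j" by blast
      then show ?thesis by (intro prod_zero) (auto simp: M mat_def intro!: bexI[of _ j])
    qed
    then show ?thesis using False by (simp only: mult_zero_right sum.neutral_const if_False)
  qed
  have "(\<Sum>q\<in>?P. of_int (sign q) * (\<Sum>i\<in>UNIV. M' i (q i) a * (\<Prod>j\<in>UNIV - {i}. M p $ j $ q j))) =
      (\<Sum>i\<in>UNIV. M' i i a)" for a
  proof -
    have "(\<Sum>q\<in>?P. of_int (sign q) * (\<Sum>i\<in>UNIV. M' i (q i) a * (\<Prod>j\<in>UNIV - {i}. M p $ j $ q j))) =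
        (\<Sum>q\<in>?P. if q = id then \<Sum>i\<in>UNIV. M' i i a else 0)"
      by (rule sum.cong[OF refl K])
    also have "\<dots> = (\<Sum>i\<in>UNIV. M' i i a)"
      by (subst sum.delta) (auto simp: permutes_id)
    finally show ?thesis .
  qed
  ultimately show ?thesis by simp
qed

lemma bij_betw_real_frame: "bij_betw real_frame UNIV (Basis :: (complex^'n::finite) set)"
proof -
  have "inj (real_frame :: 'n + 'n \<Rightarrow> complex^'n)"
    by (auto simp: inj_def real_frame_def axis_eq_axis split: sum.splits)
  moreover have "b \<in> range real_frame" if "b \<in> Basis" for b :: "complex^'n"
  proof -
    obtain i u where "b = axis i u" "u \<in> {1, \<i>}"
      using \<open>b \<in> Basis\<close> by (auto simp: Basis_vec_def Basis_complex_def)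
    then have "b = real_frame (Inl i) \<or> b = real_frame (Inr i)" by (auto simp: real_frame_def)
    then show ?thesis by auto
  qed
  moreover have "real_frame s \<in> Basis" for s :: "'n + 'n"
    by (cases s) (auto simp: real_frame_def Basis_vec_def Basis_complex_def)
  ultimately show ?thesis by (auto simp: bij_betw_def)
qed

lemma sum_real_frame: "(\<Sum>s\<in>UNIV. h (real_frame s)) = (\<Sum>b\<in>Basis. h b)"
  by (rule sum.reindex_bij_betw[OF bij_betw_real_frame])

lemma real_frame_inner:
  "real_frame s \<bullet> (real_frame t :: complex^'n::finite) = (if s = t then 1 else 0)"
  using bij_betw_real_frame[where 'n = 'n]
  by (metis (no_types) bij_betw_def inj_eq inner_Basis rangeI)

definition gram :: "(complex^'n \<Rightarrow> complex^'n::finite \<Rightarrow> real) \<Rightarrow> real^('n + 'n)^('n + 'n)" where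
  "gram g = (\<chi> s t. g (real_frame s) (real_frame t))"

lemma volume_density_gram: "volume_density g = sqrt (det (gram g))"
  by (simp add: volume_density_def gram_def)

lemma det_gram_nz:
  fixes g :: "complex^'n \<Rightarrow> complex^'n::finite \<Rightarrow> real"
  assumes g: "metric_tensor g"
  shows "det (gram g) \<noteq> 0"
proof
  have B: "bilinear g" and pos: "\<And>v. v \<noteq> 0 \<Longrightarrow> g v v > 0"
    using g by (auto simp: metric_tensor_def)
  assume "det (gram g) = 0"
  then obtain x where x: "x \<noteq> 0" "gram g *v x = 0"
    by (metis invertible_det_nz invertible_left_inverse matrix_left_invertible_ker)
  define v where "v = (\<Sum>t\<in>UNIV. (x $ t) *\<^sub>R (real_frame t :: complex^'n))"
  have "g (real_frame s) v = (gram g *v x) $ s" for s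
    by (simp add: v_def bilinear_sum_sum(2)[OF B] matrix_vector_mult_def gram_def mult.commute)
  then have "g v v = 0"
    unfolding v_def[THEN arg_cong, of "\<lambda>w. g w v"] bilinear_sum_sum(1)[OF B] by (simp add: x)
  then have "v = 0" using pos by force
  moreover have "v \<bullet> real_frame s = x $ s" for s
    by (simp add: v_def inner_sum_left real_frame_inner if_distrib cong: if_cong)
  ultimately have "x = 0" by (metis inner_zero_left vec_eq_iff zero_index)
  then show False using x by simp
qed

text \<open>The segment from the Euclidean inner product to \<open>g\<close> consists of scalar
  products, so the determinant has no zero along it, and it starts at 1.\<close>

lemma det_gram_pos:
  fixes g :: "complex^'n \<Rightarrow> complex^'n::finite \<Rightarrow> real"
  assumes g: "metric_tensor g"
  shows "det (gram g) > 0"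
proof (rule ccontr)
  have B: "bilinear g" and sym: "\<And>v w. g v w = g w v" and pos: "\<And>v. v \<noteq> 0 \<Longrightarrow> g v v > 0"
    using g by (auto simp: metric_tensor_def)
  define h where "h t v w = (1 - t) * (v \<bullet> w) + t * g v w" for t :: real and v w :: "complex^'n"
  define f where "f t = det (gram (h t))" for t
  assume "\<not> det (gram g) > 0"
  then have "f 1 \<le> 0" by (simp add: f_def h_def[abs_def])
  moreover have "gram (h 0) = mat 1"
    by (simp add: gram_def h_def mat_def vec_eq_iff real_frame_inner)
  then have "0 \<le> f 0" by (simp add: f_def)
  moreover have "continuous_on {0..1} f"
    unfolding f_def det_def gram_def h_def by (simp, intro continuous_intros)
  ultimately obtain t where t: "0 \<le> t" "t \<le> 1" "f t = 0"
    using IVT2'[of f 1 0 0] by auto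
  have "bilinear (h t)"
    unfolding bilinear_def h_def
    by (auto intro!: linearI simp: inner_add_left inner_add_right bilinear_ladd[OF B]
        bilinear_lmul[OF B] bilinear_radd[OF B] bilinear_rmul[OF B] algebra_simps)
  moreover have "h t v w = h t w v" for v w by (simp add: h_def sym inner_commute)
  moreover have "h t v v > 0" if "v \<noteq> 0" for v
  proof (cases "t = 1")
    case True
    then show ?thesis using pos[OF that] by (simp add: h_def)
  next
    case False
    then show ?thesis using t pos[OF that] that
      by (simp add: h_def add_pos_nonneg)
  qed
  ultimately have "metric_tensor (h t)" by (simp add: metric_tensor_def)
  from det_gram_nz[OF this] show False using t(3) by (simp add: f_def)
qed

lemma volume_density_pos: "metric_tensor g \<Longrightarrow> volume_density g > 0"
  by (simp add: volume_density_gram det_gram_pos)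

lemma has_derivative_volume_density:
  fixes g :: "'a::real_normed_vector \<Rightarrow> complex^'n \<Rightarrow> complex^'n::finite \<Rightarrow> real"
  assumes g: "metric_tensor (g p)"
    and D: "\<And>v w. ((\<lambda>y. g y v w) has_derivative (\<lambda>a. g' a v w)) (at p)"
    and B: "\<And>a. bilinear (g' a)" and lin: "\<And>y. y \<in> V \<Longrightarrow> bilinear (g y)" and V: "open V" "p \<in> V"
  shows "((\<lambda>y. volume_density (g y)) has_derivative
    (\<lambda>a. volume_density (g p) * tr (g p) (g' a) / 2)) (at p)"
proof -
  let ?f = "real_frame :: 'n + 'n \<Rightarrow> complex^'n"
  have Bg: "bilinear (g p)" using g by (simp add: metric_tensor_def)
  \<comment> \<open>\<open>K\<close> is the inverse of the Gram matrix at \<open>p\<close>.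
    Multiplying by it reduces the derivative of the determinant to the one at the identity
    matrix.\<close>
  define K :: "real^('n + 'n)^('n + 'n)" where "K = (\<chi> s t. raise (g p) (?f s) \<bullet> ?f t)"
  define N :: "'a \<Rightarrow> real^('n + 'n)^('n + 'n)" where "N y = (\<chi> s t. g y (raise (g p) (?f s)) (?f t))" for y
  have KN: "K ** gram (g y) = N y" if "y \<in> V" for y
  proof -
    have "(\<Sum>t\<in>UNIV. (w \<bullet> ?f t) * g y (?f t) u) = g y w u" for w u
      using linear_sum_Basis[OF bilinear_linear(2)[OF lin[OF that]], of w u]
        sum_real_frame[of "\<lambda>b. (w \<bullet> b) * g y b u"] by simp
    then show ?thesis
      by (simp add: K_def N_def gram_def matrix_matrix_mult_def vec_eq_iff)
  qed
  have Np: "N p = mat 1"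
    by (simp add: N_def mat_def vec_eq_iff raise_works[OF g] real_frame_inner)
  have 1: "det K * det (gram (g p)) = 1"
    using arg_cong[OF KN[OF V(2)], of det] Np by (simp add: det_mul)
  then have det: "det (gram (g y)) = det (gram (g p)) * det (N y)" if "y \<in> V" for y
  proof -
    have "det (N y) = det K * det (gram (g y))"
      using arg_cong[OF KN[OF that], of det] by (simp add: det_mul)
    then have "det (gram (g p)) * det (N y) = (det K * det (gram (g p))) * det (gram (g y))"
      by simp
    then show ?thesis unfolding 1 by simp
  qed
  have "((\<lambda>y. det (N y)) has_derivative (\<lambda>a. \<Sum>s\<in>UNIV. g' a (raise (g p) (?f s)) (?f s))) (at p)"
    by (rule has_derivative_det_mat1[where M = N and M' = "\<lambda>s t a. g' a (raise (g p) (?f s)) (?f t)"])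
      (simp_all add: Np, simp add: N_def D)
  moreover have "(\<Sum>s\<in>UNIV. g' a (raise (g p) (?f s)) (?f s)) = tr (g p) (g' a)" for a
    using sum_real_frame[of "\<lambda>b. g' a (raise (g p) b) b"] tr_transpose[OF g B[of a]]
    by (simp add: tr_def)
  ultimately have "((\<lambda>y. det (gram (g p)) * det (N y)) has_derivative
      (\<lambda>a. det (gram (g p)) * tr (g p) (g' a))) (at p)"
    by (intro has_derivative_mult_right) simp
  then have "((\<lambda>y. det (gram (g y))) has_derivative (\<lambda>a. det (gram (g p)) * tr (g p) (g' a))) (at p)"
    by (rule has_derivative_transform_within_open[OF _ V]) (rule det[symmetric])
  then have "((\<lambda>y. sqrt (det (gram (g y)))) has_derivative
      (\<lambda>a. det (gram (g p)) * tr (g p) (g' a) * (inverse (sqrt (det (gram (g p)))) / 2))) (at p)"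
    by (rule DERIV_compose_FDERIV[where g = "\<lambda>y. det (gram (g y))", rotated])
      (rule DERIV_real_sqrt[OF det_gram_pos[OF g]])
  moreover have "det (gram (g p)) * T * (inverse (sqrt (det (gram (g p)))) / 2) =
      sqrt (det (gram (g p))) * T / 2" for T
    using det_gram_pos[OF g] by (simp add: field_simps)
  ultimately show ?thesis by (simp only: volume_density_gram)
qed

section \<open>Hermitian metrics on open sets\<close>

lemma J_J [simp]: "J (J v) = - v"
  by (simp add: vec_eq_iff flip: mult.assoc)

lemma linear_J: "linear J"
  by (rule linearI) (simp_all add: vec_eq_iff algebra_simps)

lemma bounded_linear_J: "bounded_linear J"
  by (simp add: linear_J linear_conv_bounded_linear[symmetric])

lemma J_minus [simp]: "J (- v) = - J v"
  by (rule linear_neg[OF linear_J])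

lemma surj_J: "surj J"
  by (rule surjI[where f = "\<lambda>v. - J v"]) simp

text \<open>Extension by zero: the open sets \<open>V\<close> and \<open>- K\<close> cover the
  space, and the extended function is of class \<open>k\<close> on each.\<close>

lemma Ck_on_if:
  assumes "open V" "compact K" "K \<subseteq> V" "Ck_on k f V" "\<And>x. x \<in> V \<Longrightarrow> x \<notin> K \<Longrightarrow> f x = 0"
  shows "Ck_on k (\<lambda>x. if x \<in> V then f x else 0) UNIV"
proof (rule Ck_on_open_local)
  fix x
  show "\<exists>U. open U \<and> x \<in> U \<and> Ck_on k (\<lambda>x. if x \<in> V then f x else 0) U"
  proof (cases "x \<in> K")
    case True
    have "Ck_on k (\<lambda>x. if x \<in> V then f x else 0) V"
      by (rule Ck_on_cong[OF assms(1) _ assms(4)]) simp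
    then show ?thesis using True assms by blast
  next
    case False
    have o: "open (- K)" using compact_imp_closed[OF assms(2)] by (simp add: open_Compl)
    have "Ck_on k (\<lambda>x. if x \<in> V then f x else 0) (- K)"
      by (rule Ck_on_cong[OF o _ Ck_on_const[OF o, of _ 0]]) (use assms in auto)
    with o show ?thesis using False by blast
  qed
qed

text \<open>The identities expressing linearity hold for all \<open>y\<close> in the open set, so
  they can be differentiated in \<open>y\<close>. This makes derivatives of tensor fields
  multilinear in their vector arguments.\<close>

lemma linear_fd_parameter:
  assumes "open V" "p \<in> V" "\<And>y. y \<in> V \<Longrightarrow> linear (K y)" "\<And>v. smooth_on (\<lambda>y. K y v) V"
  shows "linear (\<lambda>v. fd (\<lambda>y. K y v) p a)"
proof (rule linearI)
  note D = smooth_on_has_derivative[OF assms(4,2)]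
  show "fd (\<lambda>y. K y (v + w)) p a = fd (\<lambda>y. K y v) p a + fd (\<lambda>y. K y w) p a" for v w
  proof -
    have "fd (\<lambda>y. K y (v + w)) p = fd (\<lambda>y. K y v + K y w) p"
      by (rule fd_cong[OF assms(1,2)]) (simp add: linear_add[OF assms(3)])
    then show ?thesis by (simp add: fd_eqI[OF has_derivative_add[OF D D]])
  qed
  show "fd (\<lambda>y. K y (c *\<^sub>R v)) p a = c *\<^sub>R fd (\<lambda>y. K y v) p a" for c v
  proof -
    have "fd (\<lambda>y. K y (c *\<^sub>R v)) p = fd (\<lambda>y. c *\<^sub>R K y v) p"
      by (rule fd_cong[OF assms(1,2)]) (simp add: linear_scale[OF assms(3)])
    then show ?thesis by (simp add: fd_eqI[OF has_derivative_scaleR_right[OF D]])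
  qed
qed

lemma bilinear_fd_parameter:
  assumes "open V" "p \<in> V" "\<And>y. y \<in> V \<Longrightarrow> bilinear (K y)" "\<And>v w. smooth_on (\<lambda>y. K y v w) V"
  shows "bilinear (\<lambda>v w. fd (\<lambda>y. K y v w) p a)"
  unfolding bilinear_def
  using linear_fd_parameter[OF assms(1,2), of "\<lambda>y. K y v" for v] linear_fd_parameter[OF assms(1,2), of "\<lambda>y v. K y v w" for w]
  by (auto simp: bilinear_linear[OF assms(3)] assms(4))

lemma fd_uminus: "f differentiable (at x) \<Longrightarrow> fd (\<lambda>y. - f y) x a = - fd f x a"
  by (simp add: fd_eqI[OF has_derivative_minus[OF fd_works]])

section \<open>The local model: a Hermitian form in one chart\<close>

locale hermitian_field =
  fixes V :: "(complex^'n::finite) set" and W :: "complex^'n \<Rightarrow> complex^'n \<Rightarrow> complex^'n \<Rightarrow> real"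
  assumes V: "open V"
    and bilinear_W: "\<And>y. y \<in> V \<Longrightarrow> bilinear (W y)"
    and skew: "\<And>y v w. y \<in> V \<Longrightarrow> W y v w = - W y w v"
    and J_inv: "\<And>y v w. y \<in> V \<Longrightarrow> W y (J v) (J w) = W y v w"
    and pos: "\<And>y v. y \<in> V \<Longrightarrow> v \<noteq> 0 \<Longrightarrow> W y v (J v) > 0"
    and smooth: "\<And>v w. smooth_on (\<lambda>y. W y v w) V"
begin

definition g :: "complex^'n \<Rightarrow> complex^'n \<Rightarrow> complex^'n \<Rightarrow> real" where
  "g y v w = W y v (J w)"

definition D1 :: "complex^'n \<Rightarrow> complex^'n \<Rightarrow> complex^'n \<Rightarrow> complex^'n \<Rightarrow> real" where
  "D1 y a v w = fd (\<lambda>y. W y v w) y a"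

definition D2 :: "complex^'n \<Rightarrow> complex^'n \<Rightarrow> complex^'n \<Rightarrow> complex^'n \<Rightarrow> complex^'n \<Rightarrow> real" where
  "D2 y a b v w = fd (\<lambda>y. D1 y b v w) y a"

text \<open>The trace of this form in \<open>a\<close> and \<open>b\<close> is the sum in equation (star).\<close>

definition star_form :: "complex^'n \<Rightarrow> complex^'n \<Rightarrow> complex^'n \<Rightarrow> complex^'n \<Rightarrow> real" where
  "star_form y w a b = 1 / 2 * D1 y (J w) a (J b) + D1 y a b w"

lemma W_J_swap:
  assumes y: "y \<in> V"
  shows "W y v (J w) = - W y (J v) w"
  using J_inv[OF y, of v "J w"] bilinear_rneg[OF bilinear_W[OF y], of "J v" w] by simp

lemma metric_g: "y \<in> V \<Longrightarrow> metric_tensor (g y)"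
  unfolding metric_tensor_def g_def
proof (intro conjI allI impI)
  assume y: "y \<in> V"
  show "bilinear (\<lambda>v w. W y v (J w))"
    using bilinear_W[OF y] linear_J unfolding bilinear_def
    by (auto intro: linear_compose[unfolded o_def])
  show "W y v (J w) = W y w (J v)" for v w
    using W_J_swap[OF y, of v w] skew[OF y, of w "J v"] by simp
qed (use pos in auto)

lemma g_J: "y \<in> V \<Longrightarrow> g y (J v) (J w) = g y v w"
  unfolding g_def by (rule J_inv)

lemma bilinear_g: "y \<in> V \<Longrightarrow> bilinear (g y)"
  using metric_g by (simp add: metric_tensor_def)

lemma smooth_D1: "smooth_on (\<lambda>y. D1 y a v w) V"
  unfolding D1_def by (rule smooth_on_fd[OF smooth])

lemma linear_D1: "y \<in> V \<Longrightarrow> linear (\<lambda>a. D1 y a v w)"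
  unfolding D1_def by (rule linear_fd[OF smooth])

lemma bilinear_D1: "y \<in> V \<Longrightarrow> bilinear (D1 y a)"
  unfolding D1_def[abs_def] by (rule bilinear_fd_parameter[OF V _ bilinear_W smooth])

lemma D1_skew: "y \<in> V \<Longrightarrow> D1 y a v w = - D1 y a w v"
  unfolding D1_def
  by (subst fd_cong[OF V, of y _ "\<lambda>y. - W y w v"])
    (auto simp: fd_uminus smooth_on_differentiable[OF smooth] skew[of _ v w])

lemma D1_J_inv: "y \<in> V \<Longrightarrow> D1 y a (J v) (J w) = D1 y a v w"
  unfolding D1_def by (subst fd_cong[OF V, of y _ "\<lambda>y. W y v w"]) (auto simp: J_inv)

lemma D1_J_swap: "y \<in> V \<Longrightarrow> D1 y a v (J w) = - D1 y a (J v) w"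
  using D1_J_inv[of y a v "J w"] by (simp add: bilinear_rneg[OF bilinear_D1])

lemma linear_D2: "y \<in> V \<Longrightarrow> linear (\<lambda>a. D2 y a b v w)"
  unfolding D2_def by (rule linear_fd[OF smooth_D1])

lemma linear_D2': "y \<in> V \<Longrightarrow> linear (\<lambda>b. D2 y a b v w)"
  unfolding D2_def
  by (rule linear_fd_parameter[OF V, of _ "\<lambda>y b. D1 y b v w"]) (auto simp: linear_D1 smooth_D1)

lemma bilinear_D2: "y \<in> V \<Longrightarrow> bilinear (D2 y a b)"
  unfolding D2_def[abs_def] by (rule bilinear_fd_parameter[OF V _ bilinear_D1 smooth_D1])

lemma D2_skew: "y \<in> V \<Longrightarrow> D2 y a b v w = - D2 y a b w v"
  unfolding D2_def
  by (subst fd_cong[OF V, of y _ "\<lambda>y. - D1 y b w v"])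
    (auto simp: fd_uminus smooth_on_differentiable[OF smooth_D1] D1_skew[of _ b v w])

lemma D2_J_inv: "y \<in> V \<Longrightarrow> D2 y a b (J v) (J w) = D2 y a b v w"
  unfolding D2_def by (subst fd_cong[OF V, of y _ "\<lambda>y. D1 y b v w"]) (auto simp: D1_J_inv)

lemma D2_J_swap: "y \<in> V \<Longrightarrow> D2 y a b v (J w) = - D2 y a b (J v) w"
  using D2_J_inv[of y a b v "J w"] by (simp add: bilinear_rneg[OF bilinear_D2])

lemma g_has_derivative: "y \<in> V \<Longrightarrow> ((\<lambda>y. g y v w) has_derivative (\<lambda>a. D1 y a v (J w))) (at y)"
  unfolding g_def D1_def by (rule smooth_on_has_derivative[OF smooth])

lemma bilinear_D1_J: "y \<in> V \<Longrightarrow> bilinear (\<lambda>v w. D1 y a v (J w))"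
  using bilinear_D1[of y a] linear_J unfolding bilinear_def
  by (auto intro: linear_compose[unfolded o_def])

lemma bilinear_star_form: "y \<in> V \<Longrightarrow> bilinear (star_form y w)"
  unfolding star_form_def bilinear_def
proof (intro conjI allI)
  assume y: "y \<in> V"
  note [simp] = bilinear_ladd[OF bilinear_D1[OF y]] bilinear_radd[OF bilinear_D1[OF y]]
    bilinear_lmul[OF bilinear_D1[OF y]] bilinear_rmul[OF bilinear_D1[OF y]]
    linear_add[OF linear_D1[OF y]] linear_scale[OF linear_D1[OF y]]
    linear_add[OF linear_J] linear_scale[OF linear_J]
  show "linear (\<lambda>b. 1 / 2 * D1 y (J w) a (J b) + D1 y a b w)" for a
    by (rule linearI) (simp_all add: algebra_simps)
  show "linear (\<lambda>a. 1 / 2 * D1 y (J w) a (J b) + D1 y a b w)" for b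
    by (rule linearI) (simp_all add: algebra_simps)
qed

lemma tr_J:
  assumes "y \<in> V" "bilinear B"
  shows "tr (g y) (\<lambda>a b. B (J a) (J b)) = tr (g y) B"
  by (rule tr_image[OF metric_g metric_g linear_J surj_J g_J]) (use assms in auto)

text \<open>Replace an orthonormal basis by its image under \<open>J\<close> and use that
  \<open>J\<close> squares to -1.\<close>

lemma tr_J_swap:
  assumes y: "y \<in> V" and B: "bilinear B"
  shows "tr (g y) (\<lambda>a b. B (J a) b) = - tr (g y) (\<lambda>a b. B a (J b))"
proof -
  have "bilinear (\<lambda>a b. B (J a) b)"
    using B linear_J unfolding bilinear_def by (auto intro: linear_compose[unfolded o_def])
  from tr_J[OF y this] show ?thesis
    by (simp add: bilinear_lneg[OF B] tr_uminus)
qed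

text \<open>The orthonormal basis of \<open>has_derivative_raise\<close> depends on the point. Here
  it is traded for the coordinate basis, which leaves a formula in \<open>D1\<close> and
  \<open>raise\<close> that can be differentiated again.\<close>

lemma raise_has_derivative:
  assumes y: "y \<in> V"
  shows "((\<lambda>y. raise (g y) l) has_derivative
    (\<lambda>a. - (\<Sum>b\<in>Basis. D1 y a (raise (g y) l) (J b) *\<^sub>R raise (g y) b))) (at y)"
proof -
  obtain E where E: "onb (g y) E" using ex_onb[OF metric_g[OF y]] .
  have "(\<Sum>e\<in>E. D1 y a (raise (g y) l) (J e) *\<^sub>R e) =
      (\<Sum>b\<in>Basis. D1 y a (raise (g y) l) (J b) *\<^sub>R raise (g y) b)" for a
  proof (rule euclidean_eqI)
    fix c :: "complex^'n"
    note [simp] = bilinear_radd[OF bilinear_D1[OF y]] bilinear_rmul[OF bilinear_D1[OF y]]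
      linear_add[OF linear_J] linear_scale[OF linear_J]
    have "bilinear (\<lambda>v w. D1 y a (raise (g y) l) (J v) * (w \<bullet> c))"
      unfolding bilinear_def by (auto intro!: linearI simp: inner_add_left algebra_simps)
    from tr_onb[OF metric_g[OF y] E this]
    show "(\<Sum>e\<in>E. D1 y a (raise (g y) l) (J e) *\<^sub>R e) \<bullet> c =
      (\<Sum>b\<in>Basis. D1 y a (raise (g y) l) (J b) *\<^sub>R raise (g y) b) \<bullet> c"
      by (simp add: tr_def inner_sum_left)
  qed
  with has_derivative_raise[OF V y metric_g g_has_derivative[OF y] bilinear_D1_J[OF y] E, of l]
  show ?thesis by (simp only:)
qed

text \<open>Bootstrapping: the derivative of \<open>raise\<close> is built algebraically from
  \<open>raise\<close> and \<open>D1\<close>, so class \<open>k\<close> implies class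
  \<open>k + 1\<close>. The volume density is treated in the same way.\<close>

lemma smooth_raise: "smooth_on (\<lambda>y. raise (g y) l) V"
proof -
  have "Ck_on k (\<lambda>y. raise (g y) l) V" for k l
  proof (induction k arbitrary: l)
    case 0
    have "isCont (\<lambda>y. raise (g y) l) y" if "y \<in> V" for y
      by (rule has_derivative_continuous[OF raise_has_derivative[OF that]])
    then show ?case by (simp add: continuous_at_imp_continuous_on)
  next
    case (Suc k)
    have "Ck_on k (\<lambda>y. - (\<Sum>b\<in>Basis. D1 y a (raise (g y) l) (J b) *\<^sub>R raise (g y) b)) V" for a
    proof -
      have "Ck_on k (\<lambda>y. - (\<Sum>b\<in>Basis. (\<Sum>c\<in>Basis. (raise (g y) l \<bullet> c) * D1 y a c (J b)) *\<^sub>R raise (g y) b)) V"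
      proof (intro Ck_on_linear_comp[where L = uminus] bounded_linear_minus bounded_linear_ident V
          Ck_on_sum Ck_on_scaleR Ck_on_mult Suc)
        show "Ck_on k (\<lambda>y. raise (g y) l \<bullet> c) V" for c
          by (intro Ck_on_linear_comp[where L = "\<lambda>x. x \<bullet> c"] bounded_linear_inner_left V Suc)
        show "Ck_on k (\<lambda>y. D1 y a c (J b)) V" for b c
          using smooth_D1 by (simp add: smooth_on_def)
      qed
      note 1 = this
      have "(\<Sum>c\<in>Basis. (v \<bullet> c) * D1 y a c w) = D1 y a v w" if "y \<in> V" for v w y
        using linear_sum_Basis[OF bilinear_linear(2)[OF bilinear_D1[OF that]], of a v w] by simp
      then show ?thesis
        by (intro Ck_on_cong[OF V _ 1]) simp
    qed
    from Ck_on_SucI[OF V raise_has_derivative this] show ?case .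
  qed
  then show ?thesis by (simp add: smooth_on_def)
qed

lemma density_has_derivative:
  assumes y: "y \<in> V"
  shows "((\<lambda>y. volume_density (g y)) has_derivative
    (\<lambda>a. volume_density (g y) * tr (g y) (\<lambda>v w. D1 y a v (J w)) / 2)) (at y)"
  by (rule has_derivative_volume_density[OF metric_g[OF y] g_has_derivative[OF y] bilinear_D1_J[OF y]
      bilinear_g V y])

lemma smooth_density: "smooth_on (\<lambda>y. volume_density (g y)) V"
proof -
  have "Ck_on k (\<lambda>y. volume_density (g y)) V" for k
  proof (induction k)
    case 0
    have "isCont (\<lambda>y. volume_density (g y)) y" if "y \<in> V" for y
      by (rule has_derivative_continuous[OF density_has_derivative[OF that]])
    then show ?case by (simp add: continuous_at_imp_continuous_on)
  next
    case (Suc k)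
    have "Ck_on k (\<lambda>y. volume_density (g y) * tr (g y) (\<lambda>v w. D1 y a v (J w)) / 2) V" for a
    proof -
      have "Ck_on k (\<lambda>y. volume_density (g y) *
          (\<Sum>b\<in>Basis. \<Sum>c\<in>Basis. (raise (g y) b \<bullet> c) * D1 y a b (J c)) * (1 / 2)) V"
      proof (intro Ck_on_sum Ck_on_mult Suc V Ck_on_const)
        show "Ck_on k (\<lambda>y. raise (g y) b \<bullet> c) V" for b c
          using smooth_raise by (intro Ck_on_linear_comp[where L = "\<lambda>x. x \<bullet> c"] bounded_linear_inner_left V)
            (simp add: smooth_on_def)
        show "Ck_on k (\<lambda>y. D1 y a b (J c)) V" for b c
          using smooth_D1 by (simp add: smooth_on_def)
      qed
      note 1 = this
      have "(\<Sum>c\<in>Basis. (w \<bullet> c) * D1 y a v (J c)) = D1 y a v (J w)" if "y \<in> V" for v w y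
        using linear_sum_Basis[OF bilinear_linear(1)[OF bilinear_D1_J[OF that]], where v = w] by simp
      then show ?thesis
        by (intro Ck_on_cong[OF V _ 1]) (simp add: tr_def)
    qed
    from Ck_on_SucI[OF V density_has_derivative this] show ?case .
  qed
  then show ?thesis by (simp add: smooth_on_def)
qed

end

section \<open>From the weak balanced condition to the pointwise equation (star)\<close>

context hermitian_field
begin

text \<open>This is the origin of \<open>star_form\<close>: the derivative of the density
  contributes half a trace along \<open>J w\<close>, and the derivative of the raised covector
  contributes the other summand after substituting \<open>J\<close> of the basis and using skew
  symmetry.\<close>

lemma divergence_eq_star:
  assumes y: "y \<in> V"
  shows "(\<Sum>b\<in>Basis. fd (\<lambda>y. (volume_density (g y) *\<^sub>R J (raise (g y) l)) \<bullet> b) y b) =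
    volume_density (g y) * tr (g y) (star_form y (raise (g y) l))"
proof -
  let ?\<rho> = "volume_density (g y)" and ?w = "raise (g y) l" and ?G = "raise (g y)"
  let ?G' = "\<lambda>a. - (\<Sum>c\<in>Basis. D1 y a ?w (J c) *\<^sub>R ?G c)"
  let ?\<rho>' = "\<lambda>a. ?\<rho> * tr (g y) (\<lambda>v w. D1 y a v (J w)) / 2"
  note B = bilinear_D1[OF y] and lin = linear_D1[OF y]
  have D: "((\<lambda>y. (volume_density (g y) *\<^sub>R J (raise (g y) l)) \<bullet> b) has_derivative
      (\<lambda>a. (?\<rho> *\<^sub>R J (?G' a) + ?\<rho>' a *\<^sub>R J ?w) \<bullet> b)) (at y)" for b
    by (intro has_derivative_inner_left has_derivative_scaleR density_has_derivative[OF y]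
        bounded_linear.has_derivative[OF bounded_linear_J] raise_has_derivative[OF y])
  have "(\<Sum>b\<in>Basis. fd (\<lambda>y. (volume_density (g y) *\<^sub>R J (raise (g y) l)) \<bullet> b) y b) =
      (\<Sum>b\<in>Basis. (?\<rho> *\<^sub>R J (?G' b) + ?\<rho>' b *\<^sub>R J ?w) \<bullet> b)"
    by (simp only: fd_eqI[OF D])
  also have "\<dots> = ?\<rho> * (\<Sum>b\<in>Basis. J (?G' b) \<bullet> b) + (\<Sum>b\<in>Basis. (J ?w \<bullet> b) * ?\<rho>' b)"
    by (simp only: inner_add_left inner_scaleR_left sum.distrib sum_distrib_left
        mult.commute[of "J ?w \<bullet> _"])
  also have "(\<Sum>b\<in>Basis. (J ?w \<bullet> b) * ?\<rho>' b) = ?\<rho>' (J ?w)"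
  proof -
    have "linear ?\<rho>'"
      by (rule linearI) (simp_all add: linear_add[OF lin] linear_scale[OF lin] tr_add tr_mult algebra_simps add_divide_distrib)
    from linear_sum_Basis[OF this, of "J ?w"] show ?thesis by simp
  qed
  also have "(\<Sum>b\<in>Basis. J (?G' b) \<bullet> b) = - tr (g y) (\<lambda>c d. D1 y (J d) ?w (J c))"
  proof -
    have "(\<Sum>b\<in>Basis. J (?G' b) \<bullet> b) = - (\<Sum>b\<in>Basis. \<Sum>c\<in>Basis. (J (?G c) \<bullet> b) * D1 y b ?w (J c))"
      by (simp add: linear_sum[OF linear_J] linear_scale[OF linear_J] inner_sum_left sum_negf mult.commute)
    also have "\<dots> = - (\<Sum>c\<in>Basis. \<Sum>b\<in>Basis. (J (?G c) \<bullet> b) * D1 y b ?w (J c))"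
      by (subst sum.swap) simp
    also have "\<dots> = - (\<Sum>c\<in>Basis. D1 y (J (?G c)) ?w (J c))"
    proof -
      have "(\<Sum>b\<in>Basis. (u \<bullet> b) * D1 y b v w) = D1 y u v w" for u v w
        using linear_sum_Basis[OF lin, of u v w] by simp
      then show ?thesis by simp
    qed
    finally show ?thesis by (simp add: tr_def)
  qed
  also have "tr (g y) (\<lambda>c d. D1 y (J d) ?w (J c)) = tr (g y) (\<lambda>c d. D1 y d ?w c)"
  proof -
    have "bilinear (\<lambda>c d. D1 y d ?w c)"
      unfolding bilinear_def
      by (auto intro!: linearI simp: linear_add[OF lin] linear_scale[OF lin] bilinear_radd[OF B] bilinear_rmul[OF B])
    from tr_J[OF y this] show ?thesis .
  qed
  also have "tr (g y) (\<lambda>c d. D1 y d ?w c) = - tr (g y) (\<lambda>c d. D1 y d c ?w)"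
    by (simp add: D1_skew[OF y, of _ ?w] tr_uminus)
  also have "tr (g y) (\<lambda>c d. D1 y d c ?w) = tr (g y) (\<lambda>c d. D1 y c d ?w)"
  proof -
    have "bilinear (\<lambda>c d. D1 y c d ?w)"
      unfolding bilinear_def
      by (auto intro!: linearI simp: linear_add[OF lin] linear_scale[OF lin] bilinear_ladd[OF B] bilinear_lmul[OF B])
    from tr_transpose[OF metric_g[OF y] this] show ?thesis .
  qed
  also have "?\<rho> * - (- tr (g y) (\<lambda>c d. D1 y c d ?w)) + ?\<rho>' (J ?w) = ?\<rho> * tr (g y) (star_form y ?w)"
    unfolding star_form_def[abs_def] tr_add tr_mult by (simp add: algebra_simps)
  finally show ?thesis .
qed

text \<open>The fundamental lemma of the calculus of variations. Near a point where the divergence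
  is nonzero it has a constant sign; a bump function supported there gives an integral that is
  positive by continuity and zero by the weak condition.\<close>

lemma divergence_eq_0_of_weak:
  fixes Y :: "complex^'n \<Rightarrow> complex^'n"
  assumes smooth_Y: "smooth_on Y V"
    and weak: "\<And>(\<phi> :: complex^'n \<Rightarrow> real) K. smooth_on \<phi> UNIV \<Longrightarrow> compact K \<Longrightarrow> K \<subseteq> V \<Longrightarrow> (\<And>x. x \<notin> K \<Longrightarrow> \<phi> x = 0) \<Longrightarrow>
      integral\<^sup>L lborel (\<lambda>x. if x \<in> V then fd \<phi> x (Y x) else 0) = 0"
    and p: "p \<in> V"
  shows "(\<Sum>b\<in>Basis. fd (\<lambda>y. Y y \<bullet> b) p b) = 0"
proof (rule ccontr)
  define h where "h y = (\<Sum>b\<in>Basis. fd (\<lambda>y. Y y \<bullet> b) y b)" for y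
  assume "\<not> ?thesis"
  then have hp: "h p \<noteq> 0" by (simp add: h_def)
  define s where "s = sgn (h p)"
  have smooth_Yb: "smooth_on (\<lambda>y. Y y \<bullet> b) V" for b
    by (rule smooth_on_linear_comp[OF bounded_linear_inner_left V smooth_Y])
  have smooth_h: "smooth_on h V"
    unfolding h_def by (intro smooth_on_sum V smooth_on_fd smooth_Yb)
  have sm: "smooth_on (\<lambda>y. s * h y) V"
    by (intro smooth_on_mult smooth_on_const V smooth_h)
  have "open (V \<inter> (\<lambda>y. s * h y) -` {0<..})"
    by (rule continuous_open_preimage[OF smooth_on_continuous[OF sm] V]) simp
  moreover have "s * h p > 0" using hp by (simp add: s_def sgn_if)
  ultimately obtain r where r: "r > 0" "cball p r \<subseteq> V \<inter> (\<lambda>y. s * h y) -` {0<..}"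
    using p open_contains_cball_eq by (metis IntI greaterThan_iff vimageI)
  obtain \<phi> :: "complex^'n \<Rightarrow> real" where \<phi>: "smooth_on \<phi> UNIV" "\<And>x. x \<in> ball p r \<Longrightarrow> \<phi> x > 0"
    "\<And>x. x \<notin> ball p r \<Longrightarrow> \<phi> x = 0"
    using ex_smooth_bump[OF r(1)] by blast
  let ?K = "cball p r"
  have K: "compact ?K" "?K \<subseteq> V" using r by auto
  have \<phi>K: "\<phi> x = 0" if "x \<notin> ?K" for x using \<phi>(3) that by auto
  have \<phi>'K: "fd \<phi> x v = 0" if "x \<notin> ?K" for x v
    by (rule fd_outside_support[OF K(1) \<phi>K that])
  have \<phi>V: "smooth_on \<phi> V" by (rule smooth_on_subset[OF \<phi>(1)]) simp
  \<comment> \<open>All three are extended by zero off \<open>V\<close>, so that q = s (div(\<phi>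
    Y) - d\<phi>(Y)) holds on the whole space. The integral of the divergence vanishes by compact
    support, that of \<open>R\<close> by hypothesis.\<close>
  define F where "F b x = (if x \<in> V then \<phi> x * (Y x \<bullet> b) else 0)" for b x
  define R where "R x = (if x \<in> V then fd \<phi> x (Y x) else 0)" for x
  define q where "q x = (if x \<in> V then \<phi> x * (s * h x) else 0)" for x
  have F: "Ck_on k (F b) UNIV" for k b
    unfolding F_def using smooth_on_mult[OF V \<phi>V smooth_Yb]
    by (intro Ck_on_if[OF V K]) (auto simp: smooth_on_def \<phi>K)
  have q: "continuous_on UNIV q"
    using Ck_on_if[OF V K, of 0 "\<lambda>x. \<phi> x * (s * h x)"] smooth_on_continuous[OF smooth_on_mult[OF V \<phi>V sm]]
    unfolding q_def by (auto simp: \<phi>K)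
  have sY: "smooth_on (\<lambda>x. \<Sum>b\<in>Basis. (Y x \<bullet> b) * fd \<phi> x b) V"
    by (intro smooth_on_sum smooth_on_mult V smooth_Yb smooth_on_fd \<phi>V)
  have "fd \<phi> x (Y x) = (\<Sum>b\<in>Basis. (Y x \<bullet> b) * fd \<phi> x b)" if "x \<in> V" for x
    using linear_sum_Basis[OF linear_fd[OF \<phi>V that], of "Y x"] by simp
  from smooth_on_cong[OF V this[symmetric] sY] have R: "continuous_on UNIV R"
    using Ck_on_if[OF V K, of 0 "\<lambda>x. fd \<phi> x (Y x)"] smooth_on_continuous
    unfolding R_def by (auto simp: \<phi>'K)
  have Fb0: "F b x = 0" if "x \<notin> ?K" for b x using \<phi>K[OF that] by (simp add: F_def)
  have cont: "continuous_on UNIV (\<lambda>x. fd (F b) x b)" for b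
    using F[of "Suc 0" b] by simp
  have int: "integrable lborel (\<lambda>x. fd (F b) x b)" for b
    by (rule integrable_compact_support[OF cont K(1) fd_outside_support[OF K(1) Fb0]])
  have intR: "integrable lborel R"
    by (rule integrable_compact_support[OF R K(1)]) (simp add: R_def \<phi>'K)
  have intq: "integrable lborel q"
    by (rule integrable_compact_support[OF q K(1)]) (simp add: q_def \<phi>K)
  have eq: "q x = s * ((\<Sum>b\<in>Basis. fd (F b) x b) - R x)" for x
  proof (cases "x \<in> V")
    case True
    have "fd (F b) x b = \<phi> x * fd (\<lambda>y. Y y \<bullet> b) x b + fd \<phi> x b * (Y x \<bullet> b)" for b
    proof -
      have "fd (F b) x = fd (\<lambda>x. \<phi> x * (Y x \<bullet> b)) x"
        by (rule fd_cong[OF V True]) (simp add: F_def)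
      then show ?thesis
        by (simp add: fd_eqI[OF has_derivative_mult[OF smooth_on_has_derivative[OF \<phi>V True]
                smooth_on_has_derivative[OF smooth_Yb True]]])
    qed
    moreover have "fd \<phi> x (Y x) = (\<Sum>b\<in>Basis. fd \<phi> x b * (Y x \<bullet> b))"
      using linear_sum_Basis[OF linear_fd[OF \<phi>V True], of "Y x"] by (simp add: mult.commute)
    ultimately show ?thesis
      using True by (simp add: q_def R_def h_def sum.distrib sum_distrib_left algebra_simps)
  next
    case False
    then have "x \<notin> ?K" using K by auto
    then show ?thesis using False fd_outside_support[OF K(1) Fb0] by (simp add: q_def R_def)
  qed
  have "integral\<^sup>L lborel q = s * ((\<Sum>b\<in>Basis. integral\<^sup>L lborel (\<lambda>x. fd (F b) x b)) - integral\<^sup>L lborel R)"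
    unfolding eq using int intR by (simp add: Bochner_Integration.integral_sum)
  also have "integral\<^sup>L lborel R = 0"
    unfolding R_def by (rule weak[OF \<phi>(1) K]) (rule \<phi>K)
  also have "s * ((\<Sum>b\<in>Basis. integral\<^sup>L lborel (\<lambda>x. fd (F b) x b)) - 0) = 0"
    using integral_fd_compact_support[OF F K(1) Fb0] by (simp add: R_def)
  finally have q0: "integral\<^sup>L lborel q = 0" .
  have "q x \<ge> 0" for x
  proof (cases "x \<in> ball p r")
    case True
    then have "x \<in> ?K" by simp
    then have "s * h x > 0" using r by blast
    then show ?thesis using \<phi>(2)[OF True] by (simp add: q_def)
  next
    case False
    then show ?thesis using \<phi>(3) by (simp add: q_def)
  qed
  from lborel_integral_nonneg_eq_0[OF q intq this q0] have "q p = 0" .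
  then show False
    using p \<phi>(2)[of p] \<open>s * h p > 0\<close> r(1) by (auto simp: q_def)
qed

lemma star_of_weak:
  assumes weak: "\<And>\<phi> K l. smooth_on \<phi> UNIV \<Longrightarrow> compact K \<Longrightarrow> K \<subseteq> V \<Longrightarrow> (\<And>x. x \<notin> K \<Longrightarrow> \<phi> x = 0) \<Longrightarrow>
      integral\<^sup>L lborel (\<lambda>x. if x \<in> V then volume_density (g x) * fd \<phi> x (J (raise (g x) l)) else 0) = 0"
    and p: "p \<in> V"
  shows "tr (g p) (star_form p w) = 0"
proof -
  \<comment> \<open>The covector is constant; its raised vector equals \<open>w\<close> at
    \<open>p\<close>, but varies elsewhere.\<close>
  obtain l where l: "raise (g p) l = w" using ex_raise[OF metric_g[OF p]] by blast
  have "(\<Sum>b\<in>Basis. fd (\<lambda>y. (volume_density (g y) *\<^sub>R J (raise (g y) l)) \<bullet> b) p b) = 0"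
  proof (rule divergence_eq_0_of_weak[OF _ _ p])
    show "smooth_on (\<lambda>y. volume_density (g y) *\<^sub>R J (raise (g y) l)) V"
      using smooth_density smooth_on_linear_comp[OF bounded_linear_J V smooth_raise]
      unfolding smooth_on_def by (intro allI Ck_on_scaleR[OF V]) auto
    fix \<phi> :: "complex^'n \<Rightarrow> real" and K
    assume \<phi>: "smooth_on \<phi> UNIV" and K: "compact K" "K \<subseteq> V" "\<And>x. x \<notin> K \<Longrightarrow> \<phi> x = 0"
    show "integral\<^sup>L lborel (\<lambda>x. if x \<in> V then fd \<phi> x (volume_density (g x) *\<^sub>R J (raise (g x) l)) else 0) = 0"
    proof -
      have "fd \<phi> x (c *\<^sub>R v) = c * fd \<phi> x v" for x c v
        using linear_scale[OF linear_fd[OF \<phi> UNIV_I]] by simp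
      then show ?thesis using weak[OF \<phi> K, of l] by (simp cong: if_cong)
    qed
  qed
  then show ?thesis
    using divergence_eq_star[OF p, of l] volume_density_pos[OF metric_g[OF p]] by (simp add: l)
qed

section \<open>Equation (star) under a conformal change\<close>

lemma conformal_hermitian_field:
  assumes "smooth_on F V"
  shows "hermitian_field V (\<lambda>y v w. exp (F y) * W y v w)"
proof
  show "bilinear (\<lambda>v w. exp (F y) * W y v w)" if "y \<in> V" for y
    unfolding bilinear_def
    by (auto intro!: linearI simp: bilinear_ladd[OF bilinear_W] bilinear_radd[OF bilinear_W]
        bilinear_lmul[OF bilinear_W] bilinear_rmul[OF bilinear_W] that algebra_simps)
  show "exp (F y) * W y v w = - (exp (F y) * W y w v)" if "y \<in> V" for y v w
    using skew[OF that, of v w] by simp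
qed (auto simp: V J_inv pos intro!: smooth_on_mult smooth_on_exp smooth assms)

lemma conformal_D1:
  assumes F: "smooth_on F V" and y: "y \<in> V"
  shows "hermitian_field.D1 (\<lambda>y v w. exp (F y) * W y v w) y a v w =
    exp (F y) * (fd F y a * W y v w + D1 y a v w)"
proof -
  interpret C: hermitian_field V "\<lambda>y v w. exp (F y) * W y v w"
    by (rule conformal_hermitian_field[OF F])
  have "((\<lambda>y. exp (F y)) has_derivative (\<lambda>a. fd F y a * exp (F y))) (at y)"
    by (rule DERIV_compose_FDERIV[OF DERIV_exp smooth_on_has_derivative[OF F y]])
  note D = has_derivative_mult[OF this smooth_on_has_derivative[OF smooth y, of v w]]
  show ?thesis unfolding C.D1_def D1_def fd_eqI[OF D] by (simp add: algebra_simps)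
qed

text \<open>Passing to e^F W adds dF times W to each first derivative. In the first term of
  \<open>star_form\<close> this is traced against the metric and gives half the real dimension; in
  the second it contracts dF with W(-, w) and gives -1. The factor e^F drops out.\<close>

lemma conformal_star:
  assumes F: "smooth_on F V" and y: "y \<in> V"
    and star: "tr (hermitian_field.g (\<lambda>y v w. exp (F y) * W y v w) y)
      (hermitian_field.star_form (\<lambda>y v w. exp (F y) * W y v w) y w) = 0"
  shows "tr (g y) (star_form y w) + (DIM(complex^'n) / 2 - 1) * fd F y (J w) = 0"
proof -
  interpret C: hermitian_field V "\<lambda>y v w. exp (F y) * W y v w"
    by (rule conformal_hermitian_field[OF F])
  note gy = metric_g[OF y]
  have gC: "C.g y = (\<lambda>v w. exp (F y) * g y v w)" by (simp add: fun_eq_iff C.g_def g_def)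
  have "0 = tr (g y) (C.star_form y w)"
    using star unfolding gC tr_scale[OF gy exp_gt_zero C.bilinear_star_form[OF y]] by simp
  also have "C.star_form y w = (\<lambda>a b. exp (F y) * ((1 / 2 * fd F y (J w)) * g y a b + fd F y a * W y b w + star_form y w a b))"
    by (auto simp: fun_eq_iff C.star_form_def star_form_def conformal_D1[OF F y] g_def algebra_simps)
  also have "tr (g y) \<dots> = exp (F y) * ((1 / 2 * fd F y (J w)) * DIM(complex^'n) + tr (g y) (\<lambda>a b. fd F y a * W y b w) + tr (g y) (star_form y w))"
    unfolding tr_mult tr_add tr_self[OF gy] ..
  also have "tr (g y) (\<lambda>a b. fd F y a * W y b w) = - fd F y (J w)"
  proof -
    have "W y b w = - g y b (J w)" for b
      by (simp add: g_def bilinear_rneg[OF bilinear_W[OF y]])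
    then show ?thesis
      using tr_contract[OF gy linear_fd[OF F y], of "J w"] by (simp add: tr_uminus)
  qed
  finally have "1 / 2 * fd F y (J w) * DIM(complex^'n) + - fd F y (J w) + tr (g y) (star_form y w) = 0"
    by simp
  then show ?thesis by (simp add: algebra_simps)
qed

end

section \<open>The norm of the torsion\<close>

context hermitian_field
begin

definition dW :: "complex^'n \<Rightarrow> complex^'n \<Rightarrow> complex^'n \<Rightarrow> complex^'n \<Rightarrow> real" where
  "dW y a b c = D1 y a b c - D1 y b a c + D1 y c a b"

text \<open>In \<open>ext_dc\<close> the map \<open>J\<close> on the arguments of the form cancels
  against its inverse. It survives only in the direction of differentiation, with a minus sign from
  the inverse.\<close>

definition dcW :: "complex^'n \<Rightarrow> complex^'n \<Rightarrow> complex^'n \<Rightarrow> complex^'n \<Rightarrow> real" where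
  "dcW y a b c = - D1 y (J a) b c + D1 y (J b) a c - D1 y (J c) a b"

definition ddcW :: "complex^'n \<Rightarrow> complex^'n \<Rightarrow> complex^'n \<Rightarrow> complex^'n \<Rightarrow> complex^'n \<Rightarrow> real" where
  "ddcW y a b c d = fd (\<lambda>y. dcW y b c d) y a - fd (\<lambda>y. dcW y a c d) y b +
     fd (\<lambda>y. dcW y a b d) y c - fd (\<lambda>y. dcW y a b c) y d"

lemma sum_J:
  fixes B :: "complex^'n \<Rightarrow> complex^'n \<Rightarrow> real"
  assumes y: "y \<in> V" and E: "onb (g y) E" and B: "bilinear B"
  shows "(\<Sum>e\<in>E. B (J e) (J e)) = (\<Sum>e\<in>E. B e e)"
    and "(\<Sum>e\<in>E. B (J e) e) = - (\<Sum>e\<in>E. B e (J e))"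
proof -
  have B1: "bilinear (\<lambda>a b. B (J a) (J b))" and B2: "bilinear (\<lambda>a b. B (J a) b)"
    and B3: "bilinear (\<lambda>a b. B a (J b))"
    using B linear_J unfolding bilinear_def by (auto intro: linear_compose[unfolded o_def])
  note t = tr_onb[OF metric_g[OF y] E]
  show "(\<Sum>e\<in>E. B (J e) (J e)) = (\<Sum>e\<in>E. B e e)"
    using tr_J[OF y B] t[OF B] t[OF B1] by simp
  show "(\<Sum>e\<in>E. B (J e) e) = - (\<Sum>e\<in>E. B e (J e))"
    using tr_J_swap[OF y B] t[OF B2] t[OF B3] by simp
qed

lemma fd_dcW:
  assumes y: "y \<in> V"
  shows "fd (\<lambda>y. dcW y b c d) y a = - D2 y a (J b) c d + D2 y a (J c) b d - D2 y a (J d) b c"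
proof -
  note D = smooth_on_has_derivative[OF smooth_D1 y]
  note D' = has_derivative_diff[OF has_derivative_add[OF has_derivative_minus[OF D[of "J b" c d]]
      D[of "J c" b d]] D[of "J d" b c]]
  show ?thesis unfolding dcW_def fd_eqI[OF D'] D2_def ..
qed

text \<open>Of the twelve second derivatives in \<open>ddcW\<close>, four have trace
  \<open>X1\<close> and eight have trace \<open>X2\<close>, signs included. The reductions use skew
  symmetry, \<open>J\<close>-invariance, renaming of the two basis vectors, and replacing one of
  them by its image under \<open>J\<close>.\<close>

lemma ddcW_trace:
  assumes y: "y \<in> V" and E: "onb (g y) E"
  shows "(\<Sum>e\<in>E. \<Sum>f\<in>E. ddcW y e (J e) f (J f)) =
    4 * (\<Sum>e\<in>E. \<Sum>f\<in>E. D2 y e e f (J f)) + 8 * (\<Sum>e\<in>E. \<Sum>f\<in>E. D2 y e f (J e) f)"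
proof -
  note B = bilinear_D2[OF y] and l = linear_D2[OF y] and l' = linear_D2'[OF y] and sk = D2_skew[OF y]
    and sw = D2_J_swap[OF y]
  note [simp] = bilinear_ladd[OF B] bilinear_radd[OF B] bilinear_lmul[OF B] bilinear_rmul[OF B]
    linear_add[OF l] linear_scale[OF l] linear_add[OF l'] linear_scale[OF l']
    linear_add[OF linear_J] linear_scale[OF linear_J]
  note [simp] = bilinear_lneg[OF B] bilinear_rneg[OF B] linear_neg[OF l] linear_neg[OF l']
  define X1 where "X1 = (\<Sum>e\<in>E. \<Sum>f\<in>E. D2 y e e f (J f))"
  define X2 where "X2 = (\<Sum>e\<in>E. \<Sum>f\<in>E. D2 y e f (J e) f)"
  have bl: "bilinear (\<lambda>a b. D2 y a b v w)" "bilinear (\<lambda>a b. D2 y c a b w)" "bilinear (\<lambda>a b. D2 y a c b w)"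
    "bilinear (\<lambda>a b. D2 y a c v b)" "bilinear (\<lambda>a b. D2 y c a v b)" for v w c
    unfolding bilinear_def by (auto intro!: linearI)
  note J1 = sum_J(1)[OF y E] and J2 = sum_J(2)[OF y E]
  have t2: "(\<Sum>e\<in>E. \<Sum>f\<in>E. D2 y e (J f) e f) = X2"
  proof -
    have "(\<Sum>f\<in>E. D2 y e (J f) e f) = (\<Sum>f\<in>E. D2 y e f (J e) f)" for e
      using J2[OF bl(5)[of e e]] by (simp add: sw sum_negf)
    then show ?thesis by (simp add: X2_def)
  qed
  have t4: "(\<Sum>e\<in>E. \<Sum>f\<in>E. D2 y (J e) (J e) f (J f)) = X1"
  proof -
    have "(\<Sum>e\<in>E. D2 y (J e) (J e) f (J f)) = (\<Sum>e\<in>E. D2 y e e f (J f))" for f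
      using J1[OF bl(1)[of f "J f"]] .
    then show ?thesis unfolding X1_def by (subst (1 2) sum.swap) simp
  qed
  have t6: "(\<Sum>e\<in>E. \<Sum>f\<in>E. D2 y (J e) f e f) = - X2"
  proof -
    have "(\<Sum>e\<in>E. D2 y (J e) f e f) = - (\<Sum>e\<in>E. D2 y e f (J e) f)" for f
      using J2[OF bl(3)[of f f]] .
    then show ?thesis unfolding X2_def by (subst (1 2) sum.swap) (simp add: sum_negf)
  qed
  have t5: "(\<Sum>e\<in>E. \<Sum>f\<in>E. D2 y (J e) (J f) e (J f)) = - X2"
  proof -
    have "(\<Sum>f\<in>E. D2 y (J e) (J f) e (J f)) = (\<Sum>f\<in>E. D2 y (J e) f e f)" for e
      using J1[OF bl(5)[of "J e" e]] .
    then show ?thesis using t6 by simp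
  qed
  have t7: "(\<Sum>e\<in>E. \<Sum>f\<in>E. D2 y f (J e) e f) = - X2"
  proof -
    have "D2 y e (J f) f e = - D2 y e (J f) e f" for e f by (rule sk)
    then show ?thesis using t2 by (subst sum.swap) (simp only: sum_negf)
  qed
  have t8: "(\<Sum>e\<in>E. \<Sum>f\<in>E. D2 y f e e (J f)) = - X2"
  proof -
    have "D2 y e f f (J e) = - D2 y e f (J e) f" for e f by (rule sk)
    then show ?thesis unfolding X2_def by (subst sum.swap) (simp only: sum_negf)
  qed
  have t9: "(\<Sum>e\<in>E. \<Sum>f\<in>E. D2 y f f e (J e)) = X1"
    unfolding X1_def by (rule sum.swap)
  have t11: "(\<Sum>e\<in>E. \<Sum>f\<in>E. D2 y (J f) e e f) = X2"
  proof -
    have "D2 y (J e) f f e = - D2 y (J e) f e f" for e f by (rule sk)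
    then show ?thesis using t6 by (subst sum.swap) (simp only: sum_negf minus_minus)
  qed
  have t10: "(\<Sum>e\<in>E. \<Sum>f\<in>E. D2 y (J f) (J e) (J e) f) = X2"
  proof -
    have "(\<Sum>e\<in>E. D2 y (J f) (J e) (J e) f) = (\<Sum>e\<in>E. D2 y (J f) e e f)" for f
      using J1[OF bl(2)[of "J f" f]] .
    then show ?thesis using t11 by (subst sum.swap) (subst (asm) sum.swap, simp only:)
  qed
  have t12: "(\<Sum>e\<in>E. \<Sum>f\<in>E. D2 y (J f) (J f) e (J e)) = X1"
    using t4 by (subst sum.swap) simp
  have "ddcW y e (J e) f (J f) =
      D2 y e e f (J f) + D2 y e (J f) e f + D2 y e f (J e) f +
      D2 y (J e) (J e) f (J f) - D2 y (J e) (J f) e (J f) - D2 y (J e) f e f -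
      D2 y f (J e) e f - D2 y f e e (J f) + D2 y f f e (J e) +
      D2 y (J f) (J e) (J e) f + D2 y (J f) e e f + D2 y (J f) (J f) e (J e)" for e f
    unfolding ddcW_def fd_dcW[OF y] by (simp add: D2_J_inv[OF y])
  then show ?thesis
    by (simp only: sum.distrib sum_subtractf t2 t4 t5 t6 t7 t8 t9 t10 t11 t12 flip: X1_def X2_def)
qed

text \<open>The sum runs over ordered triples, so the three squares contribute equally, and each of
  the three mixed products gives -2 times the same sum \<open>C\<close>. The occurrences of
  \<open>J\<close> on the right put both sums into the shape in which the derivative of (star)
  produces them.\<close>

lemma dW_norm:
  assumes y: "y \<in> V" and E: "onb (g y) E"
  shows "(\<Sum>i\<in>E. \<Sum>j\<in>E. \<Sum>k\<in>E. (dW y i j k)\<^sup>2) =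
    3 * (\<Sum>i\<in>E. \<Sum>j\<in>E. \<Sum>k\<in>E. D1 y i j (J k) * D1 y i j (J k)) -
    6 * (\<Sum>i\<in>E. \<Sum>j\<in>E. \<Sum>k\<in>E. D1 y i j (J k) * D1 y j k (J i))"
proof -
  define S where "S h = (\<Sum>i\<in>E. \<Sum>j\<in>E. \<Sum>k\<in>E. h i j k :: real)" for h
  have S12: "S (\<lambda>i j k. h j i k) = S h" and S23: "S (\<lambda>i j k. h i k j) = S h" for h
    unfolding S_def by (rule sum.swap) (intro sum.cong refl sum.swap)
  have Sadd: "S (\<lambda>i j k. h i j k + h' i j k) = S h + S h'"
    and Sneg: "S (\<lambda>i j k. - h i j k) = - S h" and Smul: "S (\<lambda>i j k. c * h i j k) = c * S h" for h h' c
    by (simp_all add: S_def sum.distrib sum_negf sum_distrib_left)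
  note B = bilinear_D1[OF y]
  let ?D = "D1 y"
  have sk: "?D a b c = - ?D a c b" for a b c by (rule D1_skew[OF y])
  define N where "N = S (\<lambda>i j k. ?D i j k * ?D i j k)"
  define C where "C = S (\<lambda>i j k. ?D i j k * ?D j i k)"
  have N2: "S (\<lambda>i j k. ?D j i k * ?D j i k) = N"
    unfolding N_def by (rule S12)
  have N3: "S (\<lambda>i j k. ?D k i j * ?D k i j) = N"
    using S23[of "\<lambda>i j k. ?D k i j * ?D k i j"] N2 by simp
  have C2: "S (\<lambda>i j k. ?D i j k * ?D k i j) = - C"
  proof -
    have *: "?D i k j * ?D j i k = - (?D i j k * ?D j i k)" for i j k
      using sk[of i k j] by simp
    have "S (\<lambda>i j k. ?D i j k * ?D k i j) = S (\<lambda>i j k. ?D i k j * ?D j i k)"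
      by (rule S23[symmetric])
    also have "\<dots> = S (\<lambda>i j k. - (?D i j k * ?D j i k))"
      by (simp only: *)
    finally show ?thesis by (simp add: Sneg C_def)
  qed
  have C3: "S (\<lambda>i j k. ?D j i k * ?D k i j) = C"
  proof -
    have *: "?D i j k * ?D k j i = - (?D i j k * ?D k i j)" for i j k
      using sk[of k j i] by simp
    have "S (\<lambda>i j k. ?D j i k * ?D k i j) = S (\<lambda>i j k. ?D i j k * ?D k j i)"
      by (rule S12[symmetric])
    also have "\<dots> = S (\<lambda>i j k. - (?D i j k * ?D k i j))"
      by (simp only: *)
    finally show ?thesis by (simp add: Sneg C2)
  qed
  have "(dW y i j k)\<^sup>2 = ?D i j k * ?D i j k + ?D j i k * ?D j i k + ?D k i j * ?D k i j +
      (- 2) * (?D i j k * ?D j i k) + 2 * (?D i j k * ?D k i j) + (- 2) * (?D j i k * ?D k i j)" for i j k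
    by (simp add: dW_def power2_eq_square algebra_simps)
  then have "S (\<lambda>i j k. (dW y i j k)\<^sup>2) = N + N + N + (- 2) * C + 2 * (- C) + (- 2) * C"
    by (simp only: Sadd Smul N2 N3 C2 C3 flip: N_def C_def)
  moreover have "S (\<lambda>i j k. ?D i j (J k) * ?D i j (J k)) = N"
  proof -
    have "bilinear (\<lambda>a b. ?D i j a * ?D i j b)" for i j
      unfolding bilinear_def
      by (auto intro!: linearI simp: bilinear_radd[OF B] bilinear_rmul[OF B] algebra_simps)
    from sum_J(1)[OF y E this] show ?thesis by (simp add: S_def N_def)
  qed
  moreover have "S (\<lambda>i j k. ?D i j (J k) * ?D j k (J i)) = C"
  proof -
    have "bilinear (\<lambda>a b. ?D i j a * ?D j i b)" for i j
      unfolding bilinear_def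
      by (auto intro!: linearI simp: bilinear_radd[OF B] bilinear_rmul[OF B] algebra_simps)
    from sum_J(1)[OF y E this] have "S (\<lambda>i j k. ?D i j (J k) * ?D j i (J k)) = C"
      by (simp add: S_def C_def)
    \<comment> \<open>Moving \<open>J\<close> to the other argument and exchanging the arguments
      produce two signs, which cancel.\<close>
    moreover have "?D j i (J k) = ?D j k (J i)" for i j k
      using D1_J_swap[OF y, of j i k] sk[of j "J i" k] by simp
    ultimately show ?thesis by simp
  qed
  ultimately show ?thesis by (simp add: S_def)
qed

section \<open>The derivative of (star) and the identity for the norm of d\<omega>\<close>

lemma star_derivative:
  assumes F: "smooth_on F V" and p: "p \<in> V" and E: "onb (g p) E"
    and star: "\<And>y. y \<in> V \<Longrightarrow> tr (g y) (star_form y w) + c * fd F y (J w) = 0"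
  shows "(\<Sum>e\<in>E. 1 / 2 * D2 p a (J w) e (J e) + D2 p a e e w) -
    (\<Sum>e\<in>E. \<Sum>e'\<in>E. D1 p a e (J e') * star_form p w e e') + c * fd (\<lambda>y. fd F y (J w)) p a = 0"
proof -
  note B2 = bilinear_D2[OF p] and l = linear_D2'[OF p]
  have BH: "bilinear (\<lambda>u v. 1 / 2 * D2 p a (J w) u (J v) + D2 p a u v w)" for a
    unfolding bilinear_def
    by (auto intro!: linearI simp: bilinear_ladd[OF B2] bilinear_radd[OF B2] bilinear_lmul[OF B2] bilinear_rmul[OF B2]
       linear_add[OF l] linear_scale[OF l] linear_add[OF linear_J] linear_scale[OF linear_J] algebra_simps)
  have DH: "((\<lambda>y. star_form y w u v) has_derivative (\<lambda>a. 1 / 2 * D2 p a (J w) u (J v) + D2 p a u v w)) (at p)" for u v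
    unfolding star_form_def D2_def
    by (intro has_derivative_add has_derivative_mult_right smooth_on_has_derivative[OF smooth_D1 p])
  have "((\<lambda>y. tr (g y) (star_form y w)) has_derivative (\<lambda>a.
      (\<Sum>e\<in>E. 1 / 2 * D2 p a (J w) e (J e) + D2 p a e e w) -
      (\<Sum>e\<in>E. \<Sum>e'\<in>E. D1 p a e (J e') * star_form p w e e'))) (at p)"
    by (rule has_derivative_tr[OF V p metric_g g_has_derivative[OF p] bilinear_D1_J[OF p] E bilinear_star_form DH BH])
  moreover have "((\<lambda>y. c * fd F y (J w)) has_derivative (\<lambda>a. c * fd (\<lambda>y. fd F y (J w)) p a)) (at p)"
    by (intro has_derivative_mult_right smooth_on_has_derivative[OF smooth_on_fd[OF F] p])
  ultimately have "fd (\<lambda>y. tr (g y) (star_form y w) + c * fd F y (J w)) p = (\<lambda>a.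
      (\<Sum>e\<in>E. 1 / 2 * D2 p a (J w) e (J e) + D2 p a e e w) -
      (\<Sum>e\<in>E. \<Sum>e'\<in>E. D1 p a e (J e') * star_form p w e e') + c * fd (\<lambda>y. fd F y (J w)) p a)"
    by (intro fd_eqI has_derivative_add)
  moreover have "fd (\<lambda>y. tr (g y) (star_form y w) + c * fd F y (J w)) p = fd (\<lambda>y. 0) p"
    by (rule fd_cong[OF V p star])
  ultimately show ?thesis by (simp add: fun_eq_iff)
qed

lemma dW_norm_eq_laplacian:
  assumes F: "smooth_on F V" and p: "p \<in> V" and E: "onb (g p) E"
    and star: "\<And>y w. y \<in> V \<Longrightarrow> tr (g y) (star_form y w) + (DIM(complex^'n) / 2 - 1) * fd F y (J w) = 0"
    and ddc: "\<And>a b c d. ddcW p a b c d = 0"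
  shows "(\<Sum>i\<in>E. \<Sum>j\<in>E. \<Sum>k\<in>E. (dW p i j k)\<^sup>2) =
    3 * (DIM(complex^'n) - 2) * (\<Sum>e\<in>E. fd (\<lambda>y. fd F y e) p e)"
proof -
  define c where "c = DIM(complex^'n) / 2 - 1"
  define X1 where "X1 = (\<Sum>e\<in>E. \<Sum>f\<in>E. D2 p e e f (J f))"
  define X2 where "X2 = (\<Sum>e\<in>E. \<Sum>f\<in>E. D2 p e f (J e) f)"
  define N where "N = (\<Sum>i\<in>E. \<Sum>j\<in>E. \<Sum>k\<in>E. D1 p i j (J k) * D1 p i j (J k))"
  define C where "C = (\<Sum>i\<in>E. \<Sum>j\<in>E. \<Sum>k\<in>E. D1 p i j (J k) * D1 p j k (J i))"
  define L where "L = (\<Sum>e\<in>E. fd (\<lambda>y. fd F y e) p e)"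
  \<comment> \<open>Pluriclosedness is used here: the second derivatives produced by (star) form -
    X1/2 - X2, a multiple of the trace 4 X1 + 8 X2 of dd^c \<omega>.\<close>
  have X: "X1 + 2 * X2 = 0"
    using ddcW_trace[OF p E] by (simp add: ddc X1_def X2_def)
  \<comment> \<open>This is the derivative of (star) in direction \<open>i\<close> at w = J i. The
    last sign is negative because J w = - i.\<close>
  have trace: "- (1 / 2) * (\<Sum>e\<in>E. D2 p i i e (J e)) - (\<Sum>e\<in>E. D2 p i e (J i) e) +
      1 / 2 * (\<Sum>e\<in>E. \<Sum>e'\<in>E. D1 p i e (J e') * D1 p i e (J e')) -
      (\<Sum>e\<in>E. \<Sum>e'\<in>E. D1 p i e (J e') * D1 p e e' (J i)) - c * fd (\<lambda>y. fd F y i) p i = 0" for i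
  proof -
    have "fd (\<lambda>y. fd F y (J (J i))) p = fd (\<lambda>y. - fd F y i) p"
      by (rule fd_cong[OF V p]) (simp add: linear_neg[OF linear_fd[OF F]])
    then have Fi: "fd (\<lambda>y. fd F y (J (J i))) p i = - fd (\<lambda>y. fd F y i) p i"
      by (simp add: fd_uminus smooth_on_differentiable[OF smooth_on_fd[OF F] p])
    have H: "1 / 2 * D2 p i (J (J i)) e (J e) + D2 p i e e (J i) =
        - (1 / 2) * D2 p i i e (J e) - D2 p i e (J i) e" for e
      using D2_skew[OF p, of i e e "J i"] by (simp add: linear_neg[OF linear_D2'[OF p]])
    have K: "D1 p i e (J e') * star_form p (J i) e e' =
        - (1 / 2) * (D1 p i e (J e') * D1 p i e (J e')) + D1 p i e (J e') * D1 p e e' (J i)" for e e'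
      by (simp add: star_form_def linear_neg[OF linear_D1[OF p]] algebra_simps)
    show ?thesis
      using star_derivative[OF F p E star[folded c_def], where w = "J i" and a = i]
      unfolding H K Fi by (simp add: sum.distrib sum_subtractf sum_negf sum_divide_distrib)
  qed
  have "- (1 / 2) * X1 - X2 + 1 / 2 * N - C - c * L =
    (\<Sum>i\<in>E. - (1 / 2) * (\<Sum>e\<in>E. D2 p i i e (J e)) - (\<Sum>e\<in>E. D2 p i e (J i) e) +
      1 / 2 * (\<Sum>e\<in>E. \<Sum>e'\<in>E. D1 p i e (J e') * D1 p i e (J e')) -
      (\<Sum>e\<in>E. \<Sum>e'\<in>E. D1 p i e (J e') * D1 p e e' (J i)) - c * fd (\<lambda>y. fd F y i) p i)"
    unfolding X1_def X2_def N_def C_def L_def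
    by (simp only: sum.distrib sum_subtractf sum_distrib_left)
  also have "\<dots> = 0" by (simp only: trace sum.neutral_const)
  finally have "1 / 2 * N - C = c * L" using X by linarith
  \<comment> \<open>Multiplying by 6 turns the left side into the expression of
    \<open>dW_norm\<close>, and 6 c equals 3 times (dimension - 2).\<close>
  then have "3 * N - 6 * C = 6 * (c * L)" by linarith
  \<comment> \<open>The subtraction of natural numbers does not truncate, as the real dimension is
    at least 2.\<close>
  moreover have "real (DIM(complex^'n) - 2) = DIM(complex^'n) - 2"
    by (subst of_nat_diff) (auto simp: Suc_le_eq)
  ultimately show ?thesis
    unfolding dW_norm[OF p E] by (simp add: c_def N_def C_def L_def algebra_simps)
qed

text \<open>Summing d\<omega>(e, J e, v) over an orthonormal basis gives twice the trace of
  \<open>star_form\<close> at w = - J v. So if d\<omega> vanishes, only the term with dF is left in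
  (star).\<close>

lemma dF_eq_0_of_dW_eq_0:
  assumes y: "y \<in> V" and star: "tr (g y) (star_form y (- J v)) + c * fd F y (J (- J v)) = 0"
    and dW: "\<And>a b c. dW y a b c = 0"
  shows "c * fd F y v = 0"
proof -
  obtain E where E: "onb (g y) E" using ex_onb[OF metric_g[OF y]] .
  note B = bilinear_D1[OF y] and l = linear_D1[OF y]
  have "bilinear (\<lambda>a b. D1 y a b v)"
    unfolding bilinear_def
    by (auto intro!: linearI simp: bilinear_ladd[OF B] bilinear_lmul[OF B] linear_add[OF l] linear_scale[OF l])
  note J2 = sum_J(2)[OF y E this]
  have "0 = (\<Sum>e\<in>E. dW y e (J e) v)" by (simp add: dW)
  also have "\<dots> = 2 * (\<Sum>e\<in>E. D1 y e (J e) v) + (\<Sum>e\<in>E. D1 y v e (J e))"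
    by (simp add: dW_def sum.distrib sum_subtractf J2)
  finally have 0: "2 * (\<Sum>e\<in>E. D1 y e (J e) v) + (\<Sum>e\<in>E. D1 y v e (J e)) = 0" by simp
  have "star_form y (- J v) e e = 1 / 2 * D1 y v e (J e) + D1 y e (J e) v" for e
    using D1_J_swap[OF y, of e e v] by (simp add: star_form_def bilinear_rneg[OF B])
  then have "tr (g y) (star_form y (- J v)) = 1 / 2 * (\<Sum>e\<in>E. D1 y v e (J e)) + (\<Sum>e\<in>E. D1 y e (J e) v)"
    unfolding tr_onb[OF metric_g[OF y] E bilinear_star_form[OF y]]
    by (simp only: sum.distrib sum_distrib_left)
  moreover have "tr (g y) (star_form y (- J v)) + c * fd F y v = 0" using star by simp
  ultimately show ?thesis using 0 by linarith
qed

end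

section \<open>Complex manifolds\<close>

locale complex_mfd =
  fixes X :: "'m topology" and A :: "('m, 'n::finite) chart set"
  assumes mfd: "complex_manifold X A"
begin

lemma chart: "c \<in> A \<Longrightarrow> is_chart X c"
  using mfd by (simp add: complex_manifold_def)

lemma openin_chart: "c \<in> A \<Longrightarrow> openin X (fst c)"
  using chart by (simp add: is_chart_def)

lemma chart_subset: "c \<in> A \<Longrightarrow> fst c \<subseteq> topspace X"
  by (rule openin_subset[OF openin_chart])

lemma open_image: "c \<in> A \<Longrightarrow> open (image_of c)"
  using chart by (simp add: is_chart_def)

lemma ex_chart: "p \<in> topspace X \<Longrightarrow> \<exists>c\<in>A. p \<in> fst c"
  using mfd by (auto simp: complex_manifold_def)

lemma homeo: "c \<in> A \<Longrightarrow> homeomorphic_map (subtopology X (fst c)) (top_of_set (image_of c)) (snd c)"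
  using chart by (simp add: is_chart_def)

lemma topspace_chart: "c \<in> A \<Longrightarrow> topspace (subtopology X (fst c)) = fst c"
  using chart_subset[of c] by (auto simp: topspace_subtopology)

lemma inj_chart: "c \<in> A \<Longrightarrow> inj_on (snd c) (fst c)"
  using homeomorphic_imp_injective_map[OF homeo] topspace_chart by metis

lemma inv_chart_left [simp]: "c \<in> A \<Longrightarrow> p \<in> fst c \<Longrightarrow> inv_chart c (snd c p) = p"
  by (simp add: inv_chart_def inj_chart)

lemma image_of_mem: "p \<in> fst c \<Longrightarrow> snd c p \<in> image_of c"
  by (simp add: image_of_def)

lemma inv_chart_right [simp]: "x \<in> image_of c \<Longrightarrow> snd c (inv_chart c x) = x"
  by (simp add: inv_chart_def image_of_def f_inv_into_f)

lemma inv_chart_mem: "x \<in> image_of c \<Longrightarrow> inv_chart c x \<in> fst c"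
  by (simp add: inv_chart_def image_of_def inv_into_into)

lemma open_image_chart:
  assumes c: "c \<in> A" and U: "openin X U"
  shows "open (snd c ` (fst c \<inter> U))"
proof -
  have "openin (subtopology X (fst c)) (fst c \<inter> U)"
    using U by (simp add: openin_subtopology_Int2)
  then have "openin (top_of_set (image_of c)) (snd c ` (fst c \<inter> U))"
    using homeo[OF c] homeomorphic_map_openness_eq by blast
  then show ?thesis using open_image[OF c] openin_open_trans by blast
qed

lemma openin_preimage_chart:
  assumes c: "c \<in> A" and S: "open S"
  shows "openin X {p \<in> fst c. snd c p \<in> S}"
proof -
  have "continuous_map (subtopology X (fst c)) euclidean (snd c)"
    using homeomorphic_imp_continuous_map[OF homeo[OF c]] continuous_map_in_subtopology by blast
  then have "openin (subtopology X (fst c)) {p \<in> topspace (subtopology X (fst c)). snd c p \<in> S}"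
    by (rule openin_continuous_map_preimage) (use S in simp)
  then show ?thesis
    unfolding topspace_chart[OF c] by (rule openin_trans_full[OF _ openin_chart[OF c]])
qed

text \<open>Together with the Hausdorff property this makes the support of a test form closed in the
  manifold, so that extension by zero is smooth.\<close>

lemma compactin_inv_chart:
  assumes c: "c \<in> A" and K: "compact K" "K \<subseteq> image_of c"
  shows "compactin X (inv_chart c ` K)"
proof -
  have "compactin (subtopology X (fst c)) (inv_chart c ` K)"
  proof -
    have h: "homeomorphic_map (top_of_set (image_of c)) (subtopology X (fst c)) (inv_chart c)"
    proof -
      obtain g where g: "homeomorphic_maps (subtopology X (fst c)) (top_of_set (image_of c)) (snd c) g"
        using homeo[OF c] by (auto simp: homeomorphic_map_maps)
      then have eq: "g x = inv_chart c x" if "x \<in> image_of c" for x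
      proof -
        have "g x \<in> fst c" "snd c (g x) = x"
          using g that topspace_chart[OF c] unfolding homeomorphic_maps_def
          by (auto simp: continuous_map_def Pi_iff)
        then show ?thesis using inv_chart_left[OF c] by metis
      qed
      have "homeomorphic_map (top_of_set (image_of c)) (subtopology X (fst c)) g"
        using g homeomorphic_maps_map homeomorphic_maps_sym by blast
      then show ?thesis by (rule homeomorphic_map_eq) (simp add: eq)
    qed
    have "compactin (top_of_set (image_of c)) K"
      using K by (simp add: compactin_subtopology)
    then show ?thesis
      using image_compactin homeomorphic_imp_continuous_map[OF h] by blast
  qed
  then show ?thesis by (simp add: compactin_subtopology)
qed

definition overlap :: "('m, 'n) chart \<Rightarrow> ('m, 'n) chart \<Rightarrow> (complex^'n) set" where
  "overlap c c' = snd c ` (fst c \<inter> fst c')"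

lemma open_overlap: "c \<in> A \<Longrightarrow> c' \<in> A \<Longrightarrow> open (overlap c c')"
  unfolding overlap_def by (rule open_image_chart[OF _ openin_chart])

lemma overlap_subset: "overlap c c' \<subseteq> image_of c"
  by (auto simp: overlap_def image_of_def)

lemma overlap_iff: "c \<in> A \<Longrightarrow> x \<in> overlap c c' \<longleftrightarrow> x \<in> image_of c \<and> inv_chart c x \<in> fst c'"
  by (auto simp: overlap_def image_of_def)

lemma transition_apply: "c \<in> A \<Longrightarrow> p \<in> fst c \<Longrightarrow> transition c c' (snd c p) = snd c' p"
  by (simp add: transition_def)

lemma transition_overlap:
  assumes "c \<in> A" "c' \<in> A" "x \<in> overlap c c'"
  shows "transition c c' x \<in> overlap c' c" "inv_chart c' (transition c c' x) = inv_chart c x"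
  using assms by (auto simp: overlap_def transition_apply)

lemma smooth_transition: "c \<in> A \<Longrightarrow> c' \<in> A \<Longrightarrow> smooth_on (transition c c') (overlap c c')"
  using mfd by (simp add: complex_manifold_def holomorphic_map_on_def overlap_def)

lemma transition_J:
  "c \<in> A \<Longrightarrow> c' \<in> A \<Longrightarrow> x \<in> overlap c c' \<Longrightarrow>
    fd (transition c c') x (J v) = J (fd (transition c c') x v)"
  using mfd unfolding complex_manifold_def holomorphic_map_on_def overlap_def by blast

lemma linear_transition:
  "c \<in> A \<Longrightarrow> c' \<in> A \<Longrightarrow> x \<in> overlap c c' \<Longrightarrow> linear (fd (transition c c') x)"
  by (rule linear_fd[OF smooth_transition])

lemma fd_transition_compose:
  assumes c: "c1 \<in> A" "c2 \<in> A" "c3 \<in> A" and x: "x \<in> overlap c1 c2" "x \<in> overlap c1 c3"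
  shows "fd (transition c1 c3) x v = fd (transition c2 c3) (transition c1 c2 x) (fd (transition c1 c2) x v)"
proof -
  let ?y = "transition c1 c2 x"
  have y: "?y \<in> overlap c2 c3"
    using c x by (simp add: overlap_iff transition_def image_of_mem)
  have D: "((\<lambda>x. transition c2 c3 (transition c1 c2 x)) has_derivative
      (\<lambda>v. fd (transition c2 c3) ?y (fd (transition c1 c2) x v))) (at x)"
    by (rule has_derivative_compose[OF smooth_on_has_derivative[OF smooth_transition[OF c(1,2)] x(1)]
          smooth_on_has_derivative[OF smooth_transition[OF c(2,3)] y]])
  have "fd (transition c1 c3) x = fd (\<lambda>x. transition c2 c3 (transition c1 c2 x)) x"
  proof (rule fd_cong)
    show "open (overlap c1 c2 \<inter> overlap c1 c3)"
      by (intro open_Int open_overlap c)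
  qed (use c x in \<open>auto simp: overlap_iff transition_def\<close>)
  then show ?thesis by (simp add: fd_eqI[OF D])
qed

lemma fd_transition_self:
  assumes c: "c \<in> A" and x: "x \<in> image_of c"
  shows "fd (transition c c) x v = v"
proof -
  have "fd (transition c c) x = fd (\<lambda>x. x) x"
    by (rule fd_cong[OF open_image[OF c] x]) (simp add: transition_def)
  then show ?thesis by simp
qed

lemma fd_transition_inverse:
  assumes c: "c \<in> A" "c' \<in> A" and x: "x \<in> overlap c c'"
  shows "fd (transition c c') x (fd (transition c' c) (transition c c' x) v) = v"
proof -
  let ?y = "transition c c' x"
  have y: "?y \<in> overlap c' c" by (rule transition_overlap[OF c x])
  then have y': "?y \<in> overlap c' c'" "?y \<in> image_of c'" using overlap_iff c by (auto intro: inv_chart_mem)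
  have "transition c' c ?y = x"
    using c x by (auto simp: overlap_def transition_apply)
  then show ?thesis
    using fd_transition_compose[OF c(2,1,2) y y'(1), of v] fd_transition_self[OF c(2) y'(2)] by simp
qed

lemma surj_fd_transition:
  "c \<in> A \<Longrightarrow> c' \<in> A \<Longrightarrow> x \<in> overlap c c' \<Longrightarrow> surj (fd (transition c c') x)"
  using fd_transition_inverse by (rule surjI)

lemma form_transition:
  assumes "differential_form A k \<alpha>" "c \<in> A" "c' \<in> A" "x \<in> overlap c c'" "length vs = k"
  shows "\<alpha> c x vs = \<alpha> c' (transition c c' x) (map (fd (transition c c') x) vs)"
proof -
  obtain p where p: "p \<in> fst c \<inter> fst c'" "x = snd c p"
    using assms(4) unfolding overlap_def by blast
  have "\<alpha> c (snd c p) vs = \<alpha> c' (snd c' p) (map (fd (transition c c') (snd c p)) vs)"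
    using assms(1-3,5) p(1) unfolding differential_form_def by blast
  then show ?thesis using p assms(2) by (simp add: transition_apply)
qed

lemma form_smooth:
  "differential_form A k \<alpha> \<Longrightarrow> c \<in> A \<Longrightarrow> length vs = k \<Longrightarrow> smooth_on (\<lambda>x. \<alpha> c x vs) (image_of c)"
  by (simp add: differential_form_def)

lemma one_form_linear:
  assumes "differential_form A 1 \<alpha>" "c \<in> A" "x \<in> image_of c"
  shows "linear (\<lambda>v. \<alpha> c x [v])"
proof -
  have a: "alternating_multilinear 1 (\<alpha> c x)" using assms by (simp add: differential_form_def)
  then have "linear (\<lambda>v. \<alpha> c x ([0][0 := v]))"
    unfolding alternating_multilinear_def by (auto dest!: spec[of _ "[0]"])
  then show ?thesis by simp
qed

lemma ext_d_1: "ext_d \<alpha> c x [v, w] = fd (\<lambda>y. \<alpha> c y [w]) x v - fd (\<lambda>y. \<alpha> c y [v]) x w"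
  by (simp add: ext_d_def numeral_2_eq_2)

text \<open>The second derivatives of the transition map cancel because they are symmetric.\<close>

lemma ext_d_transition:
  assumes \<alpha>: "differential_form A 1 \<alpha>" and c: "c \<in> A" "c' \<in> A" and x: "x \<in> overlap c c'"
  shows "ext_d \<alpha> c x [v, w] =
    ext_d \<alpha> c' (transition c c' x) [fd (transition c c') x v, fd (transition c c') x w]"
proof -
  let ?T = "transition c c'"
  let ?y = "?T x" and ?D = "fd ?T x"
  have O: "open (overlap c c')" by (rule open_overlap[OF c])
  have y: "?y \<in> image_of c'" using transition_overlap[OF c x] overlap_subset by blast
  have D: "fd (\<lambda>y. \<alpha> c y [w]) x v =
      (\<Sum>b\<in>Basis. fd (\<lambda>y. fd (\<lambda>y. ?T y \<bullet> b) y w) x v * \<alpha> c' ?y [b]) + fd (\<lambda>z. \<alpha> c' z [?D w]) ?y (?D v)" for v w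
  proof -
    have Tb: "smooth_on (\<lambda>y. ?T y \<bullet> b) (overlap c c')" for b
      by (rule smooth_on_linear_comp[OF bounded_linear_inner_left O smooth_transition[OF c]])
    have fdTb: "fd (\<lambda>y. ?T y \<bullet> b) y w = fd ?T y w \<bullet> b" if "y \<in> overlap c c'" for y w b
      by (simp add: fd_eqI[OF has_derivative_inner_left[OF
              smooth_on_has_derivative[OF smooth_transition[OF c] that]]])
    \<comment> \<open>In the other chart both the form and the vector \<open>fd ?T y w\<close> vary
      with \<open>y\<close>. Expanding the vector in the fixed basis separates them for the product
      rule.\<close>
    have "fd (\<lambda>y. \<alpha> c y [w]) x = fd (\<lambda>y. \<Sum>b\<in>Basis. fd (\<lambda>y. ?T y \<bullet> b) y w * \<alpha> c' (?T y) [b]) x"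
    proof (rule fd_cong[OF O x])
      fix y assume yo: "y \<in> overlap c c'"
      then have "?T y \<in> image_of c'" using transition_overlap[OF c] overlap_subset by blast
      from linear_sum_Basis[OF one_form_linear[OF \<alpha> c(2) this], of "fd ?T y w"]
      show "\<alpha> c y [w] = (\<Sum>b\<in>Basis. fd (\<lambda>y. ?T y \<bullet> b) y w * \<alpha> c' (?T y) [b])"
        using form_transition[OF \<alpha> c yo, of "[w]"] by (simp add: fdTb[OF yo])
    qed
    also have "fd (\<lambda>y. \<Sum>b\<in>Basis. fd (\<lambda>y. ?T y \<bullet> b) y w * \<alpha> c' (?T y) [b]) x =
        (\<lambda>v. \<Sum>b\<in>Basis. fd (\<lambda>y. ?T y \<bullet> b) x w * fd (\<lambda>z. \<alpha> c' z [b]) ?y (?D v) +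
          fd (\<lambda>y. fd (\<lambda>y. ?T y \<bullet> b) y w) x v * \<alpha> c' ?y [b])"
    proof (intro fd_eqI has_derivative_sum has_derivative_mult)
      fix b :: "complex^'n"
      show "((\<lambda>y. fd (\<lambda>y. ?T y \<bullet> b) y w) has_derivative fd (\<lambda>y. fd (\<lambda>y. ?T y \<bullet> b) y w) x) (at x)"
        by (rule smooth_on_has_derivative[OF smooth_on_fd[OF Tb] x])
      show "((\<lambda>y. \<alpha> c' (?T y) [b]) has_derivative (\<lambda>v. fd (\<lambda>z. \<alpha> c' z [b]) ?y (?D v))) (at x)"
        by (rule has_derivative_compose[OF smooth_on_has_derivative[OF smooth_transition[OF c] x]
              smooth_on_has_derivative[OF form_smooth[OF \<alpha> c(2)] y]]) simp
    qed
    finally have "fd (\<lambda>y. \<alpha> c y [w]) x v = (\<Sum>b\<in>Basis. fd (\<lambda>y. fd (\<lambda>y. ?T y \<bullet> b) y w) x v * \<alpha> c' ?y [b]) +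
        (\<Sum>b\<in>Basis. (?D w \<bullet> b) * fd (\<lambda>z. \<alpha> c' z [b]) ?y (?D v))"
      by (simp add: sum.distrib fdTb[OF x])
    also have "(\<Sum>b\<in>Basis. (?D w \<bullet> b) * fd (\<lambda>z. \<alpha> c' z [b]) ?y (?D v)) = fd (\<lambda>z. \<alpha> c' z [?D w]) ?y (?D v)"
    proof -
      have "linear (\<lambda>u. fd (\<lambda>z. \<alpha> c' z [u]) ?y (?D v))"
        by (rule linear_fd_parameter[OF open_image[OF c(2)] y one_form_linear[OF \<alpha> c(2)]])
          (auto intro: form_smooth[OF \<alpha> c(2)])
      from linear_sum_Basis[OF this, of "?D w"] show ?thesis by simp
    qed
    finally show ?thesis .
  qed
  have "fd (\<lambda>y. fd (\<lambda>y. ?T y \<bullet> b) y w) x v = fd (\<lambda>y. fd (\<lambda>y. ?T y \<bullet> b) y v) x w" for b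
    by (rule second_derivative_symmetric[OF _ O x])
      (rule smooth_on_linear_comp[OF bounded_linear_inner_left O smooth_transition[OF c]])
  then show ?thesis unfolding ext_d_1 D by simp
qed

lemma ext_d_bilinear:
  assumes \<alpha>: "differential_form A 1 \<alpha>" and c: "c \<in> A" and x: "x \<in> image_of c"
  shows "bilinear (\<lambda>v w. ext_d \<alpha> c x [v, w])"
proof -
  have l: "linear (\<lambda>w. fd (\<lambda>y. \<alpha> c y [w]) x v)" for v
    by (rule linear_fd_parameter[OF open_image[OF c] x one_form_linear[OF \<alpha> c]])
      (auto intro: form_smooth[OF \<alpha> c])
  have l': "linear (\<lambda>v. fd (\<lambda>y. \<alpha> c y [w]) x v)" for w
    by (rule linear_fd[OF form_smooth[OF \<alpha> c] x]) simp
  show ?thesis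
    unfolding ext_d_1 bilinear_def by (intro conjI allI linear_compose_sub l l')
qed

end

section \<open>Inner products of 2-forms with the fundamental form\<close>

lemma sum_lists_2:
  "(\<Sum>bs | set bs \<subseteq> B \<and> length bs = 2. h bs) = (\<Sum>a\<in>B. \<Sum>b\<in>B. h [a, b])"
proof -
  have "{bs. set bs \<subseteq> B \<and> length bs = 2} = (\<lambda>(a, b). [a, b]) ` (B \<times> B)"
    by (auto simp: length_Suc_conv numeral_2_eq_2)
  moreover have "inj_on (\<lambda>(a, b). [a, b]) (B \<times> B)" by (auto simp: inj_on_def)
  ultimately show ?thesis
    by (simp add: sum.reindex sum.cartesian_product case_prod_unfold)
qed

lemma borel_measurable_if_open:
  fixes k :: "'a::topological_space \<Rightarrow> real"
  assumes "open V" "continuous_on V k"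
  shows "(\<lambda>x. if x \<in> V then k x else 0) \<in> borel_measurable borel"
  using assms by (intro borel_measurable_continuous_on_if) auto

context hermitian_field
begin

text \<open>Raising both indices of the fundamental form leaves \<open>J\<close> composed with the
  inverse metric, so the double sum contracts to one trace. The 1/2 is the factor 1/k! for k =
  2.\<close>

lemma covector_inner_2:
  assumes y: "y \<in> V" and a: "bilinear (\<lambda>v w. a [v, w])" and b: "\<And>v w. b [v, w] = W y v w"
  shows "covector_inner (g y) 2 a b = tr (g y) (\<lambda>v w. a [v, J w]) / 2"
proof -
  let ?G = "raise (g y)"
  note gy = metric_g[OF y]
  have "b [?G c, ?G d] = d \<bullet> J (?G c)" for c d
  proof -
    have "W y (?G c) (?G d) = - W y (?G d) (?G c)" by (rule skew[OF y])
    also have "\<dots> = g y (?G d) (J (?G c))" by (simp add: g_def bilinear_rneg[OF bilinear_W[OF y]])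
    finally show ?thesis by (simp add: b raise_works[OF gy])
  qed
  then have "covector_inner (g y) 2 a b = (\<Sum>c\<in>Basis. \<Sum>d\<in>Basis. (J (?G c) \<bullet> d) * a [c, d]) / 2"
    by (simp add: covector_inner_def sum_lists_2 inner_commute mult.commute)
  moreover have "(\<Sum>d\<in>Basis. (u \<bullet> d) * a [c, d]) = a [c, u]" for c u
    using linear_sum_Basis[OF bilinear_linear(1)[OF a, of c], of u] by simp
  ultimately show ?thesis by (simp add: tr_def)
qed

text \<open>By \<open>covector_inner_2\<close> the left side is the inner product of the wedge
  product of \<phi> and l with the fundamental form. Its two halves are equal, by transposition and
  \<open>tr_J_swap\<close>.\<close>

lemma tr_exact:
  assumes y: "y \<in> V" and \<phi>: "linear (\<phi> :: complex^'n \<Rightarrow> real)"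
  shows "tr (g y) (\<lambda>v w. \<phi> v * (l \<bullet> J w) - \<phi> (J w) * (l \<bullet> v)) / 2 = - \<phi> (J (raise (g y) l))"
proof -
  note gy = metric_g[OF y]
  have B: "bilinear (\<lambda>v w. \<phi> v * (l \<bullet> w))" "bilinear (\<lambda>v w. \<phi> (J v) * (l \<bullet> w))"
    unfolding bilinear_def
    by (auto intro!: linearI simp: linear_add[OF \<phi>] linear_scale[OF \<phi>] linear_add[OF linear_J]
        linear_scale[OF linear_J] inner_add_right algebra_simps)
  have "tr (g y) (\<lambda>v w. \<phi> (J w) * (l \<bullet> v)) = tr (g y) (\<lambda>v w. \<phi> (J v) * (l \<bullet> w))"
    by (rule tr_transpose[OF gy B(2)])
  moreover have "tr (g y) (\<lambda>v w. \<phi> v * (l \<bullet> J w)) = - tr (g y) (\<lambda>v w. \<phi> (J v) * (l \<bullet> w))"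
    using tr_J_swap[OF y B(1)] by simp
  moreover have "tr (g y) (\<lambda>v w. \<phi> (J v) * (l \<bullet> w)) = \<phi> (J (raise (g y) l))"
  proof -
    have "l \<bullet> w = g y w (raise (g y) l)" for w
      using raise_works[OF gy, of l w] gy by (simp add: metric_tensor_def)
    then show ?thesis
      using tr_contract[OF gy, of "\<lambda>v. \<phi> (J v)" "raise (g y) l"] linear_compose[OF linear_J \<phi>] by (simp add: o_def)
  qed
  ultimately show ?thesis by (simp add: tr_diff)
qed

end

section \<open>Test forms supported in a chart\<close>

context complex_mfd
begin

text \<open>In the chart \<open>c\<close> this is \<phi> times the constant covector
  \<open>l\<close>, so its exterior derivative is the wedge product of d\<phi> and l. Other charts
  see its pullback, extended by zero.\<close>

definition test_form :: "('m, 'n) chart \<Rightarrow> (complex^'n \<Rightarrow> real) \<Rightarrow> complex^'n \<Rightarrow> ('m, 'n) form" where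
  "test_form c \<phi> l c' y vs = (if y \<in> overlap c' c
     then \<phi> (transition c' c y) * (l \<bullet> fd (transition c' c) y (hd vs)) else 0)"

text \<open>If \<open>K\<close> lies in the image of \<open>c\<close> and supports \<phi>, this open
  set and \<open>overlap c' c\<close> cover the image of \<open>c'\<close>. The test form is zero on
  the former and given by its formula on the latter, hence smooth.\<close>

definition off_support :: "('m, 'n) chart \<Rightarrow> (complex^'n) set \<Rightarrow> ('m, 'n) chart \<Rightarrow> (complex^'n) set" where
  "off_support c K c' = snd c' ` (fst c' \<inter> (topspace X - inv_chart c ` K))"

lemma open_off_support:
  assumes "c \<in> A" "c' \<in> A" "compact K" "K \<subseteq> image_of c"
  shows "open (off_support c K c')"
proof -
  have "Hausdorff_space X" using mfd by (simp add: complex_manifold_def)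
  then have "closedin X (inv_chart c ` K)"
    using compactin_inv_chart[OF assms(1,3,4)] compactin_imp_closedin by blast
  then show ?thesis
    unfolding off_support_def by (intro open_image_chart assms) (simp add: closedin_def)
qed

lemma test_form_off_support:
  assumes c: "c \<in> A" "c' \<in> A" and \<phi>0: "\<And>x. x \<notin> K \<Longrightarrow> \<phi> x = 0" and y: "y \<in> off_support c K c'"
  shows "test_form c \<phi> l c' y vs = 0"
proof -
  obtain q where q: "q \<in> fst c'" "q \<notin> inv_chart c ` K" "y = snd c' q"
    using y by (auto simp: off_support_def)
  have "\<phi> (snd c q) = 0" if "q \<in> fst c"
    using q(2) inv_chart_left[OF c(1) that] by (intro \<phi>0) force
  then show ?thesis
    using c q by (simp add: test_form_def overlap_iff transition_def)
qed

lemma differential_form_test_form: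
  assumes c: "c \<in> A" and \<phi>: "smooth_on \<phi> UNIV" and K: "compact K" "K \<subseteq> image_of c"
    and \<phi>0: "\<And>x. x \<notin> K \<Longrightarrow> \<phi> x = 0"
  shows "differential_form A 1 (test_form c \<phi> l)"
  unfolding differential_form_def
proof (intro conjI ballI allI impI)
  fix c' x assume c': "c' \<in> A" and x: "x \<in> image_of c'"
  have "linear (\<lambda>v. test_form c \<phi> l c' x [v])"
  proof (cases "x \<in> overlap c' c")
    case True
    note t = linear_transition[OF c' c True]
    show ?thesis using True
      by (auto intro!: linearI simp: test_form_def linear_add[OF t] linear_scale[OF t] inner_add_right algebra_simps)
  next
    case False
    then show ?thesis by (auto intro!: linearI simp: test_form_def)
  qed
  then show "alternating_multilinear 1 (test_form c \<phi> l c' x)"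
    by (auto simp: alternating_multilinear_def length_Suc_conv)
next
  fix c' and vs :: "(complex^'n) list" assume c': "c' \<in> A" and "length vs = 1"
  let ?T = "transition c' c"
  have O: "open (overlap c' c)" by (rule open_overlap[OF c' c])
  note T = smooth_transition[OF c' c]
  have "smooth_on (\<lambda>y. \<phi> (?T y) * (l \<bullet> fd ?T y (hd vs))) (overlap c' c)"
    by (intro smooth_on_mult O smooth_on_compose[OF O open_UNIV _ T \<phi>]
        smooth_on_linear_comp[OF bounded_linear_inner_right O smooth_on_fd[OF T]]) simp
  then have 1: "smooth_on (\<lambda>y. test_form c \<phi> l c' y vs) (overlap c' c)"
    by (rule smooth_on_cong[OF O, rotated]) (simp add: test_form_def)
  have O2: "open (off_support c K c')" by (rule open_off_support[OF c c' K])
  have 2: "smooth_on (\<lambda>y. test_form c \<phi> l c' y vs) (off_support c K c')"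
    by (rule smooth_on_cong[OF O2 _ smooth_on_const[OF O2, of 0]])
      (simp add: test_form_off_support[OF c c' \<phi>0])
  have "image_of c' \<subseteq> overlap c' c \<union> off_support c K c'"
  proof
    fix y assume y: "y \<in> image_of c'"
    then obtain q where q: "q \<in> fst c'" "y = snd c' q" by (auto simp: image_of_def)
    have "q \<in> fst c" if "q \<in> inv_chart c ` K" using that K inv_chart_mem by blast
    then show "y \<in> overlap c' c \<union> off_support c K c'"
      using q chart_subset[OF c'] by (auto simp: overlap_def off_support_def)
  qed
  then show "smooth_on (\<lambda>y. test_form c \<phi> l c' y vs) (image_of c')"
    using smooth_on_Un[OF O O2 1 2] smooth_on_subset by blast
next
  fix c1 c2 p and vs :: "(complex^'n) list"
  assume c12: "c1 \<in> A" "c2 \<in> A" and p: "p \<in> fst c1 \<inter> fst c2" and "length vs = 1"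
  then obtain v where v: "vs = [v]" by (auto simp: length_Suc_conv)
  have o: "snd c1 p \<in> overlap c1 c \<longleftrightarrow> p \<in> fst c" "snd c2 p \<in> overlap c2 c \<longleftrightarrow> p \<in> fst c"
    using c12 p by (simp_all add: overlap_iff image_of_mem)
  show "test_form c \<phi> l c1 (snd c1 p) vs =
    test_form c \<phi> l c2 (snd c2 p) (map (fd (transition c1 c2) (snd c1 p)) vs)"
  proof (cases "p \<in> fst c")
    case True
    have "snd c1 p \<in> overlap c1 c2" using p by (auto simp: overlap_def)
    from fd_transition_compose[OF c12 c this, of v] o True
    show ?thesis
      using c12 p by (simp add: test_form_def v transition_apply)
  next
    case False
    then show ?thesis using o by (simp add: test_form_def)
  qed
qed

lemma ext_d_test_form:
  assumes c: "c \<in> A" and \<phi>: "smooth_on \<phi> UNIV" and x: "x \<in> image_of c"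
  shows "ext_d (test_form c \<phi> l) c x [v, w] = fd \<phi> x v * (l \<bullet> w) - fd \<phi> x w * (l \<bullet> v)"
proof -
  have "fd (\<lambda>y. test_form c \<phi> l c y [v]) x = (\<lambda>w. fd \<phi> x w * (l \<bullet> v))" for v
  proof -
    have "fd (\<lambda>y. test_form c \<phi> l c y [v]) x = fd (\<lambda>y. \<phi> y * (l \<bullet> v)) x"
      by (rule fd_cong[OF open_image[OF c] x])
        (use c in \<open>simp add: test_form_def overlap_iff inv_chart_mem fd_transition_self, simp add: transition_def\<close>)
    also have "\<dots> = (\<lambda>w. fd \<phi> x w * (l \<bullet> v))"
      by (rule fd_eqI[OF has_derivative_mult_left[OF smooth_on_has_derivative[OF \<phi> UNIV_I]]])
    finally show ?thesis .
  qed
  then show ?thesis by (simp add: ext_d_1)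
qed

lemma ext_d_test_form_off_support:
  assumes c: "c \<in> A" "c' \<in> A" and K: "compact K" "K \<subseteq> image_of c" and \<phi>0: "\<And>x. x \<notin> K \<Longrightarrow> \<phi> x = 0"
    and y: "y \<in> off_support c K c'"
  shows "ext_d (test_form c \<phi> l) c' y [v, w] = 0"
proof -
  have "fd (\<lambda>y. test_form c \<phi> l c' y [v]) y = fd (\<lambda>y. 0) y" for v
    by (rule fd_cong[OF open_off_support[OF c K] y]) (simp add: test_form_off_support[OF c \<phi>0])
  then show ?thesis by (simp add: ext_d_1)
qed

end

section \<open>Hermitian metrics on the manifold and their local models\<close>

locale hermitian_mfd = complex_mfd X A for X :: "'m topology" and A :: "('m, 'n::finite) chart set" +
  fixes \<omega> :: "('m, 'n) form"
  assumes hermitian: "hermitian_metric A \<omega>"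
begin

lemma form: "differential_form A 2 \<omega>"
  using hermitian by (simp add: hermitian_metric_def)

lemma field:
  assumes c: "c \<in> A"
  shows "hermitian_field (image_of c) (\<lambda>y v w. \<omega> c y [v, w])"
proof
  show "open (image_of c)" by (rule open_image[OF c])
  show "smooth_on (\<lambda>y. \<omega> c y [v, w]) (image_of c)" for v w
    by (rule form_smooth[OF form c]) simp
  fix y assume y: "y \<in> image_of c"
  show "\<omega> c y [J v, J w] = \<omega> c y [v, w]" for v w
    using hermitian c y by (simp add: hermitian_metric_def)
  show "0 < \<omega> c y [v, J v]" if "v \<noteq> 0" for v
    using hermitian c y that by (simp add: hermitian_metric_def metric_of_def)
  have alt: "alternating_multilinear 2 (\<omega> c y)"
    using form c y by (simp add: differential_form_def)
  have "linear (\<lambda>u. \<omega> c y ([v, w][i := u]))" if "i < 2" for v w i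
    using alt that unfolding alternating_multilinear_def by (metis length_Cons list.size(3) numeral_2_eq_2)
  from this[of 0] this[of 1] show B: "bilinear (\<lambda>v w. \<omega> c y [v, w])"
    by (simp add: bilinear_def)
  have z: "\<omega> c y [v, v] = 0" for v
  proof -
    have "\<forall>i<2. \<forall>j<2. i \<noteq> j \<and> [v, v] ! i = [v, v] ! j \<longrightarrow> \<omega> c y [v, v] = 0"
      using alt unfolding alternating_multilinear_def by (metis length_Cons list.size(3) numeral_2_eq_2)
    from this[rule_format, of 0 1] show ?thesis by simp
  qed
  show "\<omega> c y [v, w] = - \<omega> c y [w, v]" for v w
    using z[of "v + w"] z[of v] z[of w] bilinear_ladd[OF B, of v w "v + w"]
      bilinear_radd[OF B, of v v w] bilinear_radd[OF B, of w v w] by simp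
qed

lemma field_g: "c \<in> A \<Longrightarrow> hermitian_field.g (\<lambda>y v w. \<omega> c y [v, w]) y = metric_of \<omega> c y"
  using hermitian_field.g_def[OF field] by (auto simp: fun_eq_iff metric_of_def)

lemma metric_tensor_metric_of: "c \<in> A \<Longrightarrow> y \<in> image_of c \<Longrightarrow> metric_tensor (metric_of \<omega> c y)"
  using hermitian_field.metric_g[OF field] field_g by metis

text \<open>\<open>form_inner\<close> evaluates in a chart picked by \<open>SOME\<close>. The
  differential of a transition map is a surjective isometry commuting with \<open>J\<close>, so by
  \<open>tr_image\<close> the trace may be taken in any chart around \<open>p\<close>.\<close>

lemma form_inner_ext_d:
  assumes \<alpha>: "differential_form A 1 \<alpha>" and c: "c \<in> A" and p: "p \<in> fst c"
  shows "form_inner A \<omega> 2 (ext_d \<alpha>) \<omega> p =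
    tr (metric_of \<omega> c (snd c p)) (\<lambda>v w. ext_d \<alpha> c (snd c p) [v, J w]) / 2"
proof -
  define c0 where "c0 = (SOME c. c \<in> A \<and> p \<in> fst c)"
  have c0: "c0 \<in> A" "p \<in> fst c0"
    using someI[of "\<lambda>c. c \<in> A \<and> p \<in> fst c" c] c p by (auto simp: c0_def)
  let ?z = "snd c0 p" and ?x = "snd c p"
  interpret H: hermitian_field "image_of c0" "\<lambda>y v w. \<omega> c0 y [v, w]" by (rule field[OF c0(1)])
  have x0: "?z \<in> image_of c0" "?x \<in> image_of c" using image_of_mem[OF c0(2)] image_of_mem[OF p] by simp_all
  have o: "?z \<in> overlap c0 c" using c0 p by (auto simp: overlap_def)
  have T: "transition c0 c ?z = ?x" using c0 by (simp add: transition_apply)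
  let ?L = "fd (transition c0 c) ?z"
  have "form_inner A \<omega> 2 (ext_d \<alpha>) \<omega> p = covector_inner (metric_of \<omega> c0 ?z) 2 (ext_d \<alpha> c0 ?z) (\<omega> c0 ?z)"
    by (simp add: form_inner_def Let_def c0_def)
  also have "\<dots> = tr (metric_of \<omega> c0 ?z) (\<lambda>v w. ext_d \<alpha> c0 ?z [v, J w]) / 2"
    using H.covector_inner_2[OF x0(1) ext_d_bilinear[OF \<alpha> c0(1) x0(1)], of "\<omega> c0 ?z"] field_g[OF c0(1)] by simp
  also have "(\<lambda>v w. ext_d \<alpha> c0 ?z [v, J w]) = (\<lambda>v w. ext_d \<alpha> c ?x [?L v, J (?L w)])"
    using ext_d_transition[OF \<alpha> c0(1) c o] transition_J[OF c0(1) c o] T by simp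
  also have "tr (metric_of \<omega> c0 ?z) \<dots> = tr (metric_of \<omega> c ?x) (\<lambda>v w. ext_d \<alpha> c ?x [v, J w])"
  proof (rule tr_image[where L = ?L])
    show "metric_of \<omega> c ?x (?L v) (?L w) = metric_of \<omega> c0 ?z v w" for v w
      using form_transition[OF form c0(1) c o, of "[v, J w]"] transition_J[OF c0(1) c o] T
      by (simp add: metric_of_def)
    show "bilinear (\<lambda>v w. ext_d \<alpha> c ?x [v, J w])"
      using ext_d_bilinear[OF \<alpha> c x0(2)] linear_J unfolding bilinear_def
      by (auto intro: linear_compose[unfolded o_def])
  qed (use c c0 o x0 in \<open>auto simp: metric_tensor_metric_of linear_transition surj_fd_transition\<close>)
  finally show ?thesis .
qed

lemma form_inner_test_form:
  assumes c: "c \<in> A" and \<phi>: "smooth_on \<phi> UNIV" and K: "compact K" "K \<subseteq> image_of c"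
    and \<phi>0: "\<And>x. x \<notin> K \<Longrightarrow> \<phi> x = 0" and p: "p \<in> topspace X"
  shows "form_inner A \<omega> 2 (ext_d (test_form c \<phi> l)) \<omega> p =
    (if p \<in> fst c then - fd \<phi> (snd c p) (J (raise (metric_of \<omega> c (snd c p)) l)) else 0)"
proof -
  have t: "differential_form A 1 (test_form c \<phi> l)"
    by (rule differential_form_test_form[OF c \<phi> K \<phi>0])
  show ?thesis
  proof (cases "p \<in> fst c")
    case True
    interpret H: hermitian_field "image_of c" "\<lambda>y v w. \<omega> c y [v, w]" by (rule field[OF c])
    have x: "snd c p \<in> image_of c" using True by (rule image_of_mem)
    from H.tr_exact[OF x linear_fd[OF \<phi> UNIV_I], of "snd c p" l] show ?thesis
      using True by (simp add: form_inner_ext_d[OF t c True] ext_d_test_form[OF c \<phi> x] field_g[OF c])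
  next
    case False
    obtain c' where c': "c' \<in> A" "p \<in> fst c'" using ex_chart[OF p] by blast
    have "p \<notin> inv_chart c ` K" using False K inv_chart_mem by blast
    then have "snd c' p \<in> off_support c K c'" using c' p by (auto simp: off_support_def)
    from ext_d_test_form_off_support[OF c c'(1) K \<phi>0 this] show ?thesis
      using False by (simp add: form_inner_ext_d[OF t c'] tr_def)
  qed
qed

end

section \<open>The volume measure in charts\<close>

context hermitian_mfd
begin

text \<open>Off the image of the chart the local representative of \<omega> carries no information.
  The value 0 there makes this a Borel function on the whole space.\<close>

definition density :: "('m, 'n) chart \<Rightarrow> complex^'n \<Rightarrow> real" where
  "density c x = (if x \<in> image_of c then volume_density (metric_of \<omega> c x) else 0)"

lemma continuous_density:
  assumes c: "c \<in> A"
  shows "continuous_on (image_of c) (\<lambda>x. volume_density (metric_of \<omega> c x))"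
  using smooth_on_continuous[OF hermitian_field.smooth_density[OF field[OF c]]] field_g[OF c] by simp

lemma density_measurable [measurable]: "c \<in> A \<Longrightarrow> density c \<in> borel_measurable borel"
  unfolding density_def[abs_def] by (rule borel_measurable_if_open[OF open_image continuous_density])

lemma density_pos: "c \<in> A \<Longrightarrow> x \<in> image_of c \<Longrightarrow> density c x > 0"
  by (simp add: density_def volume_density_pos metric_tensor_metric_of)

lemma density_nonneg: "c \<in> A \<Longrightarrow> density c x \<ge> 0"
  using density_pos[of c x] by (cases "x \<in> image_of c") (auto simp: density_def)

end

locale hermitian_measure = hermitian_mfd X A \<omega>
  for X :: "'m topology" and A :: "('m, 'n::finite) chart set" and \<omega> :: "('m, 'n) form" +
  fixes \<mu> :: "'m measure"
  assumes volume: "is_volume_measure X A \<omega> \<mu>"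
begin

lemma space_\<mu>: "space \<mu> = topspace X"
  using volume by (simp add: is_volume_measure_def)

lemma open_sets: "openin X U \<Longrightarrow> U \<in> sets \<mu>"
  using volume by (auto simp: is_volume_measure_def)

lemma continuous_map_measurable:
  assumes "continuous_map X euclidean (h :: 'm \<Rightarrow> real)"
  shows "h \<in> borel_measurable \<mu>"
proof (rule borel_measurableI)
  fix S :: "real set" assume "open S"
  then have "openin X {p \<in> topspace X. h p \<in> S}"
    using assms by (intro openin_continuous_map_preimage) auto
  moreover have "h -` S \<inter> space \<mu> = {p \<in> topspace X. h p \<in> S}" by (auto simp: space_\<mu>)
  ultimately show "h -` S \<inter> space \<mu> \<in> sets \<mu>" using open_sets by simp
qed

lemma chart_measurable:
  assumes c: "c \<in> A"
  shows "snd c \<in> measurable (restrict_space \<mu> (fst c)) borel"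
proof (rule borel_measurableI)
  fix S :: "(complex^'n) set" assume "open S"
  from open_sets[OF openin_preimage_chart[OF c this]]
  have "{p \<in> fst c. snd c p \<in> S} \<in> sets \<mu>" .
  moreover have "snd c -` S \<inter> space (restrict_space \<mu> (fst c)) = {p \<in> fst c. snd c p \<in> S}"
    using chart_subset[OF c] by (auto simp: space_restrict_space space_\<mu>)
  ultimately show "snd c -` S \<inter> space (restrict_space \<mu> (fst c)) \<in> sets (restrict_space \<mu> (fst c))"
    using open_sets[OF openin_chart[OF c]] chart_subset[OF c]
    by (subst sets_restrict_space_iff) (auto simp: space_\<mu> Int_absorb2)
qed

lemma emeasure_chart:
  assumes c: "c \<in> A" and S: "S \<in> sets \<mu>" "S \<subseteq> fst c"
  shows "emeasure \<mu> S = (\<integral>\<^sup>+x\<in>snd c ` S. ennreal (density c x) \<partial>lborel)"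
proof -
  have "emeasure \<mu> S = (\<integral>\<^sup>+x\<in>snd c ` S. ennreal (volume_density (metric_of \<omega> c x)) \<partial>lborel)"
    using volume c S by (simp add: is_volume_measure_def)
  also have "\<dots> = (\<integral>\<^sup>+x\<in>snd c ` S. ennreal (density c x) \<partial>lborel)"
    using S by (intro nn_integral_cong) (auto simp: density_def image_of_def split: split_indicator)
  finally show ?thesis .
qed

text \<open>The formula defining \<mu> on subsets of a chart, restated as an equality of measures,
  so that integrals over the chart domain can be transferred to Lebesgue integrals.\<close>

lemma distr_chart:
  assumes c: "c \<in> A"
  shows "distr (restrict_space \<mu> (fst c)) borel (snd c) = Nonnegative_Lebesgue_Integration.density lborel (density c)"
    (is "?D = ?E")
proof (rule measure_eqI)
  show "sets ?D = sets ?E" by simp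
  fix S assume "S \<in> sets ?D"
  then have S: "S \<in> sets borel" by simp
  have U: "fst c \<inter> space \<mu> \<in> sets \<mu>" "fst c \<subseteq> space \<mu>"
    using open_sets[OF openin_chart[OF c]] chart_subset[OF c] by (auto simp: space_\<mu> Int_absorb2)
  let ?P = "snd c -` S \<inter> space (restrict_space \<mu> (fst c))"
  have sp: "space (restrict_space \<mu> (fst c)) = fst c" using U by (auto simp: space_restrict_space)
  have "?P \<in> sets (restrict_space \<mu> (fst c))"
    using chart_measurable[OF c] S by (rule measurable_sets)
  then have P: "?P \<in> sets \<mu>" "?P \<subseteq> fst c" using sets_restrict_space_iff[OF U(1)] sp by auto
  have img: "snd c ` ?P = S \<inter> image_of c" using sp by (auto simp: image_of_def)
  have "emeasure ?D S = emeasure (restrict_space \<mu> (fst c)) ?P"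
    by (rule emeasure_distr[OF chart_measurable[OF c] S])
  also have "\<dots> = emeasure \<mu> ?P"
    by (rule emeasure_restrict_space[OF U(1) P(2)])
  also have "\<dots> = (\<integral>\<^sup>+x\<in>S \<inter> image_of c. ennreal (density c x) \<partial>lborel)"
    using emeasure_chart[OF c P] by (simp add: img)
  also have "\<dots> = (\<integral>\<^sup>+x. ennreal (density c x) * indicator S x \<partial>lborel)"
    by (intro nn_integral_cong) (auto simp: density_def split: split_indicator)
  also have "\<dots> = emeasure ?E S"
    using S c by (subst emeasure_density) auto
  finally show "emeasure ?D S = emeasure ?E S" .
qed

lemma integral_chart:
  assumes c: "c \<in> A" and h: "\<And>p. p \<in> topspace X \<Longrightarrow> h p = (if p \<in> fst c then k (snd c p) else 0)"
    and k: "continuous_on (image_of c) k"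
  shows "integral\<^sup>L \<mu> h = integral\<^sup>L lborel (\<lambda>x. if x \<in> image_of c then volume_density (metric_of \<omega> c x) * k x else (0::real))"
proof -
  let ?k = "\<lambda>x. if x \<in> image_of c then k x else 0"
  have [measurable]: "?k \<in> borel_measurable borel"
    by (rule borel_measurable_if_open[OF open_image[OF c] k])
  have U: "fst c \<inter> space \<mu> \<in> sets \<mu>"
    using open_sets[OF openin_chart[OF c]] chart_subset[OF c] by (auto simp: space_\<mu> Int_absorb2)
  have "integral\<^sup>L \<mu> h = integral\<^sup>L \<mu> (\<lambda>p. indicator (fst c) p *\<^sub>R ?k (snd c p))"
    by (rule Bochner_Integration.integral_cong) (auto simp: h space_\<mu> image_of_mem)
  also have "\<dots> = integral\<^sup>L (restrict_space \<mu> (fst c)) (\<lambda>p. ?k (snd c p))"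
    by (rule integral_restrict_space[OF U, symmetric])
  also have "\<dots> = integral\<^sup>L (distr (restrict_space \<mu> (fst c)) borel (snd c)) ?k"
    by (rule integral_distr[OF chart_measurable[OF c], symmetric]) measurable
  also have "\<dots> = integral\<^sup>L lborel (\<lambda>x. density c x *\<^sub>R ?k x)"
    unfolding distr_chart[OF c]
    by (rule integral_density) (use c density_nonneg in auto)
  also have "(\<lambda>x. density c x *\<^sub>R ?k x) = (\<lambda>x. if x \<in> image_of c then volume_density (metric_of \<omega> c x) * k x else 0)"
    by (auto simp: density_def)
  finally show ?thesis .
qed

text \<open>The density is bounded on a closed coordinate ball, so small balls have finite volume,
  and finitely many of them cover the compact space.\<close>

lemma finite_measure_\<mu>:
  assumes "compact_space X"
  shows "finite_measure \<mu>"
proof (rule finite_measureI)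
  have loc: "\<exists>N. openin X N \<and> p \<in> N \<and> emeasure \<mu> N < \<infinity>" if p: "p \<in> topspace X" for p
  proof -
    obtain c where c: "c \<in> A" "p \<in> fst c" using ex_chart[OF p] by blast
    obtain r where r: "r > 0" "cball (snd c p) r \<subseteq> image_of c"
      using open_image[OF c(1)] image_of_mem[OF c(2)] open_contains_cball_eq by blast
    let ?B = "cball (snd c p) r"
    obtain M where M: "\<And>x. x \<in> ?B \<Longrightarrow> volume_density (metric_of \<omega> c x) \<le> M"
    proof -
      have "compact ((\<lambda>x. volume_density (metric_of \<omega> c x)) ` ?B)"
        by (intro compact_continuous_image continuous_on_subset[OF continuous_density[OF c(1)] r(2)] compact_cball)
      then have "bounded ((\<lambda>x. volume_density (metric_of \<omega> c x)) ` ?B)" by (rule compact_imp_bounded)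
      then show ?thesis using that unfolding bounded_iff by (metis abs_le_D1 image_eqI real_norm_def)
    qed
    define N where "N = {q \<in> fst c. snd c q \<in> ball (snd c p) r}"
    have N: "openin X N" unfolding N_def by (rule openin_preimage_chart[OF c(1) open_ball])
    have "emeasure \<mu> N = (\<integral>\<^sup>+x\<in>snd c ` N. ennreal (density c x) \<partial>lborel)"
      by (rule emeasure_chart[OF c(1) open_sets[OF N]]) (auto simp: N_def)
    also have "\<dots> \<le> (\<integral>\<^sup>+x. ennreal M * indicator ?B x \<partial>lborel)"
      by (intro nn_integral_mono)
        (auto simp: N_def density_def image_of_mem intro!: ennreal_leI M split: split_indicator)
    also have "\<dots> = ennreal M * emeasure lborel ?B" by (simp add: nn_integral_cmult_indicator)
    also have "\<dots> < \<infinity>" using emeasure_lborel_cball_finite by (auto simp: ennreal_mult_less_top)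
    finally show ?thesis using N c(2) r(1) by (auto simp: N_def)
  qed
  define \<N> where "\<N> = {N. openin X N \<and> emeasure \<mu> N < \<infinity>}"
  have "topspace X \<subseteq> \<Union>\<N>" using loc by (auto simp: \<N>_def)
  then obtain \<F> where \<F>: "finite \<F>" "\<F> \<subseteq> \<N>" "topspace X \<subseteq> \<Union>\<F>"
    using assms unfolding compact_space_def compactin_def \<N>_def by (metis (no_types, lifting) mem_Collect_eq)
  have "emeasure \<mu> (space \<mu>) \<le> emeasure \<mu> (\<Union>N\<in>\<F>. N)"
    using \<F> by (intro emeasure_mono) (auto simp: space_\<mu> \<N>_def intro!: sets.finite_UN open_sets)
  also have "\<dots> \<le> (\<Sum>N\<in>\<F>. emeasure \<mu> N)"
    using \<F> by (intro emeasure_subadditive_finite) (auto simp: \<N>_def intro: open_sets)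
  also have "\<dots> < \<infinity>" using \<F> by (auto simp: \<N>_def)
  finally show "emeasure \<mu> (space \<mu>) \<noteq> \<infinity>" by simp
qed

text \<open>Within a chart the set where \<open>h\<close> is nonzero is open and \<mu>-null. As the
  density is positive, its image is Lebesgue null; being open, the image is empty.\<close>

lemma continuous_nonneg_integral_eq_0:
  assumes X: "compact_space X" and h: "continuous_map X euclidean (h :: 'm \<Rightarrow> real)"
    and nonneg: "\<And>p. p \<in> topspace X \<Longrightarrow> h p \<ge> 0" and 0: "integral\<^sup>L \<mu> h = 0" and p: "p \<in> topspace X"
  shows "h p = 0"
proof (rule ccontr)
  assume hp: "h p \<noteq> 0"
  interpret finite_measure \<mu> by (rule finite_measure_\<mu>[OF X])
  have "compactin euclidean (h ` topspace X)"
    using X h image_compactin unfolding compact_space_def by blast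
  then have "bounded (h ` topspace X)" by (simp add: compact_imp_bounded)
  then obtain M where "\<And>q. q \<in> topspace X \<Longrightarrow> norm (h q) \<le> M" unfolding bounded_iff by auto
  then have "integrable \<mu> h"
    by (intro integrable_const_bound[of _ M] continuous_map_measurable[OF h] AE_I2) (simp add: space_\<mu>)
  then have ae: "AE q in \<mu>. h q = 0"
    using 0 nonneg by (subst (asm) integral_nonneg_eq_0_iff_AE) (auto intro!: AE_I2 simp: space_\<mu>)
  obtain c where c: "c \<in> A" "p \<in> fst c" using ex_chart[OF p] by blast
  define N where "N = fst c \<inter> {q \<in> topspace X. h q \<in> - {0}}"
  have "openin X {q \<in> topspace X. h q \<in> - {0}}"
    by (rule openin_continuous_map_preimage[OF h]) (simp add: open_Compl)
  then have N: "openin X N" unfolding N_def by (intro openin_Int openin_chart[OF c(1)])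
  have "N \<in> null_sets \<mu>"
  proof -
    have "AE q in \<mu>. q \<notin> N" using ae by eventually_elim (simp add: N_def)
    then show ?thesis using AE_iff_null_sets[OF open_sets[OF N]] by simp
  qed
  then have z: "(\<integral>\<^sup>+x\<in>snd c ` N. ennreal (density c x) \<partial>lborel) = 0"
    using emeasure_chart[OF c(1) open_sets[OF N]] by (auto simp: N_def)
  have oN: "open (snd c ` N)"
    using open_image_chart[OF c(1) N] by (simp add: N_def Int_absorb1 inf.left_commute)
  have "AE x in lborel. ennreal (density c x) * indicator (snd c ` N) x = 0"
    using z oN c(1) by (subst (asm) nn_integral_0_iff_AE) auto
  then have "AE x in lborel. x \<notin> snd c ` N"
  proof eventually_elim
    case (elim x)
    then show ?case
      using density_pos[OF c(1), of x] by (auto simp: N_def image_of_mem split: split_indicator_asm)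
  qed
  then have "snd c ` N \<in> null_sets lborel" using oN AE_iff_null_sets[of "snd c ` N" lborel] by simp
  then have "negligible (snd c ` N)" by (simp add: negligible_iff_null_sets null_sets_completionI)
  then have "snd c ` N = {}" using oN open_not_negligible by blast
  then show False using hp p c by (auto simp: N_def)
qed

lemma continuous_map_local:
  assumes "\<And>c p. c \<in> A \<Longrightarrow> p \<in> fst c \<Longrightarrow> h p = k c (snd c p)" and "\<And>c. c \<in> A \<Longrightarrow> continuous_on (image_of c) (k c)"
  shows "continuous_map X euclidean (h :: 'm \<Rightarrow> real)"
  unfolding continuous_map_def
proof (intro conjI allI impI)
  fix S :: "real set" assume "openin euclidean S"
  then have S: "open S" by simp
  have "{p \<in> topspace X. h p \<in> S} = (\<Union>c\<in>A. {p \<in> fst c. snd c p \<in> image_of c \<inter> k c -` S})"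
  proof (intro equalityI subsetI)
    fix p assume p: "p \<in> {p \<in> topspace X. h p \<in> S}"
    then obtain c where "c \<in> A" "p \<in> fst c" using ex_chart by blast
    then show "p \<in> (\<Union>c\<in>A. {p \<in> fst c. snd c p \<in> image_of c \<inter> k c -` S})"
      using p assms(1)[of c p] by (auto simp: image_of_mem intro!: bexI[of _ c])
  next
    fix p assume "p \<in> (\<Union>c\<in>A. {p \<in> fst c. snd c p \<in> image_of c \<inter> k c -` S})"
    then obtain c where c: "c \<in> A" "p \<in> fst c" "k c (snd c p) \<in> S" by blast
    then show "p \<in> {p \<in> topspace X. h p \<in> S}"
      using assms(1)[OF c(1,2)] chart_subset[OF c(1)] by auto
  qed
  moreover have "openin X {p \<in> fst c. snd c p \<in> image_of c \<inter> k c -` S}" if "c \<in> A" for c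
    by (rule openin_preimage_chart[OF that continuous_open_preimage[OF assms(2)[OF that] open_image[OF that] S]])
  ultimately show "openin X {p \<in> topspace X. h p \<in> S}" by auto
qed simp

end

section \<open>Pointwise vanishing of d\<omega>\<close>

context hermitian_field
begin

lemma dW_eq_0:
  assumes y: "y \<in> V" and E: "onb (g y) E"
    and 0: "\<And>i j k. i \<in> E \<Longrightarrow> j \<in> E \<Longrightarrow> k \<in> E \<Longrightarrow> dW y i j k = 0"
  shows "dW y a b c = 0"
proof -
  note B = bilinear_D1[OF y] and l = linear_D1[OF y] and gy = metric_g[OF y]
  note s = bilinear_ladd[OF B] bilinear_radd[OF B] bilinear_lmul[OF B] bilinear_rmul[OF B]
    linear_add[OF l] linear_scale[OF l]
  have 1: "linear (\<lambda>a. dW y a b c)" and 2: "linear (\<lambda>b. dW y a b c)" and 3: "linear (\<lambda>c. dW y a b c)" for a b c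
    by (auto intro!: linearI simp: dW_def s algebra_simps)
  have "dW y i j c = 0" if "i \<in> E" "j \<in> E" for i j
    using onb_linear[OF gy E 3, where v = c] 0 that by simp
  then have "dW y i b c = 0" if "i \<in> E" for i
    using onb_linear[OF gy E 2, where v = b] that by simp
  then show ?thesis
    using onb_linear[OF gy E 1, where v = a] by simp
qed

lemma dW_eq_0_of_norm:
  assumes y: "y \<in> V" and E: "onb (g y) E" and 0: "(\<Sum>i\<in>E. \<Sum>j\<in>E. \<Sum>k\<in>E. (dW y i j k)\<^sup>2) = 0"
  shows "dW y a b c = 0"
proof (rule dW_eq_0[OF y E])
  have fin: "finite E" using E by (simp add: onb_def)
  have "(\<Sum>x\<in>E \<times> E \<times> E. (dW y (fst x) (fst (snd x)) (snd (snd x)))\<^sup>2) = 0"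
    using 0 by (simp add: sum.cartesian_product' case_prod_unfold flip: sum.cartesian_product)
  then have *: "\<forall>x\<in>E \<times> E \<times> E. (dW y (fst x) (fst (snd x)) (snd (snd x)))\<^sup>2 = 0"
    using fin by (subst (asm) sum_nonneg_eq_0_iff) auto
  show "dW y i j k = 0" if "i \<in> E" "j \<in> E" "k \<in> E" for i j k
    using bspec[OF *, of "(i, j, k)"] that by simp
qed

text \<open>Among three vectors of a two-element basis two coincide, and the 3-form is
  alternating.\<close>

lemma dW_eq_0_dim2:
  assumes y: "y \<in> V" and dim: "DIM(complex^'n) = 2"
  shows "dW y a b c = 0"
proof -
  obtain E where E: "onb (g y) E" using ex_onb[OF metric_g[OF y]] .
  have sk: "D1 y a b c = - D1 y a c b" for a b c by (rule D1_skew[OF y])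
  have z: "D1 y a b b = 0" for a b using sk[of a b b] by simp
  have alt: "dW y a a c = 0" "dW y a b b = 0" "dW y a b a = 0" for a b c
    using sk[of a b a] by (simp_all add: dW_def z)
  have "card E = 2" using card_onb[OF metric_g[OF y] E] dim by simp
  then obtain u v where "E = {u, v}" by (auto simp: card_2_iff)
  show ?thesis
  proof (rule dW_eq_0[OF y E])
    fix i j k assume "i \<in> E" "j \<in> E" "k \<in> E"
    then have "i = j \<or> j = k \<or> i = k" unfolding \<open>E = {u, v}\<close> by auto
    then show "dW y i j k = 0" by (elim disjE) (simp_all only: alt)
  qed
qed

end

section \<open>The form d^c f\<close>

context complex_mfd
begin

text \<open>This is d^c f = - df o J, which agrees with the convention of \<open>ext_dc\<close> for
  forms of degree 0.\<close>

definition dc_form :: "('m \<Rightarrow> real) \<Rightarrow> ('m, 'n) form" where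
  "dc_form f c x vs = - fd (f \<circ> inv_chart c) x (J (hd vs))"

lemma differential_form_dc_form:
  assumes f: "smooth_function A f"
  shows "differential_form A 1 (dc_form f)"
  unfolding differential_form_def
proof (intro conjI ballI allI impI)
  have F: "smooth_on (f \<circ> inv_chart c) (image_of c)" if "c \<in> A" for c
    using f that by (simp add: smooth_function_def)
  {
    fix c x assume c: "c \<in> A" and x: "x \<in> image_of c"
    note l = linear_fd[OF F[OF c] x]
    have "linear (\<lambda>v. dc_form f c x [v])"
      by (auto intro!: linearI simp: dc_form_def linear_add[OF l] linear_scale[OF l] linear_add[OF linear_J] linear_scale[OF linear_J])
    then show "alternating_multilinear 1 (dc_form f c x)"
      by (auto simp: alternating_multilinear_def length_Suc_conv)
  next
    fix c and vs :: "(complex^'n) list" assume c: "c \<in> A"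
    show "smooth_on (\<lambda>x. dc_form f c x vs) (image_of c)"
      unfolding dc_form_def by (intro smooth_on_uminus open_image[OF c] smooth_on_fd[OF F[OF c]])
  next
    fix c c' p and vs :: "(complex^'n) list"
    assume c: "c \<in> A" "c' \<in> A" and p: "p \<in> fst c \<inter> fst c'" and "length vs = 1"
    then obtain v where v: "vs = [v]" by (auto simp: length_Suc_conv)
    let ?x = "snd c p" and ?T = "transition c c'"
    have x: "?x \<in> overlap c c'" using p by (auto simp: overlap_def)
    have T: "?T ?x = snd c' p" using c p by (simp add: transition_apply)
    have x': "?T ?x \<in> image_of c'" unfolding T using p by (intro image_of_mem) simp
    have D: "((\<lambda>y. (f \<circ> inv_chart c') (?T y)) has_derivative
        (\<lambda>v. fd (f \<circ> inv_chart c') (?T ?x) (fd ?T ?x v))) (at ?x)"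
      by (rule has_derivative_compose[OF smooth_on_has_derivative[OF smooth_transition[OF c] x]
            smooth_on_has_derivative[OF F[OF c(2)] x']])
    have "fd (f \<circ> inv_chart c) ?x = fd (\<lambda>y. (f \<circ> inv_chart c') (?T y)) ?x"
      by (rule fd_cong[OF open_overlap[OF c] x]) (use c in \<open>auto simp: overlap_def transition_apply\<close>)
    then have "fd (f \<circ> inv_chart c) ?x (J v) = fd (f \<circ> inv_chart c') (snd c' p) (fd ?T ?x (J v))"
      by (simp only: fd_eqI[OF D] T)
    then show "dc_form f c ?x vs = dc_form f c' (snd c' p) (map (fd ?T ?x) vs)"
      by (simp add: dc_form_def v transition_J[OF c x])
  }
qed

end

section \<open>Conformal metrics, and exterior derivatives in the local model\<close>

context hermitian_mfd
begin

lemma hermitian_conformal: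
  assumes f: "smooth_function A f"
  shows "hermitian_metric A (conformal f \<omega>)"
  unfolding hermitian_metric_def differential_form_def
proof (intro conjI ballI allI impI)
  fix c x assume c: "c \<in> A" and x: "x \<in> image_of c"
  have "alternating_multilinear 2 (\<omega> c x)" using form c x by (simp add: differential_form_def)
  then show "alternating_multilinear 2 (conformal f \<omega> c x)"
    unfolding alternating_multilinear_def conformal_def
    by (auto intro: linear_compose_scale_right[where 'b = real, simplified])
  show "conformal f \<omega> c x [J v, J w] = conformal f \<omega> c x [v, w]" for v w
    using hermitian c x by (simp add: hermitian_metric_def conformal_def)
  show "metric_of (conformal f \<omega>) c x v v > 0" if "v \<noteq> 0" for v
    using hermitian c x that by (simp add: hermitian_metric_def metric_of_def conformal_def)
next
  fix c and vs :: "(complex^'n) list" assume c: "c \<in> A" and "length vs = 2"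
  then have "smooth_on (\<lambda>x. \<omega> c x vs) (image_of c)" by (intro form_smooth[OF form])
  moreover have "smooth_on (\<lambda>x. f (inv_chart c x)) (image_of c)"
    using f c by (simp add: smooth_function_def o_def)
  ultimately show "smooth_on (\<lambda>x. conformal f \<omega> c x vs) (image_of c)"
    unfolding conformal_def by (intro smooth_on_mult smooth_on_exp open_image[OF c])
next
  fix c c' p and vs :: "(complex^'n) list"
  assume c: "c \<in> A" "c' \<in> A" and p: "p \<in> fst c \<inter> fst c'" and "length vs = 2"
  then have "\<omega> c (snd c p) vs = \<omega> c' (snd c' p) (map (fd (transition c c') (snd c p)) vs)"
    using form unfolding differential_form_def by blast
  then show "conformal f \<omega> c (snd c p) vs =
      conformal f \<omega> c' (snd c' p) (map (fd (transition c c') (snd c p)) vs)"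
    using c p by (simp add: conformal_def)
qed

lemma ext_d_eq_dW:
  assumes "c \<in> A"
  shows "ext_d \<omega> c x [u, v, w] = hermitian_field.dW (\<lambda>y v w. \<omega> c y [v, w]) x u v w"
proof -
  interpret H: hermitian_field "image_of c" "\<lambda>y v w. \<omega> c y [v, w]" by (rule field[OF assms])
  show ?thesis by (simp add: ext_d_def H.dW_def H.D1_def numeral_3_eq_3)
qed

lemma kaehlerI:
  assumes "\<And>c x u v w. c \<in> A \<Longrightarrow> x \<in> image_of c \<Longrightarrow>
    hermitian_field.dW (\<lambda>y v w. \<omega> c y [v, w]) x u v w = 0"
  shows "kaehler_metric A \<omega>"
  unfolding kaehler_metric_def form_vanishes_def
proof (intro conjI hermitian ballI allI impI)
  fix c x and vs :: "(complex^'n) list"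
  assume c: "c \<in> A" "x \<in> image_of c" and "length vs = 3"
  then obtain u v w where "vs = [u, v, w]" by (auto simp: length_Suc_conv numeral_3_eq_3)
  then show "ext_d \<omega> c x vs = 0" using assms[OF c] by (simp add: ext_d_eq_dW[OF c(1)])
qed

lemma ext_d_ext_dc_eq_ddcW:
  assumes c: "c \<in> A" and x: "x \<in> image_of c"
  shows "ext_d (ext_dc \<omega>) c x [u, v, w, z] = hermitian_field.ddcW (\<lambda>y v w. \<omega> c y [v, w]) x u v w z"
proof -
  interpret H: hermitian_field "image_of c" "\<lambda>y v w. \<omega> c y [v, w]" by (rule field[OF c])
  have "ext_dc \<omega> c y [u, v, w] = H.dcW y u v w" if y: "y \<in> image_of c" for y u v w
  proof -
    have "ext_dc \<omega> c y [u, v, w] = H.D1 y (- J u) v w - H.D1 y (- J v) u w + H.D1 y (- J w) u v"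
      by (simp add: ext_dc_def pull_J_inv_def pull_J_def ext_d_def H.D1_def numeral_3_eq_3)
    then show ?thesis by (simp add: H.dcW_def linear_neg[OF H.linear_D1[OF y]])
  qed
  then have "fd (\<lambda>y. ext_dc \<omega> c y [u, v, w]) x = fd (\<lambda>y. H.dcW y u v w) x" for u v w
    by (intro fd_cong[OF H.V x])
  then show ?thesis
    by (simp add: ext_d_def[of "ext_dc \<omega>"] H.ddcW_def eval_nat_numeral)
qed

text \<open>The value of dd^c f on (a, J b) is the coordinate Hessian of f at (a, b) plus the one at
  (J b, J a). Both have the same trace, which cancels the 1/2 of \<open>form_inner_ext_d\<close>. In
  particular this trace of the coordinate Hessian does not depend on the chart.\<close>

lemma form_inner_dc_form:
  assumes f: "smooth_function A f" and c: "c \<in> A" and p: "p \<in> fst c"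
  shows "form_inner A \<omega> 2 (ext_d (dc_form f)) \<omega> p =
    tr (metric_of \<omega> c (snd c p)) (\<lambda>a b. fd (\<lambda>y. fd (f \<circ> inv_chart c) y b) (snd c p) a)"
proof -
  interpret H: hermitian_field "image_of c" "\<lambda>y v w. \<omega> c y [v, w]" by (rule field[OF c])
  define F where "F = f \<circ> inv_chart c"
  have F: "smooth_on F (image_of c)" using f c by (simp add: F_def smooth_function_def)
  let ?x = "snd c p"
  have x: "?x \<in> image_of c" using p by (rule image_of_mem)
  note gy = H.metric_g[OF x]
  define B where "B a b = fd (\<lambda>y. fd F y b) ?x a" for a b
  have B: "bilinear B"
    unfolding B_def[abs_def] bilinear_def
    using linear_fd_parameter[OF H.V x linear_fd[OF F] smooth_on_fd[OF F]] linear_fd[OF smooth_on_fd[OF F] x] by blast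
  have neg: "fd (\<lambda>y. - fd F y b) ?x a = - B a b" for a b
    unfolding B_def by (rule fd_uminus[OF smooth_on_differentiable[OF smooth_on_fd[OF F] x]])
  have "ext_d (dc_form f) c ?x [a, J b] = B a b + B (J b) (J a)" for a b
  proof -
    have "ext_d (dc_form f) c ?x [a, J b] = - B a (J (J b)) + B (J b) (J a)"
      unfolding ext_d_1 dc_form_def list.sel by (simp add: neg flip: F_def)
    then show ?thesis by (simp add: bilinear_rneg[OF B])
  qed
  moreover have "tr (H.g ?x) (\<lambda>a b. B (J b) (J a)) = tr (H.g ?x) B"
    using H.tr_J[OF x, of "\<lambda>a b. B b a"] tr_transpose[OF gy B] B by (simp add: bilinear_def)
  ultimately show ?thesis
    by (simp add: form_inner_ext_d[OF differential_form_dc_form[OF f] c p] tr_add field_g[OF c] B_def[abs_def] F_def)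
qed

lemma continuous_laplacian:
  assumes f: "smooth_function A f" and c: "c \<in> A"
  shows "continuous_on (image_of c)
    (\<lambda>x. tr (metric_of \<omega> c x) (\<lambda>a b. fd (\<lambda>y. fd (f \<circ> inv_chart c) y b) x a))"
proof -
  interpret H: hermitian_field "image_of c" "\<lambda>y v w. \<omega> c y [v, w]" by (rule field[OF c])
  define F where "F = f \<circ> inv_chart c"
  have F: "smooth_on F (image_of c)" using f c by (simp add: F_def smooth_function_def)
  have "smooth_on (\<lambda>x. \<Sum>b\<in>Basis. \<Sum>d\<in>Basis. (raise (H.g x) b \<bullet> d) * fd (\<lambda>y. fd F y d) x b) (image_of c)"
    by (intro smooth_on_sum smooth_on_mult smooth_on_linear_comp[OF bounded_linear_inner_left] H.V
        H.smooth_raise smooth_on_fd F)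
  then have "continuous_on (image_of c) (\<lambda>x. \<Sum>b\<in>Basis. \<Sum>d\<in>Basis. (raise (H.g x) b \<bullet> d) * fd (\<lambda>y. fd F y d) x b)"
    by (rule smooth_on_continuous)
  moreover have "(\<Sum>d\<in>Basis. (u \<bullet> d) * fd (\<lambda>y. fd F y d) x b) = fd (\<lambda>y. fd F y u) x b" if "x \<in> image_of c" for u x b
    using linear_sum_Basis[OF linear_fd_parameter[OF H.V that linear_fd[OF F] smooth_on_fd[OF F]], of u b] by simp
  ultimately show ?thesis
    by (simp add: tr_def field_g[OF c] flip: F_def cong: continuous_on_cong_simp)
qed

end

section \<open>Consequences of the weak equation on the manifold\<close>

context hermitian_measure
begin

lemma star_chart:
  assumes weak: "\<And>\<alpha>. differential_form A 1 \<alpha> \<Longrightarrow> (\<integral>p. form_inner A \<omega> 2 (ext_d \<alpha>) \<omega> p \<partial>\<mu>) = 0"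
    and c: "c \<in> A" and x: "x \<in> image_of c"
  shows "tr (hermitian_field.g (\<lambda>y v w. \<omega> c y [v, w]) x)
    (hermitian_field.star_form (\<lambda>y v w. \<omega> c y [v, w]) x w) = 0"
proof -
  interpret H: hermitian_field "image_of c" "\<lambda>y v w. \<omega> c y [v, w]" by (rule field[OF c])
  show ?thesis
  proof (rule H.star_of_weak[OF _ x])
    fix \<phi> :: "complex^'n \<Rightarrow> real" and K l
    assume \<phi>: "smooth_on \<phi> UNIV" and K: "compact K" "K \<subseteq> image_of c" and \<phi>0: "\<And>x. x \<notin> K \<Longrightarrow> \<phi> x = 0"
    define k where "k x = fd \<phi> x (J (raise (metric_of \<omega> c x) l))" for x
    have "smooth_on (\<lambda>x. \<Sum>b\<in>Basis. (J (raise (H.g x) l) \<bullet> b) * fd \<phi> x b) (image_of c)"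
      by (intro smooth_on_sum smooth_on_mult smooth_on_linear_comp[OF bounded_linear_inner_left] H.V
          smooth_on_linear_comp[OF bounded_linear_J] H.smooth_raise smooth_on_fd smooth_on_subset[OF \<phi>]) simp
    moreover have "(\<Sum>b\<in>Basis. (u \<bullet> b) * fd \<phi> x b) = fd \<phi> x u" for u x
      using linear_sum_Basis[OF linear_fd[OF \<phi> UNIV_I], where v = u] by simp
    ultimately have "continuous_on (image_of c) k"
      unfolding k_def field_g[OF c] by (simp add: smooth_on_continuous)
    then have cont: "continuous_on (image_of c) (\<lambda>x. - k x)" by (rule continuous_on_minus)
    have "0 = (\<integral>p. form_inner A \<omega> 2 (ext_d (test_form c \<phi> l)) \<omega> p \<partial>\<mu>)"
      using weak[OF differential_form_test_form[OF c \<phi> K \<phi>0]] by simp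
    also have "\<dots> = integral\<^sup>L lborel (\<lambda>x. if x \<in> image_of c then volume_density (metric_of \<omega> c x) * - k x else 0)"
      by (rule integral_chart[OF c _ cont]) (simp add: form_inner_test_form[OF c \<phi> K \<phi>0] k_def)
    also have "\<dots> = integral\<^sup>L lborel (\<lambda>x. - (if x \<in> image_of c then volume_density (metric_of \<omega> c x) * k x else 0))"
      by (rule Bochner_Integration.integral_cong) auto
    finally have "integral\<^sup>L lborel (\<lambda>x. if x \<in> image_of c then volume_density (metric_of \<omega> c x) * k x else 0) = 0"
      by simp
    then show "integral\<^sup>L lborel (\<lambda>x. if x \<in> image_of c
        then volume_density (H.g x) * fd \<phi> x (J (raise (H.g x) l)) else 0) = 0"
      unfolding k_def field_g[OF c] .
  qed
qed

text \<open>By \<open>weak\<close> for the 1-form d^c f, the trace of the Hessian has integral 0. It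
  is continuous and nonnegative, so it vanishes everywhere.\<close>

lemma laplacian_eq_0:
  assumes weak: "\<And>\<alpha>. differential_form A 1 \<alpha> \<Longrightarrow> (\<integral>p. form_inner A \<omega> 2 (ext_d \<alpha>) \<omega> p \<partial>\<mu>) = 0"
    and X: "compact_space X" and f: "smooth_function A f"
    and nonneg: "\<And>c x. c \<in> A \<Longrightarrow> x \<in> image_of c \<Longrightarrow>
      tr (metric_of \<omega> c x) (\<lambda>a b. fd (\<lambda>y. fd (f \<circ> inv_chart c) y b) x a) \<ge> 0"
    and c: "c \<in> A" and x: "x \<in> image_of c"
  shows "tr (metric_of \<omega> c x) (\<lambda>a b. fd (\<lambda>y. fd (f \<circ> inv_chart c) y b) x a) = 0"
proof -
  let ?h = "form_inner A \<omega> 2 (ext_d (dc_form f)) \<omega>"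
  let ?p = "inv_chart c x"
  have p: "?p \<in> fst c" by (rule inv_chart_mem[OF x])
  have "?h ?p = 0"
  proof (rule continuous_nonneg_integral_eq_0[OF X])
    show "continuous_map X euclidean ?h"
      by (rule continuous_map_local[OF form_inner_dc_form[OF f] continuous_laplacian[OF f]])
    show "?h q \<ge> 0" if "q \<in> topspace X" for q
    proof -
      obtain c where c: "c \<in> A" "q \<in> fst c" using ex_chart[OF \<open>q \<in> topspace X\<close>] by blast
      then show ?thesis
        using form_inner_dc_form[OF f c] nonneg[OF c(1) image_of_mem[OF c(2)]] by simp
    qed
    show "integral\<^sup>L \<mu> ?h = 0" by (rule weak[OF differential_form_dc_form[OF f]])
    show "?p \<in> topspace X" using p chart_subset[OF c] by blast
  qed
  then show ?thesis using form_inner_dc_form[OF f c p] x by simp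
qed

end

section \<open>The conclusion\<close>

lemma balanced_weak:
  assumes "balanced X A \<omega>"
  obtains \<mu> where "is_volume_measure X A \<omega> \<mu>"
    "\<And>\<alpha>. differential_form A 1 \<alpha> \<Longrightarrow> (\<integral>p. form_inner A \<omega> 2 (ext_d \<alpha>) \<omega> p \<partial>\<mu>) = 0"
proof -
  have 0: "form_inner A \<omega> 1 \<alpha> (\<lambda>c x vs. 0) = (\<lambda>p. 0)" for \<alpha>
    by (simp add: form_inner_def covector_inner_def Let_def fun_eq_iff)
  obtain \<mu> where "is_volume_measure X A \<omega> \<mu>" and "\<forall>\<alpha>. differential_form A 1 \<alpha> \<longrightarrow>
      (\<integral>p. form_inner A \<omega> (Suc 1) (ext_d \<alpha>) \<omega> p \<partial>\<mu>) = (\<integral>p. form_inner A \<omega> 1 \<alpha> (\<lambda>c x vs. 0) p \<partial>\<mu>)"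
    using assms unfolding balanced_def is_codifferential_def by blast
  then show ?thesis using that[of \<mu>] by (simp add: 0[unfolded One_nat_def] numeral_2_eq_2)
qed

theorem lemma5p5:
  fixes X :: "'m topology"
    and A :: "('m, 'n::finite) chart set"
    and \<omega> :: "('m, 'n) form"
    and f :: "'m \<Rightarrow> real"
  assumes "complex_manifold X A" and "compact_space X"
    and "hermitian_metric A \<omega>" and "pluriclosed A \<omega>"
    and "smooth_function A f" and "balanced X A (conformal f \<omega>)"
  shows "kaehler_metric A \<omega> \<and> kaehler_metric A (conformal f \<omega>)"
proof -
  interpret M: hermitian_mfd X A \<omega> by unfold_locales (rule assms)+
  obtain \<mu> where \<mu>: "is_volume_measure X A (conformal f \<omega>) \<mu>"
    and weak: "\<And>\<alpha>. differential_form A 1 \<alpha> \<Longrightarrow>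
      (\<integral>p. form_inner A (conformal f \<omega>) 2 (ext_d \<alpha>) (conformal f \<omega>) p \<partial>\<mu>) = 0"
    using balanced_weak[OF assms(6)] by blast
  \<comment> \<open>Two metrics are in play: pluriclosedness and the norm identity concern \<omega>,
    whereas the weak equation and the measure belong to the conformal metric.\<close>
  interpret C: hermitian_measure X A "conformal f \<omega>" \<mu>
    by unfold_locales (rule M.hermitian_conformal[OF assms(5)] \<mu>)+
  define m where "m = DIM(complex^'n)"
  have m: "m \<ge> 2" by (simp add: m_def Suc_le_eq)
  define F where "F c = f \<circ> inv_chart c" for c :: "('m, 'n) chart"
  have F: "smooth_on (F c) (image_of c)" if "c \<in> A" for c
    using assms(5) that by (simp add: F_def smooth_function_def)
  have conf: "(\<lambda>y v w. conformal f \<omega> c y [v, w]) = (\<lambda>y v w. exp (F c y) * \<omega> c y [v, w])" for c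
    by (simp add: conformal_def F_def)
  let ?W = "\<lambda>c y v w. \<omega> c y [v, w]"
  let ?L = "\<lambda>c x. tr (metric_of \<omega> c x) (\<lambda>a b. fd (\<lambda>y. fd (F c) y b) x a)"
  have star: "tr (hermitian_field.g (?W c) x) (hermitian_field.star_form (?W c) x w) +
      (m / 2 - 1) * fd (F c) x (J w) = 0" if c: "c \<in> A" and x: "x \<in> image_of c" for c x w
    using hermitian_field.conformal_star[OF M.field[OF c] F[OF c] x] C.star_chart[OF weak c x]
    by (simp add: conf m_def)
  have norm: "(\<Sum>i\<in>E. \<Sum>j\<in>E. \<Sum>k\<in>E. (hermitian_field.dW (?W c) x i j k)\<^sup>2) = 3 * real (m - 2) * ?L c x"
    if c: "c \<in> A" and x: "x \<in> image_of c" and E: "onb (hermitian_field.g (?W c) x) E" for c x E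
  proof -
    interpret H: hermitian_field "image_of c" "?W c" by (rule M.field[OF c])
    have "H.ddcW x u v w z = 0" for u v w z
      using assms(4) c x M.ext_d_ext_dc_eq_ddcW[OF c x, of u v w z]
      by (simp add: pluriclosed_def form_vanishes_def)
    from H.dW_norm_eq_laplacian[OF F[OF c] x E star[OF c, unfolded m_def] this]
    have "(\<Sum>i\<in>E. \<Sum>j\<in>E. \<Sum>k\<in>E. (H.dW x i j k)\<^sup>2) = 3 * real (m - 2) * (\<Sum>e\<in>E. fd (\<lambda>y. fd (F c) y e) x e)"
      by (simp add: m_def)
    also have "bilinear (\<lambda>a b. fd (\<lambda>y. fd (F c) y b) x a)"
      unfolding bilinear_def
      using linear_fd_parameter[OF H.V x linear_fd[OF F[OF c]] smooth_on_fd[OF F[OF c]]]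
        linear_fd[OF smooth_on_fd[OF F[OF c]] x] by blast
    then have "(\<Sum>e\<in>E. fd (\<lambda>y. fd (F c) y e) x e) = ?L c x"
      using tr_onb[OF H.metric_g[OF x] E] M.field_g[OF c] by simp
    finally show ?thesis .
  qed
  \<comment> \<open>The traces for the two metrics differ by a positive factor, so the sign found
    for \<omega> can be used in the integral over the conformal metric.\<close>
  have L_conf: "tr (metric_of (conformal f \<omega>) c x) (\<lambda>a b. fd (\<lambda>y. fd (F c) y b) x a) = ?L c x / exp (F c x)"
    if c: "c \<in> A" and x: "x \<in> image_of c" for c x
  proof -
    have "bilinear (\<lambda>a b. fd (\<lambda>y. fd (F c) y b) x a)"
      unfolding bilinear_def
      using linear_fd_parameter[OF M.open_image[OF c] x linear_fd[OF F[OF c]] smooth_on_fd[OF F[OF c]]]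
        linear_fd[OF smooth_on_fd[OF F[OF c]] x] by blast
    moreover have "metric_of (conformal f \<omega>) c x = (\<lambda>v w. exp (F c x) * metric_of \<omega> c x v w)"
      by (simp add: fun_eq_iff metric_of_def conformal_def F_def)
    ultimately show ?thesis
      using tr_scale[OF M.metric_tensor_metric_of[OF c x] exp_gt_zero] by simp
  qed
  \<comment> \<open>The factor joins both cases: for m = 2 it is zero and nothing is said about the
    trace, and the product is all that \<open>norm\<close> requires to give d\<omega> = 0.\<close>
  have mL: "real (m - 2) * ?L c x = 0" if c: "c \<in> A" and x: "x \<in> image_of c" for c x
  proof (cases "m = 2")
    case False
    have nonneg: "?L c x \<ge> 0" if c: "c \<in> A" and x: "x \<in> image_of c" for c x
    proof -
      obtain E where E: "onb (hermitian_field.g (?W c) x) E"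
        using ex_onb M.metric_tensor_metric_of[OF c x] M.field_g[OF c] by metis
      have "0 \<le> 3 * real (m - 2) * ?L c x"
        unfolding norm[OF c x E, symmetric] by (intro sum_nonneg) simp
      then show ?thesis using False m by (simp add: zero_le_mult_iff)
    qed
    have "tr (metric_of (conformal f \<omega>) c x) (\<lambda>a b. fd (\<lambda>y. fd (F c) y b) x a) = 0"
      unfolding F_def
    proof (rule C.laplacian_eq_0[OF weak assms(2,5) _ c x])
      fix c x assume cx: "c \<in> A" "x \<in> image_of c"
      show "0 \<le> tr (metric_of (conformal f \<omega>) c x) (\<lambda>a b. fd (\<lambda>y. fd (f \<circ> inv_chart c) y b) x a)"
        using L_conf[OF cx] nonneg[OF cx] unfolding F_def by simp
    qed
    then show ?thesis using L_conf[OF c x] by simp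
  qed simp
  have dW: "hermitian_field.dW (?W c) x u v w = 0" if c: "c \<in> A" and x: "x \<in> image_of c" for c x u v w
  proof -
    interpret H: hermitian_field "image_of c" "?W c" by (rule M.field[OF c])
    obtain E where E: "onb (H.g x) E" using ex_onb[OF H.metric_g[OF x]] .
    show ?thesis
      by (rule H.dW_eq_0_of_norm[OF x E]) (use norm[OF c x E] mL[OF c x] in simp)
  qed
  have "hermitian_field.dW (\<lambda>y v w. conformal f \<omega> c y [v, w]) x u v w = 0"
    if c: "c \<in> A" and x: "x \<in> image_of c" for c x u v w
  proof -
    interpret H: hermitian_field "image_of c" "?W c" by (rule M.field[OF c])
    interpret K: hermitian_field "image_of c" "\<lambda>y v w. exp (F c y) * \<omega> c y [v, w]"
      by (rule H.conformal_hermitian_field[OF F[OF c]])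
    show ?thesis
    proof (cases "m = 2")
      case True
      then show ?thesis unfolding conf by (intro K.dW_eq_0_dim2[OF x]) (simp add: m_def)
    next
      case False
      have "(m / 2 - 1) * fd (F c) x v = 0" for v
        by (rule H.dF_eq_0_of_dW_eq_0[OF x star[OF c x] dW[OF c x]])
      then have "fd (F c) x v = 0" for v using False by simp
      then show ?thesis
        \<comment> \<open>Since dF = 0 at the point, the first derivatives of e^F \<omega> there are
          e^F times those of \<omega>.\<close>
        using dW[OF c x, of u v w]
        by (simp add: conf K.dW_def H.dW_def H.conformal_D1[OF F[OF c] x] flip: distrib_left right_diff_distrib)
    qed
  qed
  then show ?thesis using M.kaehlerI[OF dW] C.kaehlerI by blast
qed

end
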